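(* Let $\mathcal V$ be a symmetric monoidal closed category which is locally $\lambda$-presentable as a closed category, and let $\mathcal G\subseteq\mathcal V_\lambda$ be a generator of $\mathcal V_0$. For every $\lambda$-ary language $\mathbb L$ over $\mathcal V$ and every extended $\lambda$-ary equational $\mathbb L$-theory $\mathbb E$, the $\mathcal V$-category $\mathbf{Mod}(\mathbb E)$ is isomorphic, as a $\mathcal V$-category over $\mathcal V$, to $\mathbf{Mod}(\mathbb E')$ for some $\lambda$-ary equational $\mathbb L'$-theory $\mathbb E'$, over some $\lambda$-ary language $\mathbb L'$, such that the terms occurring as sides of the equations of $\mathbb E'$: (1) have output arity in $\mathcal G$; (2) are obtained by restricting the power-term rule (rule (3) in the recursive definition of terms) only to $Z\in\mathcal G$.
   Context: Setting. $\mathcal V=(\mathcal V_0,\otimes,I)$ is a symmetric monoidal closed category with internal hom $A^X:=[X,A]$, and $\lambda$ is a regular cardinal such that $\mathcal V$ is locally $\lambda$-presentable as a closed category: $\mathcal V_0$ is locally $\lambda$-presentable and the full subcategory $\mathcal V_\lambda$ of $\lambda$-presentable objects contains $I$ and is closed under $\otimes$. A set $\mathcal G$ of objects is a generator of $\mathcal V_0$ if the functors $\mathcal V_0(G,-)$, $G\in\mathcal G$, are jointly faithful. Languages and structures. A $\lambda$-ary language $\mathbb L$ over $\mathcal V$ is a set of function symbols $f:(X,Y)$ with input arity $X$ and output arity $Y$ in $\mathcal V_\lambda$. An $\mathbb L$-structure is an object $A\in\mathcal V$ with a morphism $f_A\colon A^X\to A^Y$ in $\mathcal V$ for each $f:(X,Y)$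 in $\mathbb L$. A morphism of $\mathbb L$-structures is $h\colon A\to B$ in $\mathcal V$ with $h^Y f_A=f_B h^X$ for all $f$. $\mathbb L$-structures form a $\mathcal V$-category $\mathbf{Str}(\mathbb L)$ in which $\mathbf{Str}(\mathbb L)(A,B)$ is the joint equalizer, over all $f:(X,Y)$ in $\mathbb L$, of the two maps $[A,B]\rightrightarrows[A^X,B^Y]$ given by $h\mapsto f_B h^X$ and $h\mapsto h^Yf_A$. The forgetful $\mathcal V$-functor $U\colon\mathbf{Str}(\mathbb L)\to\mathcal V$ has a left adjoint $F$. Terms. The $\lambda$-ary $\mathbb L$-terms, each of an arity $(X,Y)$ ($X$ input, $Y$ output arity) with $X,Y\in\mathcal V_\lambda$, and their interpretations $t_A\colon A^X\to A^Y$ in an $\mathbb L$-structure $A$, are defined recursively: (1) every morphism $f\colon Y\to X$ of $\mathcal V_\lambda$ is an $(X,Y)$-ary term, with $f_A=A^f$; (2) every function symbol $f:(X,Y)$ of $\mathbb L$ is an $(X,Y)$-ary term, interpreted as $f_A$; (3) if $t$ is an $(X,Y)$-ary term and $Z\in\mathcal V_\lambda$, then $t^Z$ is a $(Z\otimes X,Z\otimes Y)$-ary term, interpreted as $(t_A)^Z$ via $(A^X)^Z\cong A^{Z\otimes X}$, $(A^Y)^Z\cong A^{Z\otimes Y}$; (4) if $|J|<\lambda$, $t_j$ is an $(X_j,Y_j)$-ary term for $j\in J$, and $s$ is a $(\sum_j Y_j,W)$-ary term, then $s((t_j)_{j\in J})$ is a $(\sum_jX_j,W)$-ary term, interpreted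 as $A^{\sum X_j}\cong\prod_jA^{X_j}\xrightarrow{\prod (t_j)_A}\prod_jA^{Y_j}\cong A^{\sum Y_j}\xrightarrow{s_A}A^W$. Extended terms. An extended $\lambda$-ary term of arity $(X,Y)$, with $X,Y\in\mathcal V_\lambda$, is a morphism $t\colon FY\to FX$ in $\mathbf{Str}(\mathbb L)$; its interpretation in $A$ is $t_A\colon A^X\cong\mathbf{Str}(\mathbb L)(FX,A)\xrightarrow{\mathbf{Str}(\mathbb L)(t,A)}\mathbf{Str}(\mathbb L)(FY,A)\cong A^Y$. Equational theories. An (extended) $\lambda$-ary equational $\mathbb L$-theory $\mathbb E$ is a set of equations $(s=t)$ with $s,t$ (extended) $\lambda$-ary terms of the same arity. $\mathbf{Mod}(\mathbb E)$ is the full sub-$\mathcal V$-category of $\mathbf{Str}(\mathbb L)$ on those $A$ with $s_A=t_A$ in $\mathcal V$ for every $(s=t)$ in $\mathbb E$. "Isomorphic as a $\mathcal V$-category over $\mathcal V$" means: there is an isomorphism of $\mathcal V$-categories commuting with the forgetful $\mathcal V$-functors to $\mathcal V$. *)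

theory Defs
  imports Main "HOL-Library.FuncSet"
begin

unbundle cardinal_syntax

section \<open>Size\<close>

text \<open>
  ``Set'' versus ``class'' is rendered by a universe: \<open>\<kappa>\<close> is an uncountable strongly inaccessible
  cardinal on the type \<open>'u\<close>, and ``small'' (a set, in the sense of the mathematics) means of
  cardinality below \<open>\<kappa>\<close>.  Every small set has a copy inside \<open>'u\<close>, so small index sets and small
  index categories are taken, without loss of generality, with elements in \<open>'u\<close>.  The collection
  of objects of a category is not bounded by \<open>\<kappa>\<close>.

  The regular cardinal usually written lambda is called \<open>\<rho>\<close> throughout.
\<close>

definition small_universe :: "'u rel \<Rightarrow> bool" where
  "small_universe \<kappa> \<longleftrightarrow>
     Card_order \<kappa> \<and> natLeq <o \<kappa> \<and> regularCard \<kappa> \<and>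
     (\<forall>A :: 'u set. |A| <o \<kappa> \<longrightarrow> |Pow A| <o \<kappa>)"

definition small :: "'u rel \<Rightarrow> 'b set \<Rightarrow> bool" where
  "small \<kappa> A \<longleftrightarrow> |A| <o \<kappa>"

definition regular_cardinal :: "'l rel \<Rightarrow> bool" where
  "regular_cardinal \<rho> \<longleftrightarrow> Card_order \<rho> \<and> cinfinite \<rho> \<and> regularCard \<rho>"

section \<open>Categories and colimits\<close>

record ('o, 'a) cat =
  Ob  :: "'o set"
  Ar  :: "'a set"
  src :: "'a \<Rightarrow> 'o"
  trg :: "'a \<Rightarrow> 'o"
  idn :: "'o \<Rightarrow> 'a"
  cmp :: "'a \<Rightarrow> 'a \<Rightarrow> 'a"  (infixr \<open>\<cdot>\<index>\<close> 65)

definition Hom :: "('o, 'a, 'm) cat_scheme \<Rightarrow> 'o \<Rightarrow> 'o \<Rightarrow> 'a set" where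
  "Hom C X Y = {f \<in> Ar C. src C f = X \<and> trg C f = Y}"

locale category =
  fixes C :: "('o, 'a, 'm) cat_scheme" (structure)
  assumes src_closed: "f \<in> Ar C \<Longrightarrow> src C f \<in> Ob C"
    and trg_closed: "f \<in> Ar C \<Longrightarrow> trg C f \<in> Ob C"
    and idn_closed: "X \<in> Ob C \<Longrightarrow> idn C X \<in> Hom C X X"
    and cmp_closed: "\<lbrakk>g \<in> Hom C Y Z; f \<in> Hom C X Y\<rbrakk> \<Longrightarrow> g \<cdot> f \<in> Hom C X Z"
    and idn_left: "f \<in> Hom C X Y \<Longrightarrow> idn C Y \<cdot> f = f"
    and idn_right: "f \<in> Hom C X Y \<Longrightarrow> f \<cdot> idn C X = f"
    and cmp_assoc: "\<lbrakk>h \<in> Hom C Y Z; g \<in> Hom C X Y; f \<in> Hom C W X\<rbrakk>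
      \<Longrightarrow> (h \<cdot> g) \<cdot> f = h \<cdot> (g \<cdot> f)"

definition iso :: "('o, 'a, 'm) cat_scheme \<Rightarrow> 'a \<Rightarrow> bool" where
  "iso C f \<longleftrightarrow> f \<in> Ar C \<and>
     (\<exists>g \<in> Hom C (trg C f) (src C f).
        g \<cdot>\<^bsub>C\<^esub> f = idn C (src C f) \<and> f \<cdot>\<^bsub>C\<^esub> g = idn C (trg C f))"

definition inverse_ar :: "('o, 'a, 'm) cat_scheme \<Rightarrow> 'a \<Rightarrow> 'a" where
  "inverse_ar C f = (THE g. g \<in> Hom C (trg C f) (src C f) \<and>
     g \<cdot>\<^bsub>C\<^esub> f = idn C (src C f) \<and> f \<cdot>\<^bsub>C\<^esub> g = idn C (trg C f))"

text \<open>\<open>factor C e z\<close> is the factorization of \<open>z\<close> through the monomorphism \<open>e\<close>.\<close>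

definition factor :: "('o, 'a, 'm) cat_scheme \<Rightarrow> 'a \<Rightarrow> 'a \<Rightarrow> 'a" where
  "factor C e z = (THE g. g \<in> Hom C (src C z) (src C e) \<and> e \<cdot>\<^bsub>C\<^esub> g = z)"

definition is_functor ::
  "('i, 'j, 'm) cat_scheme \<Rightarrow> ('o, 'a, 'n) cat_scheme \<Rightarrow> ('i \<Rightarrow> 'o) \<Rightarrow> ('j \<Rightarrow> 'a) \<Rightarrow> bool" where
  "is_functor J C Do Da \<longleftrightarrow>
     (\<forall>i \<in> Ob J. Do i \<in> Ob C \<and> Da (idn J i) = idn C (Do i)) \<and>
     (\<forall>u \<in> Ar J. Da u \<in> Hom C (Do (src J u)) (Do (trg J u))) \<and>
     (\<forall>u \<in> Ar J. \<forall>v \<in> Ar J. trg J u = src J v \<longrightarrow> Da (v \<cdot>\<^bsub>J\<^esub> u) = Da v \<cdot>\<^bsub>C\<^esub> Da u)"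

definition is_cocone ::
  "('i, 'j, 'm) cat_scheme \<Rightarrow> ('o, 'a, 'n) cat_scheme \<Rightarrow> ('i \<Rightarrow> 'o) \<Rightarrow> ('j \<Rightarrow> 'a)
    \<Rightarrow> 'o \<Rightarrow> ('i \<Rightarrow> 'a) \<Rightarrow> bool" where
  "is_cocone J C Do Da c \<iota> \<longleftrightarrow> c \<in> Ob C \<and>
     (\<forall>i \<in> Ob J. \<iota> i \<in> Hom C (Do i) c) \<and>
     (\<forall>u \<in> Ar J. \<iota> (trg J u) \<cdot>\<^bsub>C\<^esub> Da u = \<iota> (src J u))"

definition is_colimit ::
  "('i, 'j, 'm) cat_scheme \<Rightarrow> ('o, 'a, 'n) cat_scheme \<Rightarrow> ('i \<Rightarrow> 'o) \<Rightarrow> ('j \<Rightarrow> 'a)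
    \<Rightarrow> 'o \<Rightarrow> ('i \<Rightarrow> 'a) \<Rightarrow> bool" where
  "is_colimit J C Do Da c \<iota> \<longleftrightarrow> is_cocone J C Do Da c \<iota> \<and>
     (\<forall>d \<delta>. is_cocone J C Do Da d \<delta> \<longrightarrow>
        (\<exists>!h. h \<in> Hom C c d \<and> (\<forall>i \<in> Ob J. h \<cdot>\<^bsub>C\<^esub> \<iota> i = \<delta> i)))"

definition is_coproduct ::
  "('o, 'a, 'm) cat_scheme \<Rightarrow> 'i set \<Rightarrow> ('i \<Rightarrow> 'o) \<Rightarrow> 'o \<Rightarrow> ('i \<Rightarrow> 'a) \<Rightarrow> bool" where
  "is_coproduct C J X c \<iota> \<longleftrightarrow> c \<in> Ob C \<and> (\<forall>j \<in> J. \<iota> j \<in> Hom C (X j) c) \<and>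
     (\<forall>d \<in> Ob C. \<forall>\<delta>. (\<forall>j \<in> J. \<delta> j \<in> Hom C (X j) d) \<longrightarrow>
        (\<exists>!h. h \<in> Hom C c d \<and> (\<forall>j \<in> J. h \<cdot>\<^bsub>C\<^esub> \<iota> j = \<delta> j)))"

text \<open>\<open>e\<close> is a joint equalizer of the parallel pairs \<open>u i, v i\<close> with source \<open>Y\<close>, for \<open>i \<in> I\<close>.\<close>

definition is_joint_equalizer ::
  "('o, 'a, 'm) cat_scheme \<Rightarrow> 'i set \<Rightarrow> 'o \<Rightarrow> ('i \<Rightarrow> 'a) \<Rightarrow> ('i \<Rightarrow> 'a) \<Rightarrow> 'a \<Rightarrow> bool" where
  "is_joint_equalizer C I Y u v e \<longleftrightarrow>
     e \<in> Ar C \<and> trg C e = Y \<and> (\<forall>i \<in> I. u i \<cdot>\<^bsub>C\<^esub> e = v i \<cdot>\<^bsub>C\<^esub> e) \<and>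
     (\<forall>z \<in> Ar C. trg C z = Y \<and> (\<forall>i \<in> I. u i \<cdot>\<^bsub>C\<^esub> z = v i \<cdot>\<^bsub>C\<^esub> z) \<longrightarrow>
        (\<exists>!g. g \<in> Hom C (src C z) (src C e) \<and> e \<cdot>\<^bsub>C\<^esub> g = z))"

definition small_category :: "'u rel \<Rightarrow> ('u, 'u) cat \<Rightarrow> bool" where
  "small_category \<kappa> J \<longleftrightarrow> category J \<and> small \<kappa> (Ob J) \<and> small \<kappa> (Ar J)"

definition cocomplete :: "'u rel \<Rightarrow> ('o, 'a, 'm) cat_scheme \<Rightarrow> bool" where
  "cocomplete \<kappa> C \<longleftrightarrow>
     (\<forall>(J :: ('u, 'u) cat) Do Da. small_category \<kappa> J \<and> is_functor J C Do Da \<longrightarrow>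
        (\<exists>c \<iota>. is_colimit J C Do Da c \<iota>))"

section \<open>Local presentability\<close>

text \<open>Every subgraph with fewer than \<open>\<rho>\<close> objects and arrows has a cocone; for
  \<open>S = {}\<close> this includes nonemptiness.\<close>

definition filtered :: "'l rel \<Rightarrow> ('u, 'u) cat \<Rightarrow> bool" where
  "filtered \<rho> J \<longleftrightarrow>
     (\<forall>S M. S \<subseteq> Ob J \<and> |S| <o \<rho> \<and> M \<subseteq> Ar J \<and> |M| <o \<rho> \<and> src J ` M \<subseteq> S \<and> trg J ` M \<subseteq> S \<longrightarrow>
        (\<exists>k \<in> Ob J. \<exists>c. (\<forall>s \<in> S. c s \<in> Hom J s k) \<and>
           (\<forall>m \<in> M. c (trg J m) \<cdot>\<^bsub>J\<^esub> m = c (src J m))))"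

text \<open>\<open>C(X, -)\<close> sends the cocone \<open>\<iota>\<close> to a colimit cocone of (small) sets.  The universal property
  in the category of sets is tested on small sets with elements in \<open>'u\<close>.\<close>

definition hom_preserves_colimit ::
  "'u rel \<Rightarrow> ('o, 'a, 'm) cat_scheme \<Rightarrow> 'o \<Rightarrow> ('u, 'u) cat \<Rightarrow> ('u \<Rightarrow> 'o) \<Rightarrow> ('u \<Rightarrow> 'a)
    \<Rightarrow> 'o \<Rightarrow> ('u \<Rightarrow> 'a) \<Rightarrow> bool" where
  "hom_preserves_colimit \<kappa> C X J Do Da c \<iota> \<longleftrightarrow>
     (\<forall>(T :: 'u set) \<phi>. small \<kappa> T \<and>
        (\<forall>i \<in> Ob J. \<phi> i \<in> Hom C X (Do i) \<rightarrow> T) \<and>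
        (\<forall>u \<in> Ar J. \<forall>f \<in> Hom C X (Do (src J u)). \<phi> (trg J u) (Da u \<cdot>\<^bsub>C\<^esub> f) = \<phi> (src J u) f) \<longrightarrow>
        (\<exists>!\<psi>. \<psi> \<in> Hom C X c \<rightarrow>\<^sub>E T \<and>
           (\<forall>i \<in> Ob J. \<forall>f \<in> Hom C X (Do i). \<psi> (\<iota> i \<cdot>\<^bsub>C\<^esub> f) = \<phi> i f)))"

definition presentable :: "'u rel \<Rightarrow> 'l rel \<Rightarrow> ('o, 'a, 'm) cat_scheme \<Rightarrow> 'o set" where
  "presentable \<kappa> \<rho> C = {X \<in> Ob C.
     \<forall>(J :: ('u, 'u) cat) Do Da c \<iota>.
       small_category \<kappa> J \<and> filtered \<rho> J \<and> is_functor J C Do Da \<and> is_colimit J C Do Da c \<iota>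
       \<longrightarrow> hom_preserves_colimit \<kappa> C X J Do Da c \<iota>}"

definition locally_presentable :: "'u rel \<Rightarrow> 'l rel \<Rightarrow> ('o, 'a, 'm) cat_scheme \<Rightarrow> bool" where
  "locally_presentable \<kappa> \<rho> C \<longleftrightarrow>
     category C \<and> (\<forall>X \<in> Ob C. \<forall>Y \<in> Ob C. small \<kappa> (Hom C X Y)) \<and> cocomplete \<kappa> C \<and>
     (\<exists>P. small \<kappa> P \<and> P \<subseteq> presentable \<kappa> \<rho> C \<and>
        (\<forall>A \<in> Ob C. \<exists>(J :: ('u, 'u) cat) Do Da \<iota>.
           small_category \<kappa> J \<and> filtered \<rho> J \<and> is_functor J C Do Da \<and> Do ` Ob J \<subseteq> P \<and>
           is_colimit J C Do Da A \<iota>))"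

definition generator :: "'u rel \<Rightarrow> ('o, 'a, 'm) cat_scheme \<Rightarrow> 'o set \<Rightarrow> bool" where
  "generator \<kappa> C \<G> \<longleftrightarrow> small \<kappa> \<G> \<and> \<G> \<subseteq> Ob C \<and>
     (\<forall>X \<in> Ob C. \<forall>Y \<in> Ob C. \<forall>f \<in> Hom C X Y. \<forall>g \<in> Hom C X Y.
        (\<forall>G \<in> \<G>. \<forall>h \<in> Hom C G X. f \<cdot>\<^bsub>C\<^esub> h = g \<cdot>\<^bsub>C\<^esub> h) \<longrightarrow> f = g)"

section \<open>Symmetric monoidal closed categories\<close>

text \<open>\<open>ihom V X A\<close> is \<open>[X, A] = A^X\<close>, with counit \<open>ev V X A : [X, A] \<otimes> X \<rightarrow> A\<close>.\<close>

record ('o, 'a) smc = "('o, 'a) cat" +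
  tensor    :: "'o \<Rightarrow> 'o \<Rightarrow> 'o"  (infixr \<open>\<otimes>\<index>\<close> 70)
  tensor_ar :: "'a \<Rightarrow> 'a \<Rightarrow> 'a"  (infixr \<open>\<odot>\<index>\<close> 70)
  unit_ob   :: "'o"
  assoc     :: "'o \<Rightarrow> 'o \<Rightarrow> 'o \<Rightarrow> 'a"
  lunit     :: "'o \<Rightarrow> 'a"
  runit     :: "'o \<Rightarrow> 'a"
  braid     :: "'o \<Rightarrow> 'o \<Rightarrow> 'a"
  ihom      :: "'o \<Rightarrow> 'o \<Rightarrow> 'o"
  ev        :: "'o \<Rightarrow> 'o \<Rightarrow> 'a"

locale symmetric_monoidal_closed = category V
  for V :: "('o, 'a, 'm) smc_scheme" (structure) +
  assumes tensor_closed: "\<lbrakk>X \<in> Ob V; Y \<in> Ob V\<rbrakk> \<Longrightarrow> X \<otimes> Y \<in> Ob V"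
    and tensor_ar_closed: "\<lbrakk>f \<in> Hom V X X'; g \<in> Hom V Y Y'\<rbrakk>
      \<Longrightarrow> f \<odot> g \<in> Hom V (X \<otimes> Y) (X' \<otimes> Y')"
    and tensor_idn: "\<lbrakk>X \<in> Ob V; Y \<in> Ob V\<rbrakk> \<Longrightarrow> idn V X \<odot> idn V Y = idn V (X \<otimes> Y)"
    and tensor_cmp: "\<lbrakk>f \<in> Hom V X X'; f' \<in> Hom V X' X''; g \<in> Hom V Y Y'; g' \<in> Hom V Y' Y''\<rbrakk>
      \<Longrightarrow> (f' \<cdot> f) \<odot> (g' \<cdot> g) = (f' \<odot> g') \<cdot> (f \<odot> g)"
    and unit_closed: "unit_ob V \<in> Ob V"
    and assoc_closed: "\<lbrakk>X \<in> Ob V; Y \<in> Ob V; Z \<in> Ob V\<rbrakk>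
      \<Longrightarrow> assoc V X Y Z \<in> Hom V ((X \<otimes> Y) \<otimes> Z) (X \<otimes> (Y \<otimes> Z))"
    and assoc_iso: "\<lbrakk>X \<in> Ob V; Y \<in> Ob V; Z \<in> Ob V\<rbrakk> \<Longrightarrow> iso V (assoc V X Y Z)"
    and assoc_natural: "\<lbrakk>f \<in> Hom V X X'; g \<in> Hom V Y Y'; h \<in> Hom V Z Z'\<rbrakk>
      \<Longrightarrow> assoc V X' Y' Z' \<cdot> ((f \<odot> g) \<odot> h) = (f \<odot> (g \<odot> h)) \<cdot> assoc V X Y Z"
    and lunit_closed: "X \<in> Ob V \<Longrightarrow> lunit V X \<in> Hom V (unit_ob V \<otimes> X) X"
    and lunit_iso: "X \<in> Ob V \<Longrightarrow> iso V (lunit V X)"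
    and lunit_natural: "f \<in> Hom V X X'
      \<Longrightarrow> lunit V X' \<cdot> (idn V (unit_ob V) \<odot> f) = f \<cdot> lunit V X"
    and runit_closed: "X \<in> Ob V \<Longrightarrow> runit V X \<in> Hom V (X \<otimes> unit_ob V) X"
    and runit_iso: "X \<in> Ob V \<Longrightarrow> iso V (runit V X)"
    and runit_natural: "f \<in> Hom V X X'
      \<Longrightarrow> runit V X' \<cdot> (f \<odot> idn V (unit_ob V)) = f \<cdot> runit V X"
    and braid_closed: "\<lbrakk>X \<in> Ob V; Y \<in> Ob V\<rbrakk> \<Longrightarrow> braid V X Y \<in> Hom V (X \<otimes> Y) (Y \<otimes> X)"
    and braid_natural: "\<lbrakk>f \<in> Hom V X X'; g \<in> Hom V Y Y'\<rbrakk>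
      \<Longrightarrow> braid V X' Y' \<cdot> (f \<odot> g) = (g \<odot> f) \<cdot> braid V X Y"
    and pentagon: "\<lbrakk>W \<in> Ob V; X \<in> Ob V; Y \<in> Ob V; Z \<in> Ob V\<rbrakk>
      \<Longrightarrow> (idn V W \<odot> assoc V X Y Z) \<cdot> assoc V W (X \<otimes> Y) Z \<cdot> (assoc V W X Y \<odot> idn V Z)
          = assoc V W X (Y \<otimes> Z) \<cdot> assoc V (W \<otimes> X) Y Z"
    and triangle: "\<lbrakk>X \<in> Ob V; Y \<in> Ob V\<rbrakk>
      \<Longrightarrow> (idn V X \<odot> lunit V Y) \<cdot> assoc V X (unit_ob V) Y = runit V X \<odot> idn V Y"
    and hexagon: "\<lbrakk>X \<in> Ob V; Y \<in> Ob V; Z \<in> Ob V\<rbrakk>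
      \<Longrightarrow> assoc V Y Z X \<cdot> braid V X (Y \<otimes> Z) \<cdot> assoc V X Y Z
          = (idn V Y \<odot> braid V X Z) \<cdot> assoc V Y X Z \<cdot> (braid V X Y \<odot> idn V Z)"
    and braid_symmetric: "\<lbrakk>X \<in> Ob V; Y \<in> Ob V\<rbrakk>
      \<Longrightarrow> braid V Y X \<cdot> braid V X Y = idn V (X \<otimes> Y)"
    and ihom_closed: "\<lbrakk>X \<in> Ob V; A \<in> Ob V\<rbrakk> \<Longrightarrow> ihom V X A \<in> Ob V"
    and ev_closed: "\<lbrakk>X \<in> Ob V; A \<in> Ob V\<rbrakk> \<Longrightarrow> ev V X A \<in> Hom V (ihom V X A \<otimes> X) A"
    and ev_universal: "\<lbrakk>X \<in> Ob V; Z \<in> Ob V; f \<in> Hom V (Z \<otimes> X) A\<rbrakk>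
      \<Longrightarrow> \<exists>!g. g \<in> Hom V Z (ihom V X A) \<and> ev V X A \<cdot> (g \<odot> idn V X) = f"

definition locally_presentable_closed ::
  "'u rel \<Rightarrow> 'l rel \<Rightarrow> ('o, 'a, 'm) smc_scheme \<Rightarrow> bool" where
  "locally_presentable_closed \<kappa> \<rho> V \<longleftrightarrow>
     symmetric_monoidal_closed V \<and> locally_presentable \<kappa> \<rho> V \<and>
     unit_ob V \<in> presentable \<kappa> \<rho> V \<and>
     (\<forall>X \<in> presentable \<kappa> \<rho> V. \<forall>Y \<in> presentable \<kappa> \<rho> V. X \<otimes>\<^bsub>V\<^esub> Y \<in> presentable \<kappa> \<rho> V)"

text \<open>The arrow \<open>Z \<rightarrow> [X, A]\<close> corresponding to \<open>f : Z \<otimes> X \<rightarrow> A\<close>.\<close>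

definition transp :: "('o, 'a, 'm) smc_scheme \<Rightarrow> 'o \<Rightarrow> 'o \<Rightarrow> 'o \<Rightarrow> 'a \<Rightarrow> 'a" where
  "transp V Z X A f =
     (THE g. g \<in> Hom V Z (ihom V X A) \<and> ev V X A \<cdot>\<^bsub>V\<^esub> (g \<odot>\<^bsub>V\<^esub> idn V X) = f)"

text \<open>Internal composition \<open>[B, C] \<otimes> [A, B] \<rightarrow> [A, C]\<close> and identities \<open>I \<rightarrow> [A, A]\<close>.\<close>

definition icmp :: "('o, 'a, 'm) smc_scheme \<Rightarrow> 'o \<Rightarrow> 'o \<Rightarrow> 'o \<Rightarrow> 'a" where
  "icmp V A B C = transp V (ihom V B C \<otimes>\<^bsub>V\<^esub> ihom V A B) A C
     (ev V B C \<cdot>\<^bsub>V\<^esub> (idn V (ihom V B C) \<odot>\<^bsub>V\<^esub> ev V A B) \<cdot>\<^bsub>V\<^esub> assoc V (ihom V B C) (ihom V A B) A)"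

definition iidn :: "('o, 'a, 'm) smc_scheme \<Rightarrow> 'o \<Rightarrow> 'a" where
  "iidn V A = transp V (unit_ob V) A A (lunit V A)"

text \<open>For \<open>f : Y \<rightarrow> X\<close>, \<open>pre V f A\<close> is \<open>A^f : A^X \<rightarrow> A^Y\<close>; for \<open>h : A \<rightarrow> B\<close>, \<open>post V X h\<close> is
  \<open>h^X : A^X \<rightarrow> B^X\<close>, and \<open>ipow V X A B : [A, B] \<rightarrow> [A^X, B^X]\<close> is the internal form of
  \<open>h \<mapsto> h^X\<close>.\<close>

definition pre :: "('o, 'a, 'm) smc_scheme \<Rightarrow> 'a \<Rightarrow> 'o \<Rightarrow> 'a" where
  "pre V f A = transp V (ihom V (trg V f) A) (src V f) A
     (ev V (trg V f) A \<cdot>\<^bsub>V\<^esub> (idn V (ihom V (trg V f) A) \<odot>\<^bsub>V\<^esub> f))"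

definition post :: "('o, 'a, 'm) smc_scheme \<Rightarrow> 'o \<Rightarrow> 'a \<Rightarrow> 'a" where
  "post V X h = transp V (ihom V X (src V h)) X (trg V h) (h \<cdot>\<^bsub>V\<^esub> ev V X (src V h))"

definition ipow :: "('o, 'a, 'm) smc_scheme \<Rightarrow> 'o \<Rightarrow> 'o \<Rightarrow> 'o \<Rightarrow> 'a" where
  "ipow V X A B = transp V (ihom V A B) (ihom V X A) (ihom V X B) (icmp V X A B)"

text \<open>The canonical isomorphism \<open>A^(Z \<otimes> X) \<rightarrow> (A^X)^Z\<close>.\<close>

definition curry_iso :: "('o, 'a, 'm) smc_scheme \<Rightarrow> 'o \<Rightarrow> 'o \<Rightarrow> 'o \<Rightarrow> 'a" where
  "curry_iso V Z X A = transp V (ihom V (Z \<otimes>\<^bsub>V\<^esub> X) A) Z (ihom V X A)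
     (transp V (ihom V (Z \<otimes>\<^bsub>V\<^esub> X) A \<otimes>\<^bsub>V\<^esub> Z) X A
        (ev V (Z \<otimes>\<^bsub>V\<^esub> X) A \<cdot>\<^bsub>V\<^esub> assoc V (ihom V (Z \<otimes>\<^bsub>V\<^esub> X) A) Z X))"

section \<open>Enriched categories\<close>

record ('c, 'o, 'a) vcat =
  VOb  :: "'c set"
  VHom :: "'c \<Rightarrow> 'c \<Rightarrow> 'o"
  VIdn :: "'c \<Rightarrow> 'a"
  VCmp :: "'c \<Rightarrow> 'c \<Rightarrow> 'c \<Rightarrow> 'a"

locale vcategory = symmetric_monoidal_closed V
  for V :: "('o, 'a, 'm) smc_scheme" (structure) and \<C> :: "('c, 'o, 'a) vcat" +
  assumes VHom_closed: "\<lbrakk>A \<in> VOb \<C>; B \<in> VOb \<C>\<rbrakk> \<Longrightarrow> VHom \<C> A B \<in> Ob V"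
    and VIdn_closed: "A \<in> VOb \<C> \<Longrightarrow> VIdn \<C> A \<in> Hom V (unit_ob V) (VHom \<C> A A)"
    and VCmp_closed: "\<lbrakk>A \<in> VOb \<C>; B \<in> VOb \<C>; D \<in> VOb \<C>\<rbrakk>
      \<Longrightarrow> VCmp \<C> A B D \<in> Hom V (VHom \<C> B D \<otimes> VHom \<C> A B) (VHom \<C> A D)"
    and VCmp_assoc: "\<lbrakk>A \<in> VOb \<C>; B \<in> VOb \<C>; D \<in> VOb \<C>; E \<in> VOb \<C>\<rbrakk>
      \<Longrightarrow> VCmp \<C> A B E \<cdot> (VCmp \<C> B D E \<odot> idn V (VHom \<C> A B))
          = VCmp \<C> A D E \<cdot> (idn V (VHom \<C> D E) \<odot> VCmp \<C> A B D)
              \<cdot> assoc V (VHom \<C> D E) (VHom \<C> B D) (VHom \<C> A B)"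
    and VIdn_left: "\<lbrakk>A \<in> VOb \<C>; B \<in> VOb \<C>\<rbrakk>
      \<Longrightarrow> VCmp \<C> A B B \<cdot> (VIdn \<C> B \<odot> idn V (VHom \<C> A B)) = lunit V (VHom \<C> A B)"
    and VIdn_right: "\<lbrakk>A \<in> VOb \<C>; B \<in> VOb \<C>\<rbrakk>
      \<Longrightarrow> VCmp \<C> A A B \<cdot> (idn V (VHom \<C> A B) \<odot> VIdn \<C> A) = runit V (VHom \<C> A B)"

record ('c, 'd, 'a) vfun =
  VFo :: "'c \<Rightarrow> 'd"
  VFh :: "'c \<Rightarrow> 'c \<Rightarrow> 'a"

locale vfunctor = source: vcategory V \<C> + target: vcategory V \<D>
  for V :: "('o, 'a, 'm) smc_scheme" (structure)
    and \<C> :: "('c, 'o, 'a) vcat" and \<D> :: "('d, 'o, 'a) vcat" and T :: "('c, 'd, 'a) vfun" +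
  assumes VFo_closed: "A \<in> VOb \<C> \<Longrightarrow> VFo T A \<in> VOb \<D>"
    and VFh_closed: "\<lbrakk>A \<in> VOb \<C>; B \<in> VOb \<C>\<rbrakk>
      \<Longrightarrow> VFh T A B \<in> Hom V (VHom \<C> A B) (VHom \<D> (VFo T A) (VFo T B))"
    and VFh_VIdn: "A \<in> VOb \<C> \<Longrightarrow> VFh T A A \<cdot> VIdn \<C> A = VIdn \<D> (VFo T A)"
    and VFh_VCmp: "\<lbrakk>A \<in> VOb \<C>; B \<in> VOb \<C>; D \<in> VOb \<C>\<rbrakk>
      \<Longrightarrow> VFh T A D \<cdot> VCmp \<C> A B D
          = VCmp \<D> (VFo T A) (VFo T B) (VFo T D) \<cdot> (VFh T B D \<odot> VFh T A B)"

definition self_vcat :: "('o, 'a, 'm) smc_scheme \<Rightarrow> ('o, 'o, 'a) vcat" where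
  "self_vcat V = \<lparr>VOb = Ob V, VHom = ihom V, VIdn = iidn V, VCmp = icmp V\<rparr>"

definition full_vsubcat :: "('c, 'o, 'a) vcat \<Rightarrow> 'c set \<Rightarrow> ('c, 'o, 'a) vcat" where
  "full_vsubcat \<C> S = \<C>\<lparr>VOb := VOb \<C> \<inter> S\<rparr>"

text \<open>Equality of V-functors \<open>\<C> \<rightarrow> \<D>\<close>, i.e. on the objects of \<open>\<C>\<close>, and composition.\<close>

definition vfun_eq :: "('c, 'o, 'a) vcat \<Rightarrow> ('c, 'd, 'a) vfun \<Rightarrow> ('c, 'd, 'a) vfun \<Rightarrow> bool" where
  "vfun_eq \<C> S T \<longleftrightarrow> (\<forall>A \<in> VOb \<C>. VFo S A = VFo T A) \<and>
     (\<forall>A \<in> VOb \<C>. \<forall>B \<in> VOb \<C>. VFh S A B = VFh T A B)"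

definition vfun_cmp ::
  "('o, 'a, 'm) smc_scheme \<Rightarrow> ('d, 'e, 'a) vfun \<Rightarrow> ('c, 'd, 'a) vfun \<Rightarrow> ('c, 'e, 'a) vfun" where
  "vfun_cmp V T S = \<lparr>VFo = \<lambda>A. VFo T (VFo S A),
     VFh = \<lambda>A B. VFh T (VFo S A) (VFo S B) \<cdot>\<^bsub>V\<^esub> VFh S A B\<rparr>"

definition vfun_idn :: "('o, 'a, 'm) smc_scheme \<Rightarrow> ('c, 'o, 'a) vcat \<Rightarrow> ('c, 'c, 'a) vfun" where
  "vfun_idn V \<C> = \<lparr>VFo = \<lambda>A. A, VFh = \<lambda>A B. idn V (VHom \<C> A B)\<rparr>"

text \<open>\<open>(\<C>, U)\<close> and \<open>(\<D>, U')\<close> are V-categories over V and are isomorphic as such.\<close>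

definition isomorphic_over ::
  "('o, 'a, 'm) smc_scheme \<Rightarrow> ('c, 'o, 'a) vcat \<Rightarrow> ('c, 'o, 'a) vfun
    \<Rightarrow> ('d, 'o, 'a) vcat \<Rightarrow> ('d, 'o, 'a) vfun \<Rightarrow> bool" where
  "isomorphic_over V \<C> U \<D> U' \<longleftrightarrow>
     vfunctor V \<C> (self_vcat V) U \<and> vfunctor V \<D> (self_vcat V) U' \<and>
     (\<exists>S T. vfunctor V \<C> \<D> S \<and> vfunctor V \<D> \<C> T \<and>
        vfun_eq \<C> (vfun_cmp V T S) (vfun_idn V \<C>) \<and>
        vfun_eq \<D> (vfun_cmp V S T) (vfun_idn V \<D>) \<and>
        vfun_eq \<C> (vfun_cmp V U' S) U)"

section \<open>Languages and structures\<close>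

record ('f, 'o) language =
  Sym   :: "'f set"
  inar  :: "'f \<Rightarrow> 'o"
  outar :: "'f \<Rightarrow> 'o"

definition is_language ::
  "'u rel \<Rightarrow> 'l rel \<Rightarrow> ('o, 'a, 'm) smc_scheme \<Rightarrow> ('f, 'o) language \<Rightarrow> bool" where
  "is_language \<kappa> \<rho> V L \<longleftrightarrow> small \<kappa> (Sym L) \<and>
     (\<forall>f \<in> Sym L. inar L f \<in> presentable \<kappa> \<rho> V \<and> outar L f \<in> presentable \<kappa> \<rho> V)"

text \<open>A structure is its underlying object with the family of interpretations of the symbols;
  the family is extensional, so that equality of structures is the intended one.\<close>

type_synonym ('o, 'a, 'f) struct = "'o \<times> ('f \<Rightarrow> 'a)"

definition structures ::
  "('o, 'a, 'm) smc_scheme \<Rightarrow> ('f, 'o) language \<Rightarrow> ('o, 'a, 'f) struct set" where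
  "structures V L = {(A, \<phi>). A \<in> Ob V \<and>
     \<phi> \<in> (\<Pi>\<^sub>E f \<in> Sym L. Hom V (ihom V (inar L f) A) (ihom V (outar L f) A))}"

definition struct_morphism ::
  "('o, 'a, 'm) smc_scheme \<Rightarrow> ('f, 'o) language
    \<Rightarrow> ('o, 'a, 'f) struct \<Rightarrow> ('o, 'a, 'f) struct \<Rightarrow> 'a \<Rightarrow> bool" where
  "struct_morphism V L A B h \<longleftrightarrow> h \<in> Hom V (fst A) (fst B) \<and>
     (\<forall>f \<in> Sym L. post V (outar L f) h \<cdot>\<^bsub>V\<^esub> snd A f = snd B f \<cdot>\<^bsub>V\<^esub> post V (inar L f) h)"

text \<open>The chosen joint equalizer \<open>Str(L)(A, B) \<rightarrow> [A, B]\<close> of the maps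
  \<open>[A, B] \<rightarrow> [A^X, B^Y]\<close> given by \<open>h \<mapsto> f_B h^X\<close> and \<open>h \<mapsto> h^Y f_A\<close>.\<close>

definition str_incl ::
  "('o, 'a, 'm) smc_scheme \<Rightarrow> ('f, 'o) language
    \<Rightarrow> ('o, 'a, 'f) struct \<Rightarrow> ('o, 'a, 'f) struct \<Rightarrow> 'a" where
  "str_incl V L A B = (SOME e. is_joint_equalizer V (Sym L) (ihom V (fst A) (fst B))
     (\<lambda>f. post V (ihom V (inar L f) (fst A)) (snd B f) \<cdot>\<^bsub>V\<^esub> ipow V (inar L f) (fst A) (fst B))
     (\<lambda>f. pre V (snd A f) (ihom V (outar L f) (fst B)) \<cdot>\<^bsub>V\<^esub> ipow V (outar L f) (fst A) (fst B))
     e)"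

definition Str ::
  "('o, 'a, 'm) smc_scheme \<Rightarrow> ('f, 'o) language \<Rightarrow> (('o, 'a, 'f) struct, 'o, 'a) vcat" where
  "Str V L = \<lparr>
     VOb = structures V L,
     VHom = \<lambda>A B. src V (str_incl V L A B),
     VIdn = \<lambda>A. factor V (str_incl V L A A) (iidn V (fst A)),
     VCmp = \<lambda>A B C. factor V (str_incl V L A C)
       (icmp V (fst A) (fst B) (fst C) \<cdot>\<^bsub>V\<^esub> (str_incl V L B C \<odot>\<^bsub>V\<^esub> str_incl V L A B))\<rparr>"

definition forget ::
  "('o, 'a, 'm) smc_scheme \<Rightarrow> ('f, 'o) language \<Rightarrow> (('o, 'a, 'f) struct, 'o, 'a) vfun" where
  "forget V L = \<lparr>VFo = fst, VFh = str_incl V L\<rparr>"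

text \<open>\<open>Str(L)(F X, A) \<rightarrow> [F X, A] \<rightarrow> [X, A]\<close>, the second map being restriction along
  \<open>\<eta> X : X \<rightarrow> F X\<close>.  Saying that these are isomorphisms says that \<open>F\<close>, with unit \<open>\<eta>\<close>, is left
  adjoint, as a V-functor, to the forgetful V-functor (the action of \<open>F\<close> on homs being determined
  by \<open>\<eta>\<close>).\<close>

definition adj_iso ::
  "('o, 'a, 'm) smc_scheme \<Rightarrow> ('f, 'o) language
    \<Rightarrow> ('o \<Rightarrow> ('o, 'a, 'f) struct) \<Rightarrow> ('o \<Rightarrow> 'a) \<Rightarrow> 'o \<Rightarrow> ('o, 'a, 'f) struct \<Rightarrow> 'a" where
  "adj_iso V L F \<eta> X A = pre V (\<eta> X) (fst A) \<cdot>\<^bsub>V\<^esub> str_incl V L (F X) A"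

definition left_adjoint_forget ::
  "('o, 'a, 'm) smc_scheme \<Rightarrow> ('f, 'o) language
    \<Rightarrow> ('o \<Rightarrow> ('o, 'a, 'f) struct) \<Rightarrow> ('o \<Rightarrow> 'a) \<Rightarrow> bool" where
  "left_adjoint_forget V L F \<eta> \<longleftrightarrow>
     (\<forall>X \<in> Ob V. F X \<in> structures V L \<and> \<eta> X \<in> Hom V X (fst (F X)) \<and>
        (\<forall>A \<in> structures V L. iso V (adj_iso V L F \<eta> X A)))"

section \<open>Terms and equational theories\<close>

text \<open>\<open>TSubst s J t P p Q q\<close> is \<open>s((t j) j\<in>J)\<close>.  As coproducts are determined only up to isomorphism,
  the term records those used for the two sums: \<open>(P, p)\<close> for the input arities of the \<open>t j\<close>, and
  \<open>(Q, q)\<close> for their output arities.  Values of \<open>t, p, q\<close> outside \<open>J\<close> are irrelevant.\<close>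

datatype ('o, 'a, 'f, 'u) trm =
    TMor 'a
  | TFun 'f
  | TPow 'o "('o, 'a, 'f, 'u) trm"
  | TSubst "('o, 'a, 'f, 'u) trm" "'u set" "'u \<Rightarrow> ('o, 'a, 'f, 'u) trm"
      'o "'u \<Rightarrow> 'a" 'o "'u \<Rightarrow> 'a"

text \<open>\<open>is_term \<kappa> \<rho> V L \<Z> t X Y\<close>: \<open>t\<close> is an \<open>(X, Y)\<close>-ary term in whose formation the power rule is
  used only for \<open>Z \<in> \<Z>\<close>.\<close>

inductive is_term ::
  "'u rel \<Rightarrow> 'l rel \<Rightarrow> ('o, 'a, 'm) smc_scheme \<Rightarrow> ('f, 'o) language \<Rightarrow> 'o set
    \<Rightarrow> ('o, 'a, 'f, 'u) trm \<Rightarrow> 'o \<Rightarrow> 'o \<Rightarrow> bool"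
  for \<kappa> \<rho> V L \<Z> where
  TMor: "\<lbrakk>X \<in> presentable \<kappa> \<rho> V; Y \<in> presentable \<kappa> \<rho> V; f \<in> Hom V Y X\<rbrakk>
    \<Longrightarrow> is_term \<kappa> \<rho> V L \<Z> (TMor f) X Y"
| TFun: "f \<in> Sym L \<Longrightarrow> is_term \<kappa> \<rho> V L \<Z> (TFun f) (inar L f) (outar L f)"
| TPow: "\<lbrakk>is_term \<kappa> \<rho> V L \<Z> t X Y; Z \<in> presentable \<kappa> \<rho> V; Z \<in> \<Z>\<rbrakk>
    \<Longrightarrow> is_term \<kappa> \<rho> V L \<Z> (TPow Z t) (Z \<otimes>\<^bsub>V\<^esub> X) (Z \<otimes>\<^bsub>V\<^esub> Y)"
| TSubst: "\<lbrakk>|J| <o \<rho>; \<And>j. j \<in> J \<Longrightarrow> is_term \<kappa> \<rho> V L \<Z> (t j) (X j) (Y j);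
     is_coproduct V J X P p; is_coproduct V J Y Q q; is_term \<kappa> \<rho> V L \<Z> s Q W\<rbrakk>
    \<Longrightarrow> is_term \<kappa> \<rho> V L \<Z> (TSubst s J t P p Q q) P W"

primrec in_arity ::
  "('o, 'a, 'm) smc_scheme \<Rightarrow> ('f, 'o) language \<Rightarrow> ('o, 'a, 'f, 'u) trm \<Rightarrow> 'o" where
  "in_arity V L (TMor f) = trg V f"
| "in_arity V L (TFun f) = inar L f"
| "in_arity V L (TPow Z t) = Z \<otimes>\<^bsub>V\<^esub> in_arity V L t"
| "in_arity V L (TSubst s J t P p Q q) = P"

primrec out_arity ::
  "('o, 'a, 'm) smc_scheme \<Rightarrow> ('f, 'o) language \<Rightarrow> ('o, 'a, 'f, 'u) trm \<Rightarrow> 'o" where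
  "out_arity V L (TMor f) = src V f"
| "out_arity V L (TFun f) = outar L f"
| "out_arity V L (TPow Z t) = Z \<otimes>\<^bsub>V\<^esub> out_arity V L t"
| "out_arity V L (TSubst s J t P p Q q) = out_arity V L s"

text \<open>In the clause for \<open>TSubst\<close>, \<open>A^P\<close> and \<open>A^Q\<close> are the products of the powers of \<open>A\<close>, with
  projections \<open>A^(p j)\<close> and \<open>A^(q j)\<close>; the arrow \<open>m\<close> is the product of the \<open>(t j)_A\<close>.\<close>

primrec interp ::
  "('o, 'a, 'm) smc_scheme \<Rightarrow> ('f, 'o) language \<Rightarrow> ('o, 'a, 'f) struct
    \<Rightarrow> ('o, 'a, 'f, 'u) trm \<Rightarrow> 'a" where
  "interp V L A (TMor f) = pre V f (fst A)"
| "interp V L A (TFun f) = snd A f"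
| "interp V L A (TPow Z t) =
     inverse_ar V (curry_iso V Z (out_arity V L t) (fst A))
       \<cdot>\<^bsub>V\<^esub> post V Z (interp V L A t) \<cdot>\<^bsub>V\<^esub> curry_iso V Z (in_arity V L t) (fst A)"
| "interp V L A (TSubst s J t P p Q q) =
     interp V L A s \<cdot>\<^bsub>V\<^esub>
       (THE m. m \<in> Hom V (ihom V P (fst A)) (ihom V Q (fst A)) \<and>
          (\<forall>j \<in> J. pre V (q j) (fst A) \<cdot>\<^bsub>V\<^esub> m = interp V L A (t j) \<cdot>\<^bsub>V\<^esub> pre V (p j) (fst A)))"

type_synonym ('o, 'a, 'f, 'u) eq_theory =
  "(('o, 'a, 'f, 'u) trm \<times> ('o, 'a, 'f, 'u) trm) set"

definition equational_theory ::
  "'u rel \<Rightarrow> 'l rel \<Rightarrow> ('o, 'a, 'm) smc_scheme \<Rightarrow> ('f, 'o) language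
    \<Rightarrow> ('o, 'a, 'f, 'u) eq_theory \<Rightarrow> bool" where
  "equational_theory \<kappa> \<rho> V L E \<longleftrightarrow> small \<kappa> E \<and>
     (\<forall>(s, t) \<in> E. \<exists>X Y. is_term \<kappa> \<rho> V L (presentable \<kappa> \<rho> V) s X Y \<and>
        is_term \<kappa> \<rho> V L (presentable \<kappa> \<rho> V) t X Y)"

definition Mod ::
  "('o, 'a, 'm) smc_scheme \<Rightarrow> ('f, 'o) language \<Rightarrow> ('o, 'a, 'f, 'u) eq_theory
    \<Rightarrow> (('o, 'a, 'f) struct, 'o, 'a) vcat" where
  "Mod V L E = full_vsubcat (Str V L) {A. \<forall>(s, t) \<in> E. interp V L A s = interp V L A t}"

text \<open>An extended term is recorded together with its arity, \<open>(X, Y, t)\<close> with \<open>t : F Y \<rightarrow> F X\<close>; an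
  equation between extended terms \<open>s, t\<close> of the same arity is \<open>(X, Y, s, t)\<close>.\<close>

definition is_ext_term ::
  "'u rel \<Rightarrow> 'l rel \<Rightarrow> ('o, 'a, 'm) smc_scheme \<Rightarrow> ('f, 'o) language
    \<Rightarrow> ('o \<Rightarrow> ('o, 'a, 'f) struct) \<Rightarrow> 'o \<Rightarrow> 'o \<Rightarrow> 'a \<Rightarrow> bool" where
  "is_ext_term \<kappa> \<rho> V L F X Y t \<longleftrightarrow>
     X \<in> presentable \<kappa> \<rho> V \<and> Y \<in> presentable \<kappa> \<rho> V \<and> struct_morphism V L (F Y) (F X) t"

text \<open>The middle factor is \<open>Str(L)(t, A) : Str(L)(F X, A) \<rightarrow> Str(L)(F Y, A)\<close>, the restriction of
  \<open>[t, A]\<close> to the joint equalizers.\<close>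

definition ext_interp ::
  "('o, 'a, 'm) smc_scheme \<Rightarrow> ('f, 'o) language \<Rightarrow> ('o \<Rightarrow> ('o, 'a, 'f) struct) \<Rightarrow> ('o \<Rightarrow> 'a)
    \<Rightarrow> ('o, 'a, 'f) struct \<Rightarrow> 'o \<Rightarrow> 'o \<Rightarrow> 'a \<Rightarrow> 'a" where
  "ext_interp V L F \<eta> A X Y t =
     adj_iso V L F \<eta> Y A
       \<cdot>\<^bsub>V\<^esub> factor V (str_incl V L (F Y) A) (pre V t (fst A) \<cdot>\<^bsub>V\<^esub> str_incl V L (F X) A)
       \<cdot>\<^bsub>V\<^esub> inverse_ar V (adj_iso V L F \<eta> X A)"

type_synonym ('o, 'a) ext_theory = "('o \<times> 'o \<times> 'a \<times> 'a) set"

definition ext_equational_theory ::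
  "'u rel \<Rightarrow> 'l rel \<Rightarrow> ('o, 'a, 'm) smc_scheme \<Rightarrow> ('f, 'o) language
    \<Rightarrow> ('o \<Rightarrow> ('o, 'a, 'f) struct) \<Rightarrow> ('o, 'a) ext_theory \<Rightarrow> bool" where
  "ext_equational_theory \<kappa> \<rho> V L F E \<longleftrightarrow> small \<kappa> E \<and>
     (\<forall>(X, Y, s, t) \<in> E. is_ext_term \<kappa> \<rho> V L F X Y s \<and> is_ext_term \<kappa> \<rho> V L F X Y t)"

definition ext_Mod ::
  "('o, 'a, 'm) smc_scheme \<Rightarrow> ('f, 'o) language \<Rightarrow> ('o \<Rightarrow> ('o, 'a, 'f) struct) \<Rightarrow> ('o \<Rightarrow> 'a)
    \<Rightarrow> ('o, 'a) ext_theory \<Rightarrow> (('o, 'a, 'f) struct, 'o, 'a) vcat" where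
  "ext_Mod V L F \<eta> E = full_vsubcat (Str V L)
     {A. \<forall>(X, Y, s, t) \<in> E. ext_interp V L F \<eta> A X Y s = ext_interp V L F \<eta> A X Y t}"

end

theory Submission
  imports Defs
begin

text \<open>Extended terms of arity \<open>(X, Y)\<close> correspond to arrows \<open>s : Y \<rightarrow> U F X\<close>.  The new language adds to \<open>L\<close>
  a symbol for each such \<open>s\<close>, with \<open>X\<close> and \<open>Y\<close> in a small set of arities containing a dense set \<open>P\<close>
  of presentable objects.  The equations say that the symbol of the unit is the identity, that
  symbols are compatible with arrows of arities, and that the symbol of \<open>f\<close> applied to
  \<open>r : Z \<otimes> X\<^sub>f \<rightarrow> U F X\<close> is the composite of the power \<open>f\<^sup>Z\<close> with the symbol of \<open>r\<close>, for \<open>Z\<close> in the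
  generator only.  Given an interpretation of the symbols on \<open>A\<close>, density glues them to one arrow
  \<open>[X, A] \<otimes> U F X \<rightarrow> A\<close>; the last equations make it a family of morphisms of structures (this can be
  tested on the generator), so freeness of \<open>F X\<close> forces every symbol to have its intended
  interpretation.  An equation of arity \<open>(X, Y)\<close> is equivalent to its restrictions along all
  \<open>g : G \<rightarrow> Y\<close> with \<open>G\<close> in the generator.

  Arrows into internal homs are handled through their transposes \<open>W \<otimes> X \<rightarrow> A\<close>.\<close>

section \<open>Symmetric monoidal closed categories\<close>

text \<open>The obstacle is that \<open>F X\<close> is known only by its universal property and that
  its underlying object is in general not presentable, so that it cannot serve as an arity: symbols
  reach it only through arrows into it from arities. Density recombines the symbols of all these
  arrows into one arrow out of the underlying object, where freeness applies; hence \<open>P\<close>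
  has to be among the output arities. The arities \<open>Z \<otimes> inar L f\<close> and
  \<open>Z \<otimes> outar L f\<close> are included so that an argument of \<open>f\<close> and its
  value both have symbols.

  Restricting to the generator loses nothing, for powers as for output arities, because V is closed:
  tensoring has a right adjoint, so the arrows from the generator into an object stay jointly
  epimorphic after tensoring.

  Arities are drawn from small sets because a language must be small, while nothing bounds the
  collection of all presentable objects. Models of the new theory are the expansions of models of
  the old one; extended operations commute with families of morphisms, so the expansion leaves the
  hom-objects unchanged.\<close>

context category
begin

text \<open>Membership in \<open>Hom\<close> is split, here and below, into facts about
  \<open>Ar\<close>, \<open>src\<close> and \<open>trg\<close>, so that the simplifier can type
  composites by itself and nest them to the right.\<close>

lemma Ob_src [simp]: "f \<in> Ar C \<Longrightarrow> src C f \<in> Ob C"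
  and Ob_trg [simp]: "f \<in> Ar C \<Longrightarrow> trg C f \<in> Ob C"
  by (auto intro: src_closed trg_closed)

lemma idn_ar [simp]: "X \<in> Ob C \<Longrightarrow> idn C X \<in> Ar C"
  and src_idn [simp]: "X \<in> Ob C \<Longrightarrow> src C (idn C X) = X"
  and trg_idn [simp]: "X \<in> Ob C \<Longrightarrow> trg C (idn C X) = X"
  using idn_closed by (auto simp: Hom_def)

lemma
  assumes "g \<in> Ar C" "f \<in> Ar C" "src C g = trg C f"
  shows cmp_ar [simp]: "g \<cdot> f \<in> Ar C"
    and src_cmp [simp]: "src C (g \<cdot> f) = src C f"
    and trg_cmp [simp]: "trg C (g \<cdot> f) = trg C g"
  using cmp_closed[of g "trg C f" "trg C g" f "src C f"] assms by (auto simp: Hom_def)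

lemma cmp_idn_l [simp]: "f \<in> Ar C \<Longrightarrow> trg C f = X \<Longrightarrow> idn C X \<cdot> f = f"
  and cmp_idn_r [simp]: "f \<in> Ar C \<Longrightarrow> src C f = X \<Longrightarrow> f \<cdot> idn C X = f"
  using idn_left[of f "src C f" "trg C f"] idn_right[of f "src C f" "trg C f"] by (auto simp: Hom_def)

lemma cmp_assoc' [simp]:
  "\<lbrakk>h \<in> Ar C; g \<in> Ar C; f \<in> Ar C; src C h = trg C g; src C g = trg C f\<rbrakk>
    \<Longrightarrow> (h \<cdot> g) \<cdot> f = h \<cdot> (g \<cdot> f)"
  by (rule cmp_assoc[of h "trg C g" "trg C h" g "trg C f" f "src C f"]) (auto simp: Hom_def)

lemma Hom_Ob: "f \<in> Hom C X Y \<Longrightarrow> X \<in> Ob C \<and> Y \<in> Ob C"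
  by (auto simp: Hom_def)

lemma inverse_unique:
  assumes "f \<in> Ar C" "g \<in> Hom C (trg C f) (src C f)" "h \<in> Hom C (trg C f) (src C f)"
    "g \<cdot> f = idn C (src C f)" "f \<cdot> h = idn C (trg C f)"
  shows "g = h"
proof -
  have "g = g \<cdot> (f \<cdot> h)" using assms(1-3,5) by (simp add: Hom_def)
  also have "\<dots> = (g \<cdot> f) \<cdot> h" using assms(1-3) by (simp add: Hom_def)
  also have "\<dots> = h" using assms(1-4) by (simp add: Hom_def)
  finally show ?thesis .
qed

lemma inverse_ar_eqI:
  assumes "f \<in> Ar C" "g \<in> Hom C (trg C f) (src C f)"
    "g \<cdot> f = idn C (src C f)" "f \<cdot> g = idn C (trg C f)"
  shows "inverse_ar C f = g"
  unfolding inverse_ar_def using assms inverse_unique by (intro the_equality) blast+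

lemma inverse_ar:
  assumes "iso C f"
  shows "inverse_ar C f \<in> Ar C" "src C (inverse_ar C f) = trg C f" "trg C (inverse_ar C f) = src C f"
    "inverse_ar C f \<cdot> f = idn C (src C f)" "f \<cdot> inverse_ar C f = idn C (trg C f)"
proof -
  obtain g where g: "f \<in> Ar C" "g \<in> Hom C (trg C f) (src C f)"
    "g \<cdot> f = idn C (src C f)" "f \<cdot> g = idn C (trg C f)"
    using assms by (auto simp: iso_def)
  show "inverse_ar C f \<in> Ar C" "src C (inverse_ar C f) = trg C f" "trg C (inverse_ar C f) = src C f"
    "inverse_ar C f \<cdot> f = idn C (src C f)" "f \<cdot> inverse_ar C f = idn C (trg C f)"
    using g inverse_ar_eqI[OF g] by (auto simp: Hom_def)
qed

lemma iso_cancel_right: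
  assumes "iso C f" "g \<in> Ar C" "h \<in> Ar C" "src C g = trg C f" "src C h = trg C f" "g \<cdot> f = h \<cdot> f"
  shows "g = h"
proof -
  have f: "f \<in> Ar C" using assms(1) by (simp add: iso_def)
  have "(g \<cdot> f) \<cdot> inverse_ar C f = (h \<cdot> f) \<cdot> inverse_ar C f" using assms by simp
  then show ?thesis using assms(2-5) f inverse_ar[OF assms(1)] by simp
qed

lemma iso_cancel_left:
  assumes "iso C f" "g \<in> Ar C" "h \<in> Ar C" "trg C g = src C f" "trg C h = src C f" "f \<cdot> g = f \<cdot> h"
  shows "g = h"
proof -
  have f: "f \<in> Ar C" using assms(1) by (simp add: iso_def)
  have "inverse_ar C f \<cdot> (f \<cdot> g) = inverse_ar C f \<cdot> (f \<cdot> h)" using assms by simp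
  then have "(inverse_ar C f \<cdot> f) \<cdot> g = (inverse_ar C f \<cdot> f) \<cdot> h"
    using assms(2-5) f inverse_ar(1-3)[OF assms(1)] by simp
  then show ?thesis using assms(2-5) f inverse_ar[OF assms(1)] by simp
qed

end

context symmetric_monoidal_closed
begin

lemma tensor_ob [simp]: "\<lbrakk>X \<in> Ob V; Y \<in> Ob V\<rbrakk> \<Longrightarrow> X \<otimes> Y \<in> Ob V"
  and unit_ob [simp]: "unit_ob V \<in> Ob V"
  and ihom_ob [simp]: "\<lbrakk>X \<in> Ob V; A \<in> Ob V\<rbrakk> \<Longrightarrow> ihom V X A \<in> Ob V"
  by (auto intro: tensor_closed unit_closed ihom_closed)

lemma
  assumes "f \<in> Ar V" "g \<in> Ar V"
  shows tensor_ar [simp]: "f \<odot> g \<in> Ar V"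
    and src_tensor [simp]: "src V (f \<odot> g) = src V f \<otimes> src V g"
    and trg_tensor [simp]: "trg V (f \<odot> g) = trg V f \<otimes> trg V g"
  using tensor_ar_closed[of f "src V f" "trg V f" g "src V g" "trg V g"] assms
  by (auto simp: Hom_def)

declare tensor_idn [simp]

lemma tensor_cmp' [simp]:
  "\<lbrakk>f \<in> Ar V; g \<in> Ar V; f' \<in> Ar V; g' \<in> Ar V; src V f' = trg V f; src V g' = trg V g\<rbrakk>
    \<Longrightarrow> (f' \<odot> g') \<cdot> (f \<odot> g) = (f' \<cdot> f) \<odot> (g' \<cdot> g)"
  using tensor_cmp[of f "src V f" "trg V f" f' "trg V f'" g "src V g" "trg V g" g' "trg V g'"]
  by (auto simp: Hom_def)

text \<open>Nesting to the right hides the redex of \<open>tensor_cmp'\<close> as soon as a further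
  factor \<open>h\<close> stands on the right; \<open>assoc_nat_assoc\<close> exists for the same
  reason.\<close>

lemma tensor_cmp_assoc [simp]:
  "\<lbrakk>f \<in> Ar V; g \<in> Ar V; f' \<in> Ar V; g' \<in> Ar V; src V f' = trg V f; src V g' = trg V g;
     h \<in> Ar V; trg V h = src V f \<otimes> src V g\<rbrakk>
    \<Longrightarrow> (f' \<odot> g') \<cdot> ((f \<odot> g) \<cdot> h) = ((f' \<cdot> f) \<odot> (g' \<cdot> g)) \<cdot> h"
  by (simp flip: cmp_assoc')

lemma assoc_ar [simp]:
  assumes "X \<in> Ob V" "Y \<in> Ob V" "Z \<in> Ob V"
  shows "assoc V X Y Z \<in> Ar V"
    and "src V (assoc V X Y Z) = (X \<otimes> Y) \<otimes> Z"
    and "trg V (assoc V X Y Z) = X \<otimes> (Y \<otimes> Z)"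
  using assoc_closed[OF assms] by (auto simp: Hom_def)

text \<open>Oriented so that associators travel to the right, past tensor products of
  arrows.\<close>

lemma assoc_nat [simp]:
  "\<lbrakk>f \<in> Ar V; g \<in> Ar V; h \<in> Ar V; trg V f = X; trg V g = Y; trg V h = Z\<rbrakk>
    \<Longrightarrow> assoc V X Y Z \<cdot> ((f \<odot> g) \<odot> h)
        = (f \<odot> (g \<odot> h)) \<cdot> assoc V (src V f) (src V g) (src V h)"
  by (rule assoc_natural) (auto simp: Hom_def)

lemma assoc_nat_assoc [simp]:
  assumes "f \<in> Ar V" "g \<in> Ar V" "h \<in> Ar V" "trg V f = X" "trg V g = Y" "trg V h = Z"
    "k \<in> Ar V" "trg V k = (src V f \<otimes> src V g) \<otimes> src V h"
  shows "assoc V X Y Z \<cdot> (((f \<odot> g) \<odot> h) \<cdot> k)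
        = (f \<odot> (g \<odot> h)) \<cdot> (assoc V (src V f) (src V g) (src V h) \<cdot> k)"
proof -
  have "assoc V X Y Z \<cdot> (((f \<odot> g) \<odot> h) \<cdot> k) = (assoc V X Y Z \<cdot> ((f \<odot> g) \<odot> h)) \<cdot> k"
    using assms by (subst cmp_assoc') auto
  also have "\<dots> = ((f \<odot> (g \<odot> h)) \<cdot> assoc V (src V f) (src V g) (src V h)) \<cdot> k"
    using assms by (subst assoc_nat) auto
  finally show ?thesis using assms by simp
qed


end

lemma isoI:
  assumes "f \<in> Ar C" "g \<in> Ar C" "src C g = trg C f" "trg C g = src C f"
    "g \<cdot>\<^bsub>C\<^esub> f = idn C (src C f)" "f \<cdot>\<^bsub>C\<^esub> g = idn C (trg C f)"
  shows "iso C f"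
  using assms by (auto simp: iso_def Hom_def)

context symmetric_monoidal_closed
begin

text \<open>By naturality of \<open>lunit\<close>, tensoring with the unit is isomorphic to the
  identity functor, hence faithful.\<close>

lemma tensor_idn_cancel:
  assumes "f \<in> Ar V" "g \<in> Ar V" "idn V (unit_ob V) \<odot> f = idn V (unit_ob V) \<odot> g"
    "src V f = src V g" "trg V f = trg V g"
  shows "f = g"
proof (rule iso_cancel_right[OF lunit_iso])
  have "f \<cdot> lunit V (src V f) = lunit V (trg V f) \<cdot> (idn V (unit_ob V) \<odot> f)"
    using assms by (intro lunit_natural[symmetric]) (auto simp: Hom_def)
  also have "\<dots> = g \<cdot> lunit V (src V g)"
    using assms lunit_natural[of g "src V g" "trg V g"] by (auto simp: Hom_def)
  finally show "f \<cdot> lunit V (src V f) = g \<cdot> lunit V (src V f)" using assms by simp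
  show "src V f = trg V (lunit V (src V f))" "src V g = trg V (lunit V (src V f))"
    using assms lunit_closed[of "src V f"] by (auto simp: Hom_def)
qed (use assms in auto)

lemma lunit_ar [simp]:
  assumes "X \<in> Ob V"
  shows "lunit V X \<in> Ar V" "src V (lunit V X) = unit_ob V \<otimes> X" "trg V (lunit V X) = X"
  using lunit_closed[OF assms] by (auto simp: Hom_def)

lemma runit_ar [simp]:
  assumes "X \<in> Ob V"
  shows "runit V X \<in> Ar V" "src V (runit V X) = X \<otimes> unit_ob V" "trg V (runit V X) = X"
  using runit_closed[OF assms] by (auto simp: Hom_def)

lemma braid_ar [simp]:
  assumes "X \<in> Ob V" "Y \<in> Ob V"
  shows "braid V X Y \<in> Ar V" "src V (braid V X Y) = X \<otimes> Y" "trg V (braid V X Y) = Y \<otimes> X"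
  using braid_closed[OF assms] by (auto simp: Hom_def)

lemma iso_tensor_idn:
  assumes "iso V f" "Y \<in> Ob V"
  shows "iso V (f \<odot> idn V Y)"
proof -
  have f: "f \<in> Ar V" using assms(1) by (simp add: iso_def)
  show ?thesis
    by (rule isoI[where g="inverse_ar V f \<odot> idn V Y"])
      (use assms(2) f inverse_ar[OF assms(1)] in auto)
qed

text \<open>Kelly's coherence law: it suffices to check it after tensoring with the unit, where it
  follows from pentagon and triangle.\<close>

lemma lunit_assoc:
  assumes X: "X \<in> Ob V" and Y: "Y \<in> Ob V"
  shows "lunit V (X \<otimes> Y) \<cdot> assoc V (unit_ob V) X Y = lunit V X \<odot> idn V Y"
proof (rule tensor_idn_cancel)
  let ?I = "unit_ob V" let ?i = "idn V ?I"
  let ?a = "assoc V ?I (?I \<otimes> X) Y" and ?b = "assoc V ?I ?I X \<odot> idn V Y"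
  have "(?i \<odot> (lunit V (X \<otimes> Y) \<cdot> assoc V ?I X Y)) \<cdot> ?a \<cdot> ?b
      = (?i \<odot> lunit V (X \<otimes> Y)) \<cdot> ((?i \<odot> assoc V ?I X Y) \<cdot> ?a \<cdot> ?b)"
    using X Y by simp
  also have "\<dots> = (?i \<odot> lunit V (X \<otimes> Y)) \<cdot> assoc V ?I ?I (X \<otimes> Y) \<cdot> assoc V (?I \<otimes> ?I) X Y"
    using X Y by (subst pentagon) auto
  also have "\<dots> = ((?i \<odot> lunit V (X \<otimes> Y)) \<cdot> assoc V ?I ?I (X \<otimes> Y)) \<cdot> assoc V (?I \<otimes> ?I) X Y"
    using X Y by simp
  also have "\<dots> = (runit V ?I \<odot> (idn V X \<odot> idn V Y)) \<cdot> assoc V (?I \<otimes> ?I) X Y"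
    using X Y by (subst triangle) auto
  also have "\<dots> = assoc V ?I X Y \<cdot> ((runit V ?I \<odot> idn V X) \<odot> idn V Y)"
    using X Y by (subst assoc_nat) auto
  also have "\<dots> = assoc V ?I X Y \<cdot> (((?i \<odot> lunit V X) \<cdot> assoc V ?I ?I X) \<odot> idn V Y)"
    using X Y by (subst triangle) auto
  also have "\<dots> = assoc V ?I X Y \<cdot> (((?i \<odot> lunit V X) \<odot> idn V Y) \<cdot> ?b)"
    using X Y by simp
  also have "\<dots> = (?i \<odot> (lunit V X \<odot> idn V Y)) \<cdot> ?a \<cdot> ?b"
    using X Y by (subst assoc_nat_assoc) auto
  finally have *: "(?i \<odot> (lunit V (X \<otimes> Y) \<cdot> assoc V ?I X Y)) \<cdot> ?a \<cdot> ?b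
    = (?i \<odot> (lunit V X \<odot> idn V Y)) \<cdot> ?a \<cdot> ?b" .
  show "?i \<odot> (lunit V (X \<otimes> Y) \<cdot> assoc V ?I X Y) = ?i \<odot> (lunit V X \<odot> idn V Y)"
  proof (rule iso_cancel_right[OF assoc_iso])
    show "(?i \<odot> (lunit V (X \<otimes> Y) \<cdot> assoc V ?I X Y)) \<cdot> ?a = (?i \<odot> (lunit V X \<odot> idn V Y)) \<cdot> ?a"
    proof (rule iso_cancel_right[of ?b])
      show "iso V ?b" using X Y by (intro iso_tensor_idn assoc_iso) auto
    next
      show "((?i \<odot> (lunit V (X \<otimes> Y) \<cdot> assoc V ?I X Y)) \<cdot> ?a) \<cdot> ?b
        = ((?i \<odot> (lunit V X \<odot> idn V Y)) \<cdot> ?a) \<cdot> ?b"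
        using * X Y by simp
    qed (use X Y in auto)
  qed (use X Y in auto)
qed (use assms in auto)

definition asi :: "'o \<Rightarrow> 'o \<Rightarrow> 'o \<Rightarrow> 'a" where
  "asi X Y Z = inverse_ar V (assoc V X Y Z)"

lemma asi_ar [simp]:
  assumes "X \<in> Ob V" "Y \<in> Ob V" "Z \<in> Ob V"
  shows "asi X Y Z \<in> Ar V" "src V (asi X Y Z) = X \<otimes> (Y \<otimes> Z)" "trg V (asi X Y Z) = (X \<otimes> Y) \<otimes> Z"
    and asi_assoc: "asi X Y Z \<cdot> assoc V X Y Z = idn V ((X \<otimes> Y) \<otimes> Z)"
    and assoc_asi: "assoc V X Y Z \<cdot> asi X Y Z = idn V (X \<otimes> (Y \<otimes> Z))"
  using inverse_ar[OF assoc_iso[OF assms]] assms by (auto simp: asi_def)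

lemma assoc_asi' [simp]:
  assumes "X \<in> Ob V" "Y \<in> Ob V" "Z \<in> Ob V" "f \<in> Ar V"
  shows "trg V f = X \<otimes> (Y \<otimes> Z) \<Longrightarrow> assoc V X Y Z \<cdot> (asi X Y Z \<cdot> f) = f"
    and "trg V f = (X \<otimes> Y) \<otimes> Z \<Longrightarrow> asi X Y Z \<cdot> (assoc V X Y Z \<cdot> f) = f"
proof -
  assume "trg V f = X \<otimes> (Y \<otimes> Z)"
  then have "assoc V X Y Z \<cdot> (asi X Y Z \<cdot> f) = (assoc V X Y Z \<cdot> asi X Y Z) \<cdot> f"
    using assms by (subst cmp_assoc') auto
  then show "assoc V X Y Z \<cdot> (asi X Y Z \<cdot> f) = f"
    using assms \<open>trg V f = X \<otimes> (Y \<otimes> Z)\<close> by (simp only: assoc_asi) simp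
next
  assume "trg V f = (X \<otimes> Y) \<otimes> Z"
  then have "asi X Y Z \<cdot> (assoc V X Y Z \<cdot> f) = (asi X Y Z \<cdot> assoc V X Y Z) \<cdot> f"
    using assms by (subst cmp_assoc') auto
  then show "asi X Y Z \<cdot> (assoc V X Y Z \<cdot> f) = f"
    using assms \<open>trg V f = (X \<otimes> Y) \<otimes> Z\<close> by (simp only: asi_assoc) simp
qed

lemma assoc_cancel:
  assumes "X \<in> Ob V" "Y \<in> Ob V" "Z \<in> Ob V" "f \<in> Ar V" "g \<in> Ar V"
    "src V f = X \<otimes> (Y \<otimes> Z)" "src V g = X \<otimes> (Y \<otimes> Z)" "f \<cdot> assoc V X Y Z = g \<cdot> assoc V X Y Z"
  shows "f = g"
  by (rule iso_cancel_right[OF assoc_iso[OF assms(1-3)]]) (use assms in auto)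

section \<open>Internal homs and transposition\<close>

lemma ev_ar [simp]:
  assumes "X \<in> Ob V" "A \<in> Ob V"
  shows "ev V X A \<in> Ar V" "src V (ev V X A) = ihom V X A \<otimes> X" "trg V (ev V X A) = A"
  using ev_closed[OF assms] by (auto simp: Hom_def)

text \<open>Inverse to \<open>transp\<close>. The rules below compute \<open>unc\<close> of a
  composite with each structural arrow, so that equations between arrows into internal homs become
  equations between arrows \<open>W \<otimes> X -> A\<close>.\<close>

definition unc :: "'o \<Rightarrow> 'o \<Rightarrow> 'a \<Rightarrow> 'a" where
  "unc X A g = ev V X A \<cdot> (g \<odot> idn V X)"

lemma unc_ar [simp]:
  assumes "X \<in> Ob V" "A \<in> Ob V" "g \<in> Ar V" "trg V g = ihom V X A"
  shows "unc X A g \<in> Ar V" "src V (unc X A g) = src V g \<otimes> X" "trg V (unc X A g) = A"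
  using assms by (auto simp: unc_def)

lemma
  assumes "X \<in> Ob V" "Z \<in> Ob V" "k \<in> Ar V" "src V k = Z \<otimes> X" "trg V k = A"
  shows transp_ar [simp]: "transp V Z X A k \<in> Ar V" "src V (transp V Z X A k) = Z"
      "trg V (transp V Z X A k) = ihom V X A"
    and unc_transp [simp]: "unc X A (transp V Z X A k) = k"
proof -
  have "\<exists>!g. g \<in> Hom V Z (ihom V X A) \<and> ev V X A \<cdot> (g \<odot> idn V X) = k"
    using assms by (intro ev_universal) (auto simp: Hom_def)
  from theI'[OF this] show "transp V Z X A k \<in> Ar V" "src V (transp V Z X A k) = Z"
      "trg V (transp V Z X A k) = ihom V X A" "unc X A (transp V Z X A k) = k"
    unfolding transp_def unc_def by (auto simp: Hom_def)
qed

text \<open>The uniqueness half of \<open>ev_universal\<close>, and the way in which equality of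
  arrows into an internal hom is proved throughout.\<close>

lemma unc_inject:
  assumes "X \<in> Ob V" "A \<in> Ob V" "g \<in> Ar V" "trg V g = ihom V X A" "h \<in> Ar V" "trg V h = ihom V X A"
    "src V g = src V h" "unc X A g = unc X A h"
  shows "g = h"
proof -
  have "\<exists>!g'. g' \<in> Hom V (src V g) (ihom V X A) \<and> ev V X A \<cdot> (g' \<odot> idn V X) = unc X A g"
    using assms by (intro ev_universal) (auto simp: Hom_def)
  moreover have "g \<in> Hom V (src V g) (ihom V X A)" "h \<in> Hom V (src V g) (ihom V X A)"
    using assms by (auto simp: Hom_def)
  moreover have "ev V X A \<cdot> (g \<odot> idn V X) = unc X A g" "ev V X A \<cdot> (h \<odot> idn V X) = unc X A g"
    using assms(8) by (auto simp: unc_def)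
  ultimately show ?thesis by blast
qed

lemma transp_unc [simp]:
  assumes "X \<in> Ob V" "A \<in> Ob V" "g \<in> Ar V" "trg V g = ihom V X A" "src V g = Z"
  shows "transp V Z X A (unc X A g) = g"
  by (rule unc_inject[of X A]) (use assms in auto)

lemma transp_inject:
  assumes "transp V Z X A k = transp V Z X A k'" "X \<in> Ob V" "Z \<in> Ob V"
    "k \<in> Ar V" "src V k = Z \<otimes> X" "trg V k = A" "k' \<in> Ar V" "src V k' = Z \<otimes> X" "trg V k' = A"
  shows "k = k'"
  using assms(1) unc_transp[OF assms(2-6)] unc_transp[OF assms(2,3,7-9)] by metis

lemma unc_cmp:
  assumes "X \<in> Ob V" "A \<in> Ob V" "g \<in> Ar V" "trg V g = ihom V X A" "z \<in> Ar V" "trg V z = src V g"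
  shows "unc X A (g \<cdot> z) = unc X A g \<cdot> (z \<odot> idn V X)"
  using assms by (simp add: unc_def)

lemma transp_cmp:
  assumes "X \<in> Ob V" "k \<in> Ar V" "src V k = trg V z \<otimes> X" "trg V k = A" "z \<in> Ar V"
    "src V z = Z'" "trg V z = Z"
  shows "transp V Z X A k \<cdot> z = transp V Z' X A (k \<cdot> (z \<odot> idn V X))"
proof (rule unc_inject[of X A])
  show "unc X A (transp V Z X A k \<cdot> z) = unc X A (transp V Z' X A (k \<cdot> (z \<odot> idn V X)))"
    using assms by (subst unc_cmp) auto
qed (use assms in auto)

lemma unc_idn [simp]: "\<lbrakk>X \<in> Ob V; A \<in> Ob V\<rbrakk> \<Longrightarrow> unc X A (idn V (ihom V X A)) = ev V X A"
  by (simp add: unc_def)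

lemma transp_ev [simp]:
  "\<lbrakk>X \<in> Ob V; A \<in> Ob V\<rbrakk> \<Longrightarrow> transp V (ihom V X A) X A (ev V X A) = idn V (ihom V X A)"
  using transp_unc[of X A "idn V (ihom V X A)"] by simp

lemma ev_transp:
  assumes "X \<in> Ob V" "Z \<in> Ob V" "k \<in> Ar V" "src V k = Z \<otimes> X" "trg V k = A"
  shows "ev V X A \<cdot> (transp V Z X A k \<odot> idn V X) = k"
  using unc_transp[OF assms] by (simp add: unc_def)

lemma pre_ar [simp]:
  assumes "f \<in> Ar V" "A \<in> Ob V"
  shows "pre V f A \<in> Ar V" "src V (pre V f A) = ihom V (trg V f) A"
    "trg V (pre V f A) = ihom V (src V f) A"
  using assms by (auto simp: pre_def)

text \<open>With \<open>z\<close> read as a generalized element of \<open>A^X\<close>, the arrow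
  \<open>A^f\<close> acts by substituting \<open>f\<close> into the second variable. The tail
  \<open>z\<close> keeps the rule applicable inside composites nested to the right.\<close>

lemma unc_pre_cmp:
  assumes "f \<in> Ar V" "A \<in> Ob V" "z \<in> Ar V" "trg V z = ihom V (trg V f) A" "src V f = Y"
  shows "unc Y A (pre V f A \<cdot> z) = unc (trg V f) A z \<cdot> (idn V (src V z) \<odot> f)"
proof -
  have "unc Y A (pre V f A) = ev V (trg V f) A \<cdot> (idn V (ihom V (trg V f) A) \<odot> f)"
    unfolding pre_def assms(5)[symmetric] using assms(1,2) by simp
  then show ?thesis using assms by (subst unc_cmp) (auto simp: unc_def)
qed

lemma post_ar [simp]:
  assumes "h \<in> Ar V" "X \<in> Ob V"
  shows "post V X h \<in> Ar V" "src V (post V X h) = ihom V X (src V h)"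
    "trg V (post V X h) = ihom V X (trg V h)"
  using assms by (auto simp: post_def)

lemma unc_post_cmp:
  assumes "h \<in> Ar V" "X \<in> Ob V" "z \<in> Ar V" "trg V z = ihom V X (src V h)" "trg V h = B"
  shows "unc X B (post V X h \<cdot> z) = h \<cdot> unc X (src V h) z"
proof -
  have "unc X B (post V X h) = h \<cdot> ev V X (src V h)"
    using assms by (auto simp: post_def)
  then show ?thesis using assms by (subst unc_cmp) (auto simp: unc_def)
qed

lemma icmp_ar [simp]:
  assumes "A \<in> Ob V" "B \<in> Ob V" "C \<in> Ob V"
  shows "icmp V A B C \<in> Ar V" "src V (icmp V A B C) = ihom V B C \<otimes> ihom V A B"
    "trg V (icmp V A B C) = ihom V A C"
  using assms by (auto simp: icmp_def)

lemma unc_icmp_cmp: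
  assumes "A \<in> Ob V" "B \<in> Ob V" "C \<in> Ob V" "z \<in> Ar V" "w \<in> Ar V"
    "trg V z = ihom V B C" "trg V w = ihom V A B"
  shows "unc A C (icmp V A B C \<cdot> (z \<odot> w))
    = unc B C z \<cdot> (idn V (src V z) \<odot> unc A B w) \<cdot> assoc V (src V z) (src V w) A"
  using assms by (subst unc_cmp) (auto simp: icmp_def unc_def[of B C z] unc_def[of A B w])

lemma unc_icmp:
  assumes "A \<in> Ob V" "B \<in> Ob V" "C \<in> Ob V"
  shows "unc A C (icmp V A B C)
    = ev V B C \<cdot> (idn V (ihom V B C) \<odot> ev V A B) \<cdot> assoc V (ihom V B C) (ihom V A B) A"
  using assms by (auto simp: icmp_def)

lemma iidn_ar [simp]:
  assumes "A \<in> Ob V"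
  shows "iidn V A \<in> Ar V" "src V (iidn V A) = unit_ob V" "trg V (iidn V A) = ihom V A A"
    and unc_iidn: "unc A A (iidn V A) = lunit V A"
  using assms by (auto simp: iidn_def)

lemma ipow_ar [simp]:
  assumes "X \<in> Ob V" "A \<in> Ob V" "B \<in> Ob V"
  shows "ipow V X A B \<in> Ar V" "src V (ipow V X A B) = ihom V A B"
    "trg V (ipow V X A B) = ihom V (ihom V X A) (ihom V X B)"
  using assms by (auto simp: ipow_def)

text \<open>\<open>ipow\<close> is a transpose of a transpose; only the outer layer is removed here,
  and a second \<open>unc\<close> removes the remaining \<open>transp\<close>.\<close>

lemma unc_ipow_cmp:
  assumes "X \<in> Ob V" "A \<in> Ob V" "B \<in> Ob V" "z \<in> Ar V" "trg V z = ihom V A B"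
  shows "unc (ihom V X A) (ihom V X B) (ipow V X A B \<cdot> z)
    = transp V (src V z \<otimes> ihom V X A) X B
        (unc A B z \<cdot> (idn V (src V z) \<odot> ev V X A) \<cdot> assoc V (src V z) (ihom V X A) X)"
proof -
  have "unc (ihom V X A) (ihom V X B) (ipow V X A B \<cdot> z)
    = icmp V X A B \<cdot> (z \<odot> idn V (ihom V X A))"
    using assms by (subst unc_cmp) (auto simp: ipow_def)
  also have "\<dots> = transp V (src V z \<otimes> ihom V X A) X B (unc X B (icmp V X A B \<cdot> (z \<odot> idn V (ihom V X A))))"
    using assms by (subst transp_unc) auto
  also have "unc X B (icmp V X A B \<cdot> (z \<odot> idn V (ihom V X A)))
    = unc A B z \<cdot> (idn V (src V z) \<odot> ev V X A) \<cdot> assoc V (src V z) (ihom V X A) X"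
    using assms by (subst unc_icmp_cmp) auto
  finally show ?thesis .
qed

text \<open>A \<open>V\<close>-arrow \<open>\<phi> : [X, A] \<rightarrow> [Y, A]\<close> acts on generalized elements \<open>x : W \<otimes> X \<rightarrow> A\<close>, naturally
  in the stage \<open>W\<close>.\<close>

definition act :: "'o \<Rightarrow> 'o \<Rightarrow> 'o \<Rightarrow> 'a \<Rightarrow> 'o \<Rightarrow> 'a \<Rightarrow> 'a" where
  "act X Y A \<phi> W x = unc Y A (\<phi> \<cdot> transp V W X A x)"

lemma act_ar [simp]:
  assumes "X \<in> Ob V" "Y \<in> Ob V" "A \<in> Ob V" "\<phi> \<in> Ar V" "src V \<phi> = ihom V X A"
    "trg V \<phi> = ihom V Y A" "W \<in> Ob V" "x \<in> Ar V" "src V x = W \<otimes> X" "trg V x = A"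
  shows "act X Y A \<phi> W x \<in> Ar V" "src V (act X Y A \<phi> W x) = W \<otimes> Y" "trg V (act X Y A \<phi> W x) = A"
  using assms by (auto simp: act_def)

lemma act_natural:
  assumes "X \<in> Ob V" "Y \<in> Ob V" "A \<in> Ob V" "\<phi> \<in> Ar V" "src V \<phi> = ihom V X A"
    "trg V \<phi> = ihom V Y A" "W \<in> Ob V" "x \<in> Ar V" "src V x = W \<otimes> X" "trg V x = A"
    "w \<in> Ar V" "src V w = W'" "trg V w = W"
  shows "act X Y A \<phi> W' (x \<cdot> (w \<odot> idn V X)) = act X Y A \<phi> W x \<cdot> (w \<odot> idn V Y)"
proof -
  have "transp V W' X A (x \<cdot> (w \<odot> idn V X)) = transp V W X A x \<cdot> w"
    using assms by (subst transp_cmp) auto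
  then show ?thesis
    using assms unc_cmp[of Y A "\<phi> \<cdot> transp V W X A x" w] by (simp add: act_def)
qed

text \<open>Yoneda: \<open>ev\<close> at the stage \<open>ihom V X A\<close> is the generic element,
  so its image recovers \<phi> up to transposition.\<close>

lemma act_ev:
  assumes "X \<in> Ob V" "Y \<in> Ob V" "A \<in> Ob V" "\<phi> \<in> Ar V" "src V \<phi> = ihom V X A"
    "trg V \<phi> = ihom V Y A"
  shows "act X Y A \<phi> (ihom V X A) (ev V X A) = unc Y A \<phi>"
  using assms by (simp add: act_def)

lemma act_eq_unc:
  assumes "X \<in> Ob V" "Y \<in> Ob V" "A \<in> Ob V" "\<phi> \<in> Ar V" "src V \<phi> = ihom V X A"
    "trg V \<phi> = ihom V Y A" "W \<in> Ob V" "x \<in> Ar V" "src V x = W \<otimes> X" "trg V x = A"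
  shows "act X Y A \<phi> W x = unc Y A \<phi> \<cdot> (transp V W X A x \<odot> idn V Y)"
  using assms by (simp add: act_def unc_cmp)

lemma curry_iso_ar [simp]:
  assumes "Z \<in> Ob V" "X \<in> Ob V" "A \<in> Ob V"
  shows "curry_iso V Z X A \<in> Ar V" "src V (curry_iso V Z X A) = ihom V (Z \<otimes> X) A"
    "trg V (curry_iso V Z X A) = ihom V Z (ihom V X A)"
  using assms by (auto simp: curry_iso_def)

lemma unc_curry_cmp:
  assumes "Z \<in> Ob V" "X \<in> Ob V" "A \<in> Ob V" "z \<in> Ar V" "trg V z = ihom V (Z \<otimes> X) A"
  shows "unc X A (unc Z (ihom V X A) (curry_iso V Z X A \<cdot> z)) = unc (Z \<otimes> X) A z \<cdot> assoc V (src V z) Z X"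
proof -
  have "unc X A (unc Z (ihom V X A) (curry_iso V Z X A \<cdot> z))
    = unc X A (transp V (ihom V (Z \<otimes> X) A \<otimes> Z) X A
        (ev V (Z \<otimes> X) A \<cdot> assoc V (ihom V (Z \<otimes> X) A) Z X) \<cdot> (z \<odot> idn V Z))"
    using assms by (subst unc_cmp) (auto simp: curry_iso_def)
  also have "\<dots> = unc (Z \<otimes> X) A z \<cdot> assoc V (src V z) Z X"
    using assms by (subst unc_cmp) (auto simp: unc_def[of "Z \<otimes> X" A z])
  finally show ?thesis .
qed

lemma curry_iso:
  assumes "Z \<in> Ob V" "X \<in> Ob V" "A \<in> Ob V"
  shows "iso V (curry_iso V Z X A)"
proof -
  let ?c = "curry_iso V Z X A" and ?H = "ihom V Z (ihom V X A)"
  \<comment> \<open>The inverse uncurries the evaluation at \<open>Z\<close> once more, rebrackets,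
    and transposes both variables at once.\<close>
  let ?g = "transp V ?H (Z \<otimes> X) A (unc X A (ev V Z (ihom V X A)) \<cdot> asi ?H Z X)"
  have g: "?g \<in> Ar V" "src V ?g = ?H" "trg V ?g = ihom V (Z \<otimes> X) A" using assms by auto
  have "?c \<cdot> ?g = idn V ?H"
  proof (rule unc_inject[of Z "ihom V X A"])
    show "unc Z (ihom V X A) (?c \<cdot> ?g) = unc Z (ihom V X A) (idn V ?H)"
    proof (rule unc_inject[of X A])
      show "unc X A (unc Z (ihom V X A) (?c \<cdot> ?g)) = unc X A (unc Z (ihom V X A) (idn V ?H))"
        using assms g by (subst unc_curry_cmp) auto
    qed (use assms g in auto)
  qed (use assms g in auto)
  moreover have "?g \<cdot> ?c = idn V (ihom V (Z \<otimes> X) A)"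
  proof (rule unc_inject[of "Z \<otimes> X" A])
    let ?E = "ihom V (Z \<otimes> X) A"
    have "unc (Z \<otimes> X) A (?g \<cdot> ?c) = unc X A (ev V Z (ihom V X A)) \<cdot> asi ?H Z X \<cdot> (?c \<odot> idn V (Z \<otimes> X))"
      using assms g by (subst unc_cmp) auto
    \<comment> \<open>Naturality of the inverse associator, from that of the associator by
      cancelling.\<close>
    also have "asi ?H Z X \<cdot> (?c \<odot> idn V (Z \<otimes> X)) = ((?c \<odot> idn V Z) \<odot> idn V X) \<cdot> asi ?E Z X"
    proof (rule iso_cancel_left[OF assoc_iso[of ?H Z X]])
      have "assoc V ?H Z X \<cdot> (((?c \<odot> idn V Z) \<odot> idn V X) \<cdot> asi ?E Z X) = ?c \<odot> idn V (Z \<otimes> X)"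
        using assms by (subst assoc_nat_assoc) auto
      then show "assoc V ?H Z X \<cdot> (asi ?H Z X \<cdot> (?c \<odot> idn V (Z \<otimes> X)))
        = assoc V ?H Z X \<cdot> (((?c \<odot> idn V Z) \<odot> idn V X) \<cdot> asi ?E Z X)"
        using assms by simp
    qed (use assms in auto)
    also have "unc X A (ev V Z (ihom V X A)) \<cdot> (((?c \<odot> idn V Z) \<odot> idn V X) \<cdot> asi ?E Z X)
      = (unc X A (ev V Z (ihom V X A)) \<cdot> ((?c \<odot> idn V Z) \<odot> idn V X)) \<cdot> asi ?E Z X"
      using assms by simp
    also have "unc X A (ev V Z (ihom V X A)) \<cdot> ((?c \<odot> idn V Z) \<odot> idn V X)
      = unc X A (unc Z (ihom V X A) (?c \<cdot> idn V ?E))"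
      using assms by (subst unc_cmp[symmetric]) (auto simp: unc_def[of Z])
    also have "\<dots> = ev V (Z \<otimes> X) A \<cdot> assoc V ?E Z X"
      using assms by (subst unc_curry_cmp) auto
    finally show "unc (Z \<otimes> X) A (?g \<cdot> ?c) = unc (Z \<otimes> X) A (idn V ?E)"
      using assms by simp
  qed (use assms g in auto)
  ultimately show ?thesis using assms g by (intro isoI[where g="?g"]) auto
qed

text \<open>The power of \<phi> by \<open>Z\<close>, acting at stage \<open>W\<close>, is \<phi>
  itself acting at stage \<open>W \<otimes> Z\<close>. Through this rule powers are treated as a
  change of stage, and \<open>curry_iso\<close> and its inverse disappear from later
  computations.\<close>

lemma act_power:
  assumes "X \<in> Ob V" "Y \<in> Ob V" "Z \<in> Ob V" "A \<in> Ob V" "\<phi> \<in> Ar V" "src V \<phi> = ihom V X A"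
    "trg V \<phi> = ihom V Y A" "W \<in> Ob V" "x \<in> Ar V" "src V x = W \<otimes> (Z \<otimes> X)" "trg V x = A"
  shows "act (Z \<otimes> X) (Z \<otimes> Y) A
      (inverse_ar V (curry_iso V Z Y A) \<cdot> post V Z \<phi> \<cdot> curry_iso V Z X A) W x \<cdot> assoc V W Z Y
    = act X Y A \<phi> (W \<otimes> Z) (x \<cdot> assoc V W Z X)"
proof -
  let ?cY = "curry_iso V Z Y A" and ?cX = "curry_iso V Z X A"
  let ?t = "transp V W (Z \<otimes> X) A x"
  let ?p = "inverse_ar V ?cY \<cdot> post V Z \<phi> \<cdot> ?cX \<cdot> ?t"
  note i = inverse_ar[OF curry_iso[of Z Y A]]
  have "unc (Z \<otimes> Y) A ?p \<cdot> assoc V W Z Y = unc Y A (unc Z (ihom V Y A) (?cY \<cdot> ?p))"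
    using assms i by (subst unc_curry_cmp) auto
  also have "?cY \<cdot> ?p = (?cY \<cdot> inverse_ar V ?cY) \<cdot> post V Z \<phi> \<cdot> ?cX \<cdot> ?t"
    using assms i(1-3) by simp
  also have "\<dots> = post V Z \<phi> \<cdot> ?cX \<cdot> ?t"
    using assms by (subst i(5)) auto
  also have "unc Z (ihom V Y A) \<dots> = \<phi> \<cdot> unc Z (ihom V X A) (?cX \<cdot> ?t)"
    using assms by (subst unc_post_cmp) auto
  also have "unc Z (ihom V X A) (?cX \<cdot> ?t)
      = transp V (W \<otimes> Z) X A (unc X A (unc Z (ihom V X A) (?cX \<cdot> ?t)))"
    using assms by (subst transp_unc) auto
  also have "unc X A (unc Z (ihom V X A) (?cX \<cdot> ?t)) = x \<cdot> assoc V W Z X"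
    using assms by (subst unc_curry_cmp) auto
  finally show ?thesis using assms i(1-3) by (simp add: act_def)
qed

end

section \<open>Structures and indexed families of morphisms\<close>

lemma is_joint_equalizer_mono:
  fixes C :: "('o, 'a, 'm) cat_scheme" (structure)
  assumes "category C" "is_joint_equalizer C I Y u v e"
    "\<And>i. i \<in> I \<Longrightarrow> u i \<in> Ar C \<and> src C (u i) = Y" "\<And>i. i \<in> I \<Longrightarrow> v i \<in> Ar C \<and> src C (v i) = Y"
    "g \<in> Ar C" "h \<in> Ar C" "trg C g = src C e" "trg C h = src C e"
    "src C g = src C h" "e \<cdot> g = e \<cdot> h"
  shows "g = h"
proof -
  interpret category C by fact
  have e: "e \<in> Ar C" "trg C e = Y" "\<And>i. i \<in> I \<Longrightarrow> u i \<cdot> e = v i \<cdot> e"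
    using assms(2) by (auto simp: is_joint_equalizer_def)
  have "u i \<cdot> (e \<cdot> g) = v i \<cdot> (e \<cdot> g)" if "i \<in> I" for i
  proof -
    have "(u i \<cdot> e) \<cdot> g = (v i \<cdot> e) \<cdot> g" using e(3)[OF that] by simp
    then show ?thesis using assms(3)[OF that] assms(4)[OF that] assms(5-) e by simp
  qed
  then have "\<exists>!k. k \<in> Hom C (src C (e \<cdot> g)) (src C e) \<and> e \<cdot> k = e \<cdot> g"
    using assms(2,5-) e unfolding is_joint_equalizer_def by (metis cmp_ar trg_cmp)
  moreover have "g \<in> Hom C (src C (e \<cdot> g)) (src C e)" "h \<in> Hom C (src C (e \<cdot> g)) (src C e)"
    using assms(5-9) e by (auto simp: Hom_def)
  ultimately show ?thesis using assms(10) by metis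
qed

context symmetric_monoidal_closed
begin

text \<open>The pentagon combined with naturality of the associator in its last variable. It
  rebrackets iterated evaluations, both for associativity of internal composition and for
  \<open>imor_cmp\<close>.\<close>

lemma pentagon_arrow:
  assumes "W \<in> Ob V" "X \<in> Ob V" "Y \<in> Ob V" "Z \<in> Ob V" "k \<in> Ar V" "src V k = Y \<otimes> Z" "trg V k = A"
  shows "(idn V W \<odot> ((idn V X \<odot> k) \<cdot> assoc V X Y Z)) \<cdot> assoc V W (X \<otimes> Y) Z \<cdot> (assoc V W X Y \<odot> idn V Z)
    = assoc V W X A \<cdot> (idn V (W \<otimes> X) \<odot> k) \<cdot> assoc V (W \<otimes> X) Y Z"
proof -
  have A: "A \<in> Ob V" using assms by auto
  have "(idn V W \<odot> ((idn V X \<odot> k) \<cdot> assoc V X Y Z)) \<cdot> assoc V W (X \<otimes> Y) Z \<cdot> (assoc V W X Y \<odot> idn V Z)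
    = (idn V W \<odot> (idn V X \<odot> k)) \<cdot> (idn V W \<odot> assoc V X Y Z) \<cdot> assoc V W (X \<otimes> Y) Z \<cdot> (assoc V W X Y \<odot> idn V Z)"
    using assms by simp
  also have "\<dots> = (idn V W \<odot> (idn V X \<odot> k)) \<cdot> assoc V W X (Y \<otimes> Z) \<cdot> assoc V (W \<otimes> X) Y Z"
    using assms by (subst pentagon) auto
  also have "\<dots> = ((idn V W \<odot> (idn V X \<odot> k)) \<cdot> assoc V W X (Y \<otimes> Z)) \<cdot> assoc V (W \<otimes> X) Y Z"
    using assms by simp
  also have "(idn V W \<odot> (idn V X \<odot> k)) \<cdot> assoc V W X (Y \<otimes> Z) = assoc V W X A \<cdot> ((idn V W \<odot> idn V X) \<odot> k)"
    using assms A by (subst assoc_nat) auto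
  finally show ?thesis using assms A by simp
qed

text \<open>Each law is transposed, which turns internal composition into iterated evaluation;
  \<open>pentagon_arrow\<close>, \<open>lunit_assoc\<close> and the triangle then give
  associativity, the left and the right unit law.\<close>

lemma self_vcategory: "vcategory V (self_vcat V)"
proof
  fix A B D E assume "A \<in> VOb (self_vcat V)" "B \<in> VOb (self_vcat V)" "D \<in> VOb (self_vcat V)"
    "E \<in> VOb (self_vcat V)"
  then have o: "A \<in> Ob V" "B \<in> Ob V" "D \<in> Ob V" "E \<in> Ob V" by (auto simp: self_vcat_def)
  let ?de = "ihom V D E" and ?bd = "ihom V B D" and ?ab = "ihom V A B"
  have "unc A E (icmp V A B E \<cdot> (icmp V B D E \<odot> idn V ?ab))
    = ev V D E \<cdot> (idn V ?de \<odot> ev V B D) \<cdot> (assoc V ?de ?bd B \<cdot> (idn V (?de \<otimes> ?bd) \<odot> ev V A B)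
      \<cdot> assoc V (?de \<otimes> ?bd) ?ab A)"
    using o by (subst unc_icmp_cmp) (auto simp: unc_icmp)
  also have "assoc V ?de ?bd B \<cdot> (idn V (?de \<otimes> ?bd) \<odot> ev V A B) \<cdot> assoc V (?de \<otimes> ?bd) ?ab A
    = (idn V ?de \<odot> ((idn V ?bd \<odot> ev V A B) \<cdot> assoc V ?bd ?ab A)) \<cdot> assoc V ?de (?bd \<otimes> ?ab) A
      \<cdot> (assoc V ?de ?bd ?ab \<odot> idn V A)"
    using o by (subst pentagon_arrow) auto
  also have "ev V D E \<cdot> (idn V ?de \<odot> ev V B D) \<cdot> \<dots>
    = (ev V D E \<cdot> (idn V ?de \<odot> unc A D (icmp V A B D)) \<cdot> assoc V ?de (?bd \<otimes> ?ab) A)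
      \<cdot> (assoc V ?de ?bd ?ab \<odot> idn V A)"
    using o by (auto simp: unc_icmp)
  also have "ev V D E \<cdot> (idn V ?de \<odot> unc A D (icmp V A B D)) \<cdot> assoc V ?de (?bd \<otimes> ?ab) A
    = unc A E (icmp V A D E \<cdot> (idn V ?de \<odot> icmp V A B D))"
    using o by (subst unc_icmp_cmp) auto
  also have "\<dots> \<cdot> (assoc V ?de ?bd ?ab \<odot> idn V A)
    = unc A E ((icmp V A D E \<cdot> (idn V ?de \<odot> icmp V A B D)) \<cdot> assoc V ?de ?bd ?ab)"
    using o by (subst unc_cmp[symmetric]) auto
  finally have "icmp V A B E \<cdot> (icmp V B D E \<odot> idn V ?ab)
    = (icmp V A D E \<cdot> (idn V ?de \<odot> icmp V A B D)) \<cdot> assoc V ?de ?bd ?ab"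
    by (rule unc_inject[rotated -1]) (use o in auto)
  then show "VCmp (self_vcat V) A B E \<cdot> (VCmp (self_vcat V) B D E \<odot> idn V (VHom (self_vcat V) A B))
          = VCmp (self_vcat V) A D E \<cdot> (idn V (VHom (self_vcat V) D E) \<odot> VCmp (self_vcat V) A B D)
              \<cdot> assoc V (VHom (self_vcat V) D E) (VHom (self_vcat V) B D) (VHom (self_vcat V) A B)"
    using o by (simp add: self_vcat_def)
next
  fix A B assume "A \<in> VOb (self_vcat V)" "B \<in> VOb (self_vcat V)"
  then have o: "A \<in> Ob V" "B \<in> Ob V" by (auto simp: self_vcat_def)
  let ?h = "ihom V A B"
  have "unc A B (icmp V A B B \<cdot> (iidn V B \<odot> idn V ?h))
    = (lunit V B \<cdot> (idn V (unit_ob V) \<odot> ev V A B)) \<cdot> assoc V (unit_ob V) ?h A"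
    using o by (subst unc_icmp_cmp) (auto simp: unc_iidn)
  also have "lunit V B \<cdot> (idn V (unit_ob V) \<odot> ev V A B) = ev V A B \<cdot> lunit V (?h \<otimes> A)"
    using o by (intro lunit_natural) (auto simp: Hom_def)
  also have "\<dots> \<cdot> assoc V (unit_ob V) ?h A = ev V A B \<cdot> (lunit V ?h \<odot> idn V A)"
    using o by (simp add: lunit_assoc)
  also have "\<dots> = unc A B (lunit V ?h)"
    by (simp add: unc_def)
  finally have "icmp V A B B \<cdot> (iidn V B \<odot> idn V ?h) = lunit V ?h"
    by (rule unc_inject[rotated -1]) (use o in auto)
  then show "VCmp (self_vcat V) A B B \<cdot> (VIdn (self_vcat V) B \<odot> idn V (VHom (self_vcat V) A B))
    = lunit V (VHom (self_vcat V) A B)"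
    by (simp add: self_vcat_def)
  have "unc A B (icmp V A A B \<cdot> (idn V ?h \<odot> iidn V A))
    = ev V A B \<cdot> ((idn V ?h \<odot> lunit V A) \<cdot> assoc V ?h (unit_ob V) A)"
    using o by (subst unc_icmp_cmp) (auto simp: unc_iidn)
  also have "(idn V ?h \<odot> lunit V A) \<cdot> assoc V ?h (unit_ob V) A = runit V ?h \<odot> idn V A"
    using o by (intro triangle) auto
  also have "ev V A B \<cdot> (runit V ?h \<odot> idn V A) = unc A B (runit V ?h)"
    by (simp add: unc_def)
  finally have "icmp V A A B \<cdot> (idn V ?h \<odot> iidn V A) = runit V ?h"
    by (rule unc_inject[rotated -1]) (use o in auto)
  then show "VCmp (self_vcat V) A A B \<cdot> (idn V (VHom (self_vcat V) A B) \<odot> VIdn (self_vcat V) A)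
    = runit V (VHom (self_vcat V) A B)"
    by (simp add: self_vcat_def)
qed (auto simp: self_vcat_def Hom_def)

end

locale structures_over = symmetric_monoidal_closed V
  for V :: "('o, 'a, 'm) smc_scheme" (structure) and L :: "('f, 'o) language" +
  assumes inar_ob [simp]: "f \<in> Sym L \<Longrightarrow> inar L f \<in> Ob V"
    and outar_ob [simp]: "f \<in> Sym L \<Longrightarrow> outar L f \<in> Ob V"
begin

lemma structuresD [simp]:
  assumes "A \<in> structures V L"
  shows "fst A \<in> Ob V" "f \<in> Sym L \<Longrightarrow> snd A f \<in> Ar V"
    "f \<in> Sym L \<Longrightarrow> src V (snd A f) = ihom V (inar L f) (fst A)"
    "f \<in> Sym L \<Longrightarrow> trg V (snd A f) = ihom V (outar L f) (fst A)"
  using assms by (auto simp: structures_def Hom_def PiE_def Pi_def)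

abbreviation opn :: "('o, 'a, 'f) struct \<Rightarrow> 'f \<Rightarrow> 'o \<Rightarrow> 'a \<Rightarrow> 'a" where
  "opn A f \<equiv> act (inar L f) (outar L f) (fst A) (snd A f)"

text \<open>\<open>imor Z A B k\<close>: the arrow \<open>k : Z \<otimes> A \<rightarrow> B\<close> is a \<open>Z\<close>-indexed family of morphisms of structures,
  i.e.\ corresponds to an arrow from \<open>Z\<close> to the hom-object of structures.\<close>

definition imor :: "'o \<Rightarrow> ('o, 'a, 'f) struct \<Rightarrow> ('o, 'a, 'f) struct \<Rightarrow> 'a \<Rightarrow> bool" where
  "imor Z A B k \<longleftrightarrow> Z \<in> Ob V \<and> k \<in> Hom V (Z \<otimes> fst A) (fst B) \<and>
     (\<forall>f \<in> Sym L. \<forall>W \<in> Ob V. \<forall>x \<in> Hom V (W \<otimes> inar L f) (fst A).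
        opn B f (Z \<otimes> W) (k \<cdot> (idn V Z \<odot> x) \<cdot> assoc V Z W (inar L f))
          = k \<cdot> (idn V Z \<odot> opn A f W x) \<cdot> assoc V Z W (outar L f))"

lemma imor_ar:
  assumes "imor Z A B k"
  shows "Z \<in> Ob V" "k \<in> Ar V" "src V k = Z \<otimes> fst A" "trg V k = fst B"
  using assms by (auto simp: imor_def Hom_def)

lemma imor_opn:
  assumes "imor Z A B k" "f \<in> Sym L" "W \<in> Ob V" "x \<in> Ar V" "src V x = W \<otimes> inar L f" "trg V x = fst A"
  shows "opn B f (Z \<otimes> W) (k \<cdot> (idn V Z \<odot> x) \<cdot> assoc V Z W (inar L f))
          = k \<cdot> (idn V Z \<odot> opn A f W x) \<cdot> assoc V Z W (outar L f)"
  using assms by (auto simp: imor_def Hom_def)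

text \<open>The law for the reindexed family is the law for \<open>k\<close> at stage
  \<open>Z \<otimes> W\<close>, restricted along \<open>z \<odot> idn V W\<close>; operations are
  natural in the stage.\<close>

lemma imor_natural:
  assumes A: "A \<in> structures V L" and B: "B \<in> structures V L" and k: "imor Z A B k"
    and z: "z \<in> Ar V" "src V z = Z'" "trg V z = Z"
  shows "imor Z' A B (k \<cdot> (z \<odot> idn V (fst A)))"
  unfolding imor_def
proof (intro conjI ballI)
  note ka = imor_ar[OF k]
  show "Z' \<in> Ob V" "k \<cdot> (z \<odot> idn V (fst A)) \<in> Hom V (Z' \<otimes> fst A) (fst B)"
    using A B ka z by (auto simp: Hom_def)
  then have Z': "Z' \<in> Ob V" by simp
  fix f W x assume f: "f \<in> Sym L" and W: "W \<in> Ob V" and "x \<in> Hom V (W \<otimes> inar L f) (fst A)"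
  then have x: "x \<in> Ar V" "src V x = W \<otimes> inar L f" "trg V x = fst A" by (auto simp: Hom_def)
  let ?X = "inar L f" and ?Y = "outar L f"
  have y: "opn A f W x \<in> Ar V" "src V (opn A f W x) = W \<otimes> ?Y" "trg V (opn A f W x) = fst A"
    using A f W x by auto
  have kx: "(k \<cdot> (z \<odot> idn V (fst A))) \<cdot> (idn V Z' \<odot> x) \<cdot> assoc V Z' W ?X
    = (k \<cdot> (idn V Z \<odot> x) \<cdot> assoc V Z W ?X) \<cdot> ((z \<odot> idn V W) \<odot> idn V ?X)"
    using A B ka z Z' f W x by simp
  have "opn B f (Z' \<otimes> W) ((k \<cdot> (z \<odot> idn V (fst A))) \<cdot> (idn V Z' \<odot> x) \<cdot> assoc V Z' W ?X)
    = opn B f (Z \<otimes> W) (k \<cdot> (idn V Z \<odot> x) \<cdot> assoc V Z W ?X) \<cdot> ((z \<odot> idn V W) \<odot> idn V ?Y)"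
    unfolding kx using A B ka z Z' f W x by (intro act_natural) auto
  also have "\<dots> = (k \<cdot> (idn V Z \<odot> opn A f W x) \<cdot> assoc V Z W ?Y) \<cdot> ((z \<odot> idn V W) \<odot> idn V ?Y)"
    using imor_opn[OF k f W x] by simp
  also have "\<dots> = (k \<cdot> (z \<odot> idn V (fst A))) \<cdot> (idn V Z' \<odot> opn A f W x) \<cdot> assoc V Z' W ?Y"
    using A B ka z Z' f W y by simp
  finally show "opn B f (Z' \<otimes> W) ((k \<cdot> (z \<odot> idn V (fst A))) \<cdot> (idn V Z' \<odot> x) \<cdot> assoc V Z' W ?X)
    = (k \<cdot> (z \<odot> idn V (fst A))) \<cdot> (idn V Z' \<odot> opn A f W x) \<cdot> assoc V Z' W ?Y" .
qed

text \<open>This is why restriction along an extended term maps hom-objects of structures to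
  hom-objects of structures.\<close>

lemma imor_struct_morphism:
  assumes A: "A \<in> structures V L" and B: "B \<in> structures V L" and D: "D \<in> structures V L"
    and k: "imor Z B D k" and h: "struct_morphism V L A B h"
  shows "imor Z A D (k \<cdot> (idn V Z \<odot> h))"
  unfolding imor_def
proof (intro conjI ballI)
  note ka = imor_ar[OF k]
  have ha: "h \<in> Ar V" "src V h = fst A" "trg V h = fst B"
    using h by (auto simp: struct_morphism_def Hom_def)
  show "Z \<in> Ob V" "k \<cdot> (idn V Z \<odot> h) \<in> Hom V (Z \<otimes> fst A) (fst D)"
    using A B ka ha by (auto simp: Hom_def)
  fix f W x assume f: "f \<in> Sym L" and W: "W \<in> Ob V" and "x \<in> Hom V (W \<otimes> inar L f) (fst A)"
  then have x: "x \<in> Ar V" "src V x = W \<otimes> inar L f" "trg V x = fst A" by (auto simp: Hom_def)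
  let ?X = "inar L f" and ?Y = "outar L f"
  have y: "opn A f W x \<in> Ar V" "src V (opn A f W x) = W \<otimes> ?Y" "trg V (opn A f W x) = fst A"
    using A f W x by auto
  \<comment> \<open>After transposing, \<open>post V X h\<close> is composition with
    \<open>h\<close>, so the defining square of a morphism says that \<open>h\<close> commutes with
    operations on generalized elements.\<close>
  have hx: "opn B f W (h \<cdot> x) = h \<cdot> opn A f W x"
  proof -
    let ?t = "transp V W ?X (fst A) x"
    have t: "?t \<in> Ar V" "src V ?t = W" "trg V ?t = ihom V ?X (fst A)" using A f W x by auto
    have "transp V W ?X (fst B) (h \<cdot> x) = transp V W ?X (fst B) (unc ?X (fst B) (post V ?X h \<cdot> ?t))"
      using A B f W x ha by (subst unc_post_cmp) auto
    also have "\<dots> = post V ?X h \<cdot> ?t"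
      using A B f W x ha by (subst transp_unc) auto
    finally have "opn B f W (h \<cdot> x) = unc ?Y (fst B) ((snd B f \<cdot> post V ?X h) \<cdot> ?t)"
      using A B f ha t by (simp add: act_def)
    also have "snd B f \<cdot> post V ?X h = post V ?Y h \<cdot> snd A f"
      using h f by (simp add: struct_morphism_def)
    also have "unc ?Y (fst B) ((post V ?Y h \<cdot> snd A f) \<cdot> ?t) = unc ?Y (fst B) (post V ?Y h \<cdot> (snd A f \<cdot> ?t))"
      using A B f ha t by simp
    also have "\<dots> = h \<cdot> opn A f W x"
      using A B f ha t by (subst unc_post_cmp) (auto simp: act_def)
    finally show ?thesis .
  qed
  have kx: "(k \<cdot> (idn V Z \<odot> h)) \<cdot> (idn V Z \<odot> x) \<cdot> assoc V Z W ?X = k \<cdot> (idn V Z \<odot> (h \<cdot> x)) \<cdot> assoc V Z W ?X"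
    using A B ka f W x ha by simp
  have "opn D f (Z \<otimes> W) ((k \<cdot> (idn V Z \<odot> h)) \<cdot> (idn V Z \<odot> x) \<cdot> assoc V Z W ?X)
    = k \<cdot> (idn V Z \<odot> opn B f W (h \<cdot> x)) \<cdot> assoc V Z W ?Y"
    unfolding kx using x ha by (intro imor_opn[OF k f W]) auto
  also have "\<dots> = (k \<cdot> (idn V Z \<odot> h)) \<cdot> (idn V Z \<odot> opn A f W x) \<cdot> assoc V Z W ?Y"
    unfolding hx using A B ka f W x ha y by simp
  finally show "opn D f (Z \<otimes> W) ((k \<cdot> (idn V Z \<odot> h)) \<cdot> (idn V Z \<odot> x) \<cdot> assoc V Z W ?X)
    = (k \<cdot> (idn V Z \<odot> h)) \<cdot> (idn V Z \<odot> opn A f W x) \<cdot> assoc V Z W ?Y" .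
qed

text \<open>The identity of \<open>A\<close>, as a family indexed by the unit object; it yields the
  identities of \<open>Str V L\<close>.\<close>

lemma imor_lunit:
  assumes A: "A \<in> structures V L"
  shows "imor (unit_ob V) A A (lunit V (fst A))"
  unfolding imor_def
proof (intro conjI ballI)
  let ?I = "unit_ob V"
  show "?I \<in> Ob V" "lunit V (fst A) \<in> Hom V (?I \<otimes> fst A) (fst A)"
    using A by (auto simp: Hom_def)
  fix f W x assume f: "f \<in> Sym L" and W: "W \<in> Ob V" and "x \<in> Hom V (W \<otimes> inar L f) (fst A)"
  then have x: "x \<in> Ar V" "src V x = W \<otimes> inar L f" "trg V x = fst A" by (auto simp: Hom_def)
  let ?X = "inar L f" and ?Y = "outar L f"
  have y: "opn A f W x \<in> Ar V" "src V (opn A f W x) = W \<otimes> ?Y" "trg V (opn A f W x) = fst A"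
    using A f W x by auto
  \<comment> \<open>By coherence, passing to the stage \<open>I \<otimes> W\<close> is reindexing
    along \<open>lunit V W\<close>, so the law reduces to naturality of the operation in the
    stage.\<close>
  have *: "lunit V (fst A) \<cdot> (idn V ?I \<odot> y) \<cdot> assoc V ?I W T = y \<cdot> (lunit V W \<odot> idn V T)"
    if "y \<in> Ar V" "src V y = W \<otimes> T" "trg V y = fst A" "T \<in> Ob V" for y T
  proof -
    have "lunit V (fst A) \<cdot> (idn V ?I \<odot> y) \<cdot> assoc V ?I W T
      = (lunit V (fst A) \<cdot> (idn V ?I \<odot> y)) \<cdot> assoc V ?I W T"
      using that A W by simp
    also have "lunit V (fst A) \<cdot> (idn V ?I \<odot> y) = y \<cdot> lunit V (W \<otimes> T)"
      using that by (intro lunit_natural) (auto simp: Hom_def)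
    finally show ?thesis using that A W by (simp add: lunit_assoc)
  qed
  show "opn A f (?I \<otimes> W) (lunit V (fst A) \<cdot> (idn V ?I \<odot> x) \<cdot> assoc V ?I W ?X)
    = lunit V (fst A) \<cdot> (idn V ?I \<odot> opn A f W x) \<cdot> assoc V ?I W ?Y"
    using A f W x y by (simp add: * act_natural[where W=W])
qed

text \<open>This yields the composition of \<open>Str V L\<close>: the family is the transpose of
  internal composition applied to \<open>k\<close> and \<open>h\<close>.\<close>

lemma imor_cmp:
  assumes A: "A \<in> structures V L" and B: "B \<in> structures V L" and D: "D \<in> structures V L"
    and k: "imor Z B D k" and h: "imor W A B h"
  shows "imor (Z \<otimes> W) A D (k \<cdot> (idn V Z \<odot> h) \<cdot> assoc V Z W (fst A))"
  unfolding imor_def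
proof (intro conjI ballI)
  note ka = imor_ar[OF k] and ha = imor_ar[OF h]
  let ?g = "k \<cdot> (idn V Z \<odot> h) \<cdot> assoc V Z W (fst A)"
  show "Z \<otimes> W \<in> Ob V" "?g \<in> Hom V ((Z \<otimes> W) \<otimes> fst A) (fst D)"
    using A B ka ha by (auto simp: Hom_def)
  \<comment> \<open>The stage \<open>(Z \<otimes> W) \<otimes> U\<close> is rebracketed as
    \<open>Z \<otimes> (W \<otimes> U)\<close>, the shape in which the laws for \<open>k\<close> and
    for \<open>h\<close> apply one after the other.\<close>
  have *: "?g \<cdot> (idn V (Z \<otimes> W) \<odot> x) \<cdot> assoc V (Z \<otimes> W) U X
    = (k \<cdot> (idn V Z \<odot> (h \<cdot> (idn V W \<odot> x) \<cdot> assoc V W U X)) \<cdot> assoc V Z (W \<otimes> U) X) \<cdot> (assoc V Z W U \<odot> idn V X)"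
    if x: "x \<in> Ar V" "src V x = U \<otimes> X" "trg V x = fst A" and U: "U \<in> Ob V" "X \<in> Ob V" for x U X
  proof -
    have "?g \<cdot> (idn V (Z \<otimes> W) \<odot> x) \<cdot> assoc V (Z \<otimes> W) U X
      = k \<cdot> (idn V Z \<odot> h) \<cdot> (assoc V Z W (fst A) \<cdot> (idn V (Z \<otimes> W) \<odot> x) \<cdot> assoc V (Z \<otimes> W) U X)"
      using A ka ha x U by simp
    also have "assoc V Z W (fst A) \<cdot> (idn V (Z \<otimes> W) \<odot> x) \<cdot> assoc V (Z \<otimes> W) U X
      = (idn V Z \<odot> ((idn V W \<odot> x) \<cdot> assoc V W U X)) \<cdot> assoc V Z (W \<otimes> U) X \<cdot> (assoc V Z W U \<odot> idn V X)"
      using A ka ha x U by (subst pentagon_arrow) auto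
    finally show ?thesis using A ka ha x U by simp
  qed
  fix f U x assume f: "f \<in> Sym L" and U: "U \<in> Ob V" and "x \<in> Hom V (U \<otimes> inar L f) (fst A)"
  then have x: "x \<in> Ar V" "src V x = U \<otimes> inar L f" "trg V x = fst A" by (auto simp: Hom_def)
  let ?X = "inar L f" and ?Y = "outar L f"
  let ?hx = "h \<cdot> (idn V W \<odot> x) \<cdot> assoc V W U ?X"
  have y: "opn A f U x \<in> Ar V" "src V (opn A f U x) = U \<otimes> ?Y" "trg V (opn A f U x) = fst A"
    using A f U x by auto
  have "opn D f ((Z \<otimes> W) \<otimes> U) (?g \<cdot> (idn V (Z \<otimes> W) \<odot> x) \<cdot> assoc V (Z \<otimes> W) U ?X)
    = opn D f (Z \<otimes> (W \<otimes> U)) (k \<cdot> (idn V Z \<odot> ?hx) \<cdot> assoc V Z (W \<otimes> U) ?X) \<cdot> (assoc V Z W U \<odot> idn V ?Y)"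
    unfolding *[OF x U inar_ob[OF f]] using A B D ka ha f U x by (intro act_natural) auto
  also have "opn D f (Z \<otimes> (W \<otimes> U)) (k \<cdot> (idn V Z \<odot> ?hx) \<cdot> assoc V Z (W \<otimes> U) ?X)
    = k \<cdot> (idn V Z \<odot> opn B f (W \<otimes> U) ?hx) \<cdot> assoc V Z (W \<otimes> U) ?Y"
    using ka ha x f U A by (intro imor_opn[OF k f]) auto
  also have "opn B f (W \<otimes> U) ?hx = h \<cdot> (idn V W \<odot> opn A f U x) \<cdot> assoc V W U ?Y"
    using ha x f U A by (intro imor_opn[OF h f]) auto
  finally show "opn D f ((Z \<otimes> W) \<otimes> U) (?g \<cdot> (idn V (Z \<otimes> W) \<odot> x) \<cdot> assoc V (Z \<otimes> W) U ?X)
    = ?g \<cdot> (idn V (Z \<otimes> W) \<odot> opn A f U x) \<cdot> assoc V (Z \<otimes> W) U ?Y"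
    unfolding *[OF y U outar_ob[OF f]] .
qed

text \<open>\<open>str_eq_l\<close> and \<open>str_eq_r\<close> name the two families of arrows
  whose joint equalizer \<open>str_incl\<close> chooses.\<close>

definition str_eq_l :: "('o, 'a, 'f) struct \<Rightarrow> ('o, 'a, 'f) struct \<Rightarrow> 'f \<Rightarrow> 'a" where
  "str_eq_l A B f = post V (ihom V (inar L f) (fst A)) (snd B f) \<cdot> ipow V (inar L f) (fst A) (fst B)"

definition str_eq_r :: "('o, 'a, 'f) struct \<Rightarrow> ('o, 'a, 'f) struct \<Rightarrow> 'f \<Rightarrow> 'a" where
  "str_eq_r A B f = pre V (snd A f) (ihom V (outar L f) (fst B)) \<cdot> ipow V (outar L f) (fst A) (fst B)"

lemma str_eq_ar:
  assumes "A \<in> structures V L" "B \<in> structures V L" "f \<in> Sym L"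
  shows "str_eq_l A B f \<in> Hom V (ihom V (fst A) (fst B)) (ihom V (ihom V (inar L f) (fst A)) (ihom V (outar L f) (fst B)))"
    "str_eq_r A B f \<in> Hom V (ihom V (fst A) (fst B)) (ihom V (ihom V (inar L f) (fst A)) (ihom V (outar L f) (fst B)))"
  using assms by (auto simp: str_eq_l_def str_eq_r_def Hom_def)

text \<open>The two composites are compared after uncurrying twice; they then agree on the generic
  element \<open>ev : [X, A] \<otimes> X \<rightarrow> A\<close>, of which every other one is a restriction.\<close>

lemma imor_iff:
  assumes A: "A \<in> structures V L" and B: "B \<in> structures V L"
    and z: "z \<in> Ar V" "trg V z = ihom V (fst A) (fst B)" "src V z = Z"
  shows "(\<forall>f \<in> Sym L. str_eq_l A B f \<cdot> z = str_eq_r A B f \<cdot> z) \<longleftrightarrow> imor Z A B (unc (fst A) (fst B) z)"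
proof -
  let ?a = "fst A" and ?b = "fst B" let ?k = "unc ?a ?b z"
  have Z: "Z \<in> Ob V" using z by auto
  have k: "?k \<in> Ar V" "src V ?k = Z \<otimes> ?a" "trg V ?k = ?b" using A B z Z by auto
  have gen: "str_eq_l A B f \<cdot> z = str_eq_r A B f \<cdot> z \<longleftrightarrow>
    opn B f (Z \<otimes> ihom V (inar L f) ?a)
        (?k \<cdot> (idn V Z \<odot> ev V (inar L f) ?a) \<cdot> assoc V Z (ihom V (inar L f) ?a) (inar L f))
      = ?k \<cdot> (idn V Z \<odot> unc (outar L f) ?a (snd A f)) \<cdot> assoc V Z (ihom V (inar L f) ?a) (outar L f)"
    if f: "f \<in> Sym L" for f
  proof -
    let ?X = "inar L f" and ?Y = "outar L f"
    let ?aX = "ihom V ?X ?a" and ?bY = "ihom V ?Y ?b" and ?aY = "ihom V ?Y ?a" and ?bX = "ihom V ?X ?b"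
    let ?l = "str_eq_l A B f \<cdot> z" and ?r = "str_eq_r A B f \<cdot> z"
    have lr: "?l \<in> Ar V" "src V ?l = Z" "trg V ?l = ihom V ?aX ?bY"
      "?r \<in> Ar V" "src V ?r = Z" "trg V ?r = ihom V ?aX ?bY"
      using str_eq_ar[OF A B f] z by (auto simp: Hom_def)
    have l1: "unc ?aX ?bY ?l = snd B f \<cdot> unc ?aX ?bX (ipow V ?X ?a ?b \<cdot> z)"
      using A B f z by (simp add: str_eq_l_def) (subst unc_post_cmp, auto)
    have l: "unc ?Y ?b (unc ?aX ?bY ?l)
      = opn B f (Z \<otimes> ?aX) (?k \<cdot> (idn V Z \<odot> ev V ?X ?a) \<cdot> assoc V Z ?aX ?X)"
      unfolding l1 using A B f z by (simp add: unc_ipow_cmp act_def)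
    have r1: "unc ?aX ?bY ?r = unc ?aY ?bY (ipow V ?Y ?a ?b \<cdot> z) \<cdot> (idn V Z \<odot> snd A f)"
      using A B f z by (simp add: str_eq_r_def) (subst unc_pre_cmp, auto)
    have "unc ?Y ?b (unc ?aX ?bY ?r)
      = unc ?Y ?b (unc ?aY ?bY (ipow V ?Y ?a ?b \<cdot> z)) \<cdot> ((idn V Z \<odot> snd A f) \<odot> idn V ?Y)"
      unfolding r1 using A B f z Z by (subst unc_cmp) auto
    also have "\<dots> = ?k \<cdot> (idn V Z \<odot> unc ?Y ?a (snd A f)) \<cdot> assoc V Z ?aX ?Y"
      using A B f z k Z by (simp add: unc_ipow_cmp unc_def[of "outar L f" _ "snd A f"])
    finally have r: "unc ?Y ?b (unc ?aX ?bY ?r) = ?k \<cdot> (idn V Z \<odot> unc ?Y ?a (snd A f)) \<cdot> assoc V Z ?aX ?Y" .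
    have "?l = ?r \<longleftrightarrow> unc ?Y ?b (unc ?aX ?bY ?l) = unc ?Y ?b (unc ?aX ?bY ?r)"
    proof
      assume *: "unc ?Y ?b (unc ?aX ?bY ?l) = unc ?Y ?b (unc ?aX ?bY ?r)"
      have "unc ?aX ?bY ?l = unc ?aX ?bY ?r"
        by (rule unc_inject[OF _ _ _ _ _ _ _ *]) (use A B f lr in auto)
      then show "?l = ?r"
        by (rule unc_inject[rotated -1]) (use A B f lr in auto)
    qed simp
    then show ?thesis unfolding l r .
  qed
  show ?thesis
  proof
    assume eq: "\<forall>f \<in> Sym L. str_eq_l A B f \<cdot> z = str_eq_r A B f \<cdot> z"
    show "imor Z A B ?k"
      unfolding imor_def
    proof (intro conjI ballI)
      show "Z \<in> Ob V" "?k \<in> Hom V (Z \<otimes> fst A) (fst B)" using Z k by (auto simp: Hom_def)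
      fix f W x assume f: "f \<in> Sym L" and W: "W \<in> Ob V" and "x \<in> Hom V (W \<otimes> inar L f) (fst A)"
      then have x: "x \<in> Ar V" "src V x = W \<otimes> inar L f" "trg V x = ?a" by (auto simp: Hom_def)
      let ?X = "inar L f" and ?Y = "outar L f"
      let ?aX = "ihom V ?X ?a" and ?t = "transp V W (inar L f) (fst A) x"
      have t: "?t \<in> Ar V" "src V ?t = W" "trg V ?t = ?aX" using A f W x by auto
      have u: "unc ?Y ?a (snd A f) \<in> Ar V" "src V (unc ?Y ?a (snd A f)) = ?aX \<otimes> ?Y"
        "trg V (unc ?Y ?a (snd A f)) = ?a" using A f by auto
      have xt: "x = ev V ?X ?a \<cdot> (?t \<odot> idn V ?X)"
        using A f W x ev_transp[of ?X W x ?a] by simp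
      have e: "ev V ?X ?a \<cdot> (?t \<odot> idn V ?X) \<in> Ar V" using A f t by simp
      let ?g = "?k \<cdot> (idn V Z \<odot> ev V ?X ?a) \<cdot> assoc V Z ?aX ?X"
      have "?k \<cdot> (idn V Z \<odot> (ev V ?X ?a \<cdot> (?t \<odot> idn V ?X))) \<cdot> assoc V Z W ?X
        = ?g \<cdot> ((idn V Z \<odot> ?t) \<odot> idn V ?X)"
        using A B f k Z W t by simp
      then have "?k \<cdot> (idn V Z \<odot> x) \<cdot> assoc V Z W ?X = ?g \<cdot> ((idn V Z \<odot> ?t) \<odot> idn V ?X)"
        unfolding xt[symmetric] .
      then have "opn B f (Z \<otimes> W) (?k \<cdot> (idn V Z \<odot> x) \<cdot> assoc V Z W ?X)
        = opn B f (Z \<otimes> ?aX) ?g \<cdot> ((idn V Z \<odot> ?t) \<odot> idn V ?Y)"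
        using A B f k Z W t by (simp only:, intro act_natural) auto
      also have "opn B f (Z \<otimes> ?aX) ?g = ?k \<cdot> (idn V Z \<odot> unc ?Y ?a (snd A f)) \<cdot> assoc V Z ?aX ?Y"
        using gen[OF f] eq f by blast
      also have "(?k \<cdot> (idn V Z \<odot> unc ?Y ?a (snd A f)) \<cdot> assoc V Z ?aX ?Y) \<cdot> ((idn V Z \<odot> ?t) \<odot> idn V ?Y)
          = ?k \<cdot> (idn V Z \<odot> (unc ?Y ?a (snd A f) \<cdot> (?t \<odot> idn V ?Y))) \<cdot> assoc V Z W ?Y"
        using A B f k Z W t u by simp
      also have "unc ?Y ?a (snd A f) \<cdot> (?t \<odot> idn V ?Y) = opn A f W x"
        using A f W x by (subst act_eq_unc) auto
      finally show "opn B f (Z \<otimes> W) (?k \<cdot> (idn V Z \<odot> x) \<cdot> assoc V Z W ?X)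
        = ?k \<cdot> (idn V Z \<odot> opn A f W x) \<cdot> assoc V Z W ?Y" .
    qed
  next
    assume im: "imor Z A B ?k"
    show "\<forall>f \<in> Sym L. str_eq_l A B f \<cdot> z = str_eq_r A B f \<cdot> z"
    proof
      fix f assume f: "f \<in> Sym L"
      show "str_eq_l A B f \<cdot> z = str_eq_r A B f \<cdot> z"
        unfolding gen[OF f] using imor_opn[OF im f, of "ihom V (inar L f) (fst A)" "ev V (inar L f) (fst A)"] A f
        by (simp add: act_ev)
    qed
  qed
qed

end

section \<open>Colimits, equalizers and density\<close>

locale universe =
  fixes \<kappa> :: "'u rel"
  assumes universe: "small_universe \<kappa>"
begin

lemma infinite_universe: "\<not> finite (Field \<kappa>)"
proof -
  have \<kappa>: "Card_order \<kappa>" "natLeq <o \<kappa>" using universe by (auto simp: small_universe_def)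
  have "natLeq \<le>o |Field \<kappa>|"
    using ordLeq_ordIso_trans[OF ordLess_imp_ordLeq[OF \<kappa>(2)] ordIso_symmetric[OF card_of_Field_ordIso[OF \<kappa>(1)]]] .
  then show ?thesis using infinite_iff_natLeq_ordLeq by blast
qed

lemma stable_universe: "stable \<kappa>"
  using universe infinite_universe by (auto simp: small_universe_def intro: regularCard_stable)

lemma small_mono: "small \<kappa> B \<Longrightarrow> A \<subseteq> B \<Longrightarrow> small \<kappa> A"
  unfolding small_def using card_of_mono1 ordLeq_ordLess_trans by blast

lemma small_image [simp]: "small \<kappa> A \<Longrightarrow> small \<kappa> (f ` A)"
  unfolding small_def using card_of_image ordLeq_ordLess_trans by blast

lemma small_UNION [simp]: "small \<kappa> A \<Longrightarrow> (\<And>a. a \<in> A \<Longrightarrow> small \<kappa> (B a)) \<Longrightarrow> small \<kappa> (\<Union>a\<in>A. B a)"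
  unfolding small_def by (rule stable_UNION[OF stable_universe])

lemma small_Sigma [simp]: "small \<kappa> A \<Longrightarrow> (\<And>a. a \<in> A \<Longrightarrow> small \<kappa> (B a)) \<Longrightarrow> small \<kappa> (Sigma A B)"
  unfolding small_def by (rule stable_elim[OF stable_universe])

lemma small_finite [simp]: "finite A \<Longrightarrow> small \<kappa> A"
  unfolding small_def
  using universe ordLess_transitive[of "|A|" natLeq \<kappa>] by (simp add: small_universe_def finite_iff_ordLess_natLeq)

lemma small_Un [simp]: "small \<kappa> A \<Longrightarrow> small \<kappa> B \<Longrightarrow> small \<kappa> (A \<union> B)"
  unfolding small_def
  using universe card_of_Un_ordLess_infinite_Field[OF infinite_universe] by (simp add: small_universe_def)

text \<open>The relation \<kappa> lives on \<open>'u\<close>, so a small set injects into its field.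
  This moves small index categories into \<open>'u\<close>, and later the symbols of the new
  language.\<close>

lemma small_embeds:
  assumes "small \<kappa> A"
  shows "\<exists>f :: _ \<Rightarrow> 'u. inj_on f A"
proof -
  have \<kappa>: "Card_order \<kappa>" "|A| <o \<kappa>" using assms universe by (simp_all add: small_universe_def small_def)
  have "|A| \<le>o |Field \<kappa>|"
    using ordLeq_ordIso_trans[OF ordLess_imp_ordLeq[OF \<kappa>(2)] ordIso_symmetric[OF card_of_Field_ordIso[OF \<kappa>(1)]]] .
  then obtain f :: "_ \<Rightarrow> 'u" where "inj_on f A" unfolding card_of_ordLeq[symmetric] by blast
  then show ?thesis by blast
qed

text \<open>\<open>cocomplete\<close> only speaks about index categories with elements in \<open>'u\<close>.\<close>

lemma cocomplete_colimit:
  assumes coc: "cocomplete \<kappa> C" and J: "category (J :: ('i, 'j) cat)"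
    and sm: "small \<kappa> (Ob J)" "small \<kappa> (Ar J)" and D: "is_functor J C Do Da"
  shows "\<exists>c \<iota>. is_colimit J C Do Da c \<iota>"
proof -
  interpret J: category J by fact
  obtain fo :: "'i \<Rightarrow> 'u" where fo: "inj_on fo (Ob J)" using small_embeds[OF sm(1)] by blast
  obtain fa :: "'j \<Rightarrow> 'u" where fa: "inj_on fa (Ar J)" using small_embeds[OF sm(2)] by blast
  define go where "go = inv_into (Ob J) fo"
  define ga where "ga = inv_into (Ar J) fa"
  have go [simp]: "i \<in> Ob J \<Longrightarrow> go (fo i) = i" for i using fo by (simp add: go_def)
  have ga [simp]: "u \<in> Ar J \<Longrightarrow> ga (fa u) = u" for u using fa by (simp add: ga_def)
  define J' :: "('u, 'u) cat" where "J' = \<lparr>Ob = fo ` Ob J, Ar = fa ` Ar J,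
    src = \<lambda>u. fo (src J (ga u)), trg = \<lambda>u. fo (trg J (ga u)), idn = \<lambda>i. fa (idn J (go i)),
    cmp = \<lambda>v u. fa (ga v \<cdot>\<^bsub>J\<^esub> ga u)\<rparr>"
  have J': "Ob J' = fo ` Ob J" "Ar J' = fa ` Ar J" "src J' u = fo (src J (ga u))"
    "trg J' u = fo (trg J (ga u))" "idn J' i = fa (idn J (go i))" "v \<cdot>\<^bsub>J'\<^esub> u = fa (ga v \<cdot>\<^bsub>J\<^esub> ga u)"
    for u v i by (simp_all add: J'_def)
  have fo_eq: "fo i = fo j \<longleftrightarrow> i = j" if "i \<in> Ob J" "j \<in> Ob J" for i j
    using fo that by (auto dest: inj_onD)
  have "category J'"
    by unfold_locales (auto simp: Hom_def J' fo_eq)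
  then have "small_category \<kappa> J'" using sm by (simp add: small_category_def J')
  moreover have "is_functor J' C (Do \<circ> go) (Da \<circ> ga)"
    using D by (auto simp: is_functor_def J' fo_eq)
  ultimately obtain c \<iota> where c: "is_colimit J' C (Do \<circ> go) (Da \<circ> ga) c \<iota>"
    using coc by (fastforce simp: cocomplete_def)
  have cocone: "is_cocone J' C (Do \<circ> go) (Da \<circ> ga) d \<delta> \<longleftrightarrow> is_cocone J C Do Da d (\<delta> \<circ> fo)" for d \<delta>
    by (auto simp: is_cocone_def J')
  have "is_colimit J C Do Da c (\<iota> \<circ> fo)"
    unfolding is_colimit_def
  proof (intro conjI allI impI)
    show "is_cocone J C Do Da c (\<iota> \<circ> fo)" using c by (simp add: is_colimit_def cocone)
    fix d \<delta> assume "is_cocone J C Do Da d \<delta>"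
    then have "is_cocone J C Do Da d ((\<delta> \<circ> go) \<circ> fo)" by (auto simp: is_cocone_def)
    then have "is_cocone J' C (Do \<circ> go) (Da \<circ> ga) d (\<delta> \<circ> go)" unfolding cocone .
    then have "\<exists>!h. h \<in> Hom C c d \<and> (\<forall>i \<in> Ob J'. h \<cdot>\<^bsub>C\<^esub> \<iota> i = (\<delta> \<circ> go) i)"
      using c unfolding is_colimit_def by blast
    then show "\<exists>!h. h \<in> Hom C c d \<and> (\<forall>i \<in> Ob J. h \<cdot>\<^bsub>C\<^esub> (\<iota> \<circ> fo) i = \<delta> i)" by (simp add: J')
  qed
  then show ?thesis by blast
qed

end

lemma is_colimit_cocone:
  fixes C :: "('o, 'a, 'm) cat_scheme" (structure)
  assumes "is_colimit J C Do Da c \<iota>"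
  shows "c \<in> Ob C" "i \<in> Ob J \<Longrightarrow> \<iota> i \<in> Ar C" "i \<in> Ob J \<Longrightarrow> src C (\<iota> i) = Do i"
    "i \<in> Ob J \<Longrightarrow> trg C (\<iota> i) = c" "u \<in> Ar J \<Longrightarrow> \<iota> (trg J u) \<cdot> Da u = \<iota> (src J u)"
  using assms by (auto simp: is_colimit_def is_cocone_def Hom_def)

lemma is_colimit_factor:
  fixes C :: "('o, 'a, 'm) cat_scheme" (structure)
  assumes "is_colimit J C Do Da c \<iota>" "d \<in> Ob C"
    "\<And>i. i \<in> Ob J \<Longrightarrow> \<delta> i \<in> Ar C \<and> src C (\<delta> i) = Do i \<and> trg C (\<delta> i) = d"
    "\<And>u. u \<in> Ar J \<Longrightarrow> \<delta> (trg J u) \<cdot> Da u = \<delta> (src J u)"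
  shows "\<exists>h. h \<in> Ar C \<and> src C h = c \<and> trg C h = d \<and> (\<forall>i \<in> Ob J. h \<cdot> \<iota> i = \<delta> i)"
proof -
  have "is_cocone J C Do Da d \<delta>" using assms(2-4) by (auto simp: is_cocone_def Hom_def)
  then show ?thesis using assms(1) unfolding is_colimit_def Hom_def by blast
qed

lemma (in category) is_colimit_unique:
  assumes c: "is_colimit J C Do Da c \<iota>" and J: "category J" and D: "is_functor J C Do Da"
    and gh: "g \<in> Ar C" "h \<in> Ar C" "src C g = c" "src C h = c" "trg C g = trg C h"
    "\<And>i. i \<in> Ob J \<Longrightarrow> g \<cdot> \<iota> i = h \<cdot> \<iota> i"
  shows "g = h"
proof -
  interpret J: category J by fact
  have "is_cocone J C Do Da (trg C g) (\<lambda>i. g \<cdot> \<iota> i)"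
    unfolding is_cocone_def
  proof (intro conjI ballI)
    fix u assume u: "u \<in> Ar J"
    have "Da u \<in> Ar C" "src C (Da u) = Do (src J u)" "trg C (Da u) = Do (trg J u)"
      using D u by (auto simp: is_functor_def Hom_def)
    then have "(g \<cdot> \<iota> (trg J u)) \<cdot> Da u = g \<cdot> (\<iota> (trg J u) \<cdot> Da u)"
      using is_colimit_cocone[OF c] gh u by simp
    then show "(g \<cdot> \<iota> (trg J u)) \<cdot> Da u = g \<cdot> \<iota> (src J u)"
      using is_colimit_cocone(5)[OF c u] by simp
  qed (use gh is_colimit_cocone[OF c] in \<open>auto simp: Hom_def\<close>)
  then have "\<exists>!k. k \<in> Hom C c (trg C g) \<and> (\<forall>i \<in> Ob J. k \<cdot> \<iota> i = g \<cdot> \<iota> i)"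
    using c unfolding is_colimit_def by blast
  moreover have "g \<in> Hom C c (trg C g)" "h \<in> Hom C c (trg C g)" using gh by (simp_all add: Hom_def)
  moreover have "\<forall>i \<in> Ob J. h \<cdot> \<iota> i = g \<cdot> \<iota> i" using gh(6) by simp
  ultimately show ?thesis by blast
qed

text \<open>Existence of limits in a locally presentable category by Freyd's argument: the colimit of the
  small category of equalizing arrows out of objects in \<open>P\<close> is weakly terminal among equalizing
  arrows, and coequalizing its endomorphisms makes it terminal.\<close>

locale small_cocomplete = category C + universe \<kappa>
  for C :: "('o, 'a, 'm) cat_scheme" (structure) and \<kappa> :: "'u rel" +
  assumes cocomplete: "cocomplete \<kappa> C"
    and small_Hom [simp]: "\<lbrakk>X \<in> Ob C; Y \<in> Ob C\<rbrakk> \<Longrightarrow> small \<kappa> (Hom C X Y)"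
begin

text \<open>A joint coequalizer of a whole set of parallel arrows. Existence and uniqueness of
  factorizations are separate clauses because the second, that \<open>q\<close> is epi, is used on
  its own.\<close>

definition is_coequalizer :: "'a set \<Rightarrow> 'o \<Rightarrow> 'a \<Rightarrow> bool" where
  "is_coequalizer M Y q \<longleftrightarrow> q \<in> Ar C \<and> src C q = Y \<and> (\<forall>m \<in> M. \<forall>m' \<in> M. q \<cdot> m = q \<cdot> m') \<and>
    (\<forall>h \<in> Ar C. src C h = Y \<and> (\<forall>m \<in> M. \<forall>m' \<in> M. h \<cdot> m = h \<cdot> m') \<longrightarrow>
      (\<exists>k \<in> Ar C. src C k = trg C q \<and> trg C k = trg C h \<and> k \<cdot> q = h)) \<and>
    (\<forall>g \<in> Ar C. \<forall>h \<in> Ar C. src C g = trg C q \<and> src C h = trg C q \<and> trg C g = trg C h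
      \<and> g \<cdot> q = h \<cdot> q \<longrightarrow> g = h)"

lemma is_coequalizerD:
  assumes "is_coequalizer M Y q"
  shows "q \<in> Ar C" "src C q = Y" "m \<in> M \<Longrightarrow> m' \<in> M \<Longrightarrow> q \<cdot> m = q \<cdot> m'"
  using assms unfolding is_coequalizer_def by blast+

lemma is_coequalizer_factor:
  assumes "is_coequalizer M Y q" "h \<in> Ar C" "src C h = Y"
    "\<And>m m'. m \<in> M \<Longrightarrow> m' \<in> M \<Longrightarrow> h \<cdot> m = h \<cdot> m'"
  obtains k where "k \<in> Ar C" "src C k = trg C q" "trg C k = trg C h" "k \<cdot> q = h"
  using assms unfolding is_coequalizer_def by blast

lemma is_coequalizer_epi:
  assumes "is_coequalizer M Y q" "g \<in> Ar C" "h \<in> Ar C" "src C g = trg C q" "src C h = trg C q"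
    "trg C g = trg C h" "g \<cdot> q = h \<cdot> q"
  shows "g = h"
  using assms unfolding is_coequalizer_def by blast

lemma coequalizer_exists:
  assumes X: "X \<in> Ob C" and Y: "Y \<in> Ob C" and M: "M \<subseteq> Hom C X Y" "M \<noteq> {}"
  shows "\<exists>q. is_coequalizer M Y q"
proof -
  \<comment> \<open>If \<open>M\<close> were empty, the colimit formed below would be the coproduct
    of \<open>X\<close> and \<open>Y\<close>.\<close>
  obtain m0 where m0: "m0 \<in> M" using M by blast
  have Mar: "m \<in> Ar C" "src C m = X" "trg C m = Y" if "m \<in> M" for m using M that by (auto simp: Hom_def)
  \<comment> \<open>Two objects, \<open>False\<close> over \<open>X\<close> and \<open>True\<close>
    over \<open>Y\<close>, with one arrow \<open>Inr m\<close> from the first to the second for each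
    \<open>m\<close>; of two composable arrows at least one is an identity
    \<open>Inl b\<close>.\<close>
  define J :: "(bool, bool + 'a) cat" where "J = \<lparr>Ob = UNIV, Ar = range Inl \<union> Inr ` M,
    src = case_sum id (\<lambda>_. False), trg = case_sum id (\<lambda>_. True), idn = Inl,
    cmp = \<lambda>v u. case v of Inl _ \<Rightarrow> u | Inr _ \<Rightarrow> v\<rparr>"
  have J: "Ob J = UNIV" "Ar J = range Inl \<union> Inr ` M" "src J u = case_sum id (\<lambda>_. False) u"
    "trg J u = case_sum id (\<lambda>_. True) u" "idn J i = Inl i"
    "v \<cdot>\<^bsub>J\<^esub> u = (case v of Inl _ \<Rightarrow> u | Inr _ \<Rightarrow> v)" for u v i
    by (simp_all add: J_def)
  define Do where "Do = (\<lambda>b. if b then Y else X)"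
  define Da where "Da = case_sum (\<lambda>b. idn C (Do b)) (\<lambda>m. m)"
  have cJ: "category J" by unfold_locales (auto simp: Hom_def J split: sum.splits)
  have DF: "is_functor J C Do Da"
    using X Y Mar by (auto simp: is_functor_def J Da_def Do_def Hom_def)
  have "small \<kappa> M" using M(1) small_Hom[OF X Y] small_mono by blast
  then obtain c \<iota> where c: "is_colimit J C Do Da c \<iota>"
    using cocomplete_colimit[OF cocomplete cJ _ _ DF] by (auto simp: J)
  note cc = is_colimit_cocone[OF c]
  let ?q = "\<iota> True"
  have q: "?q \<in> Ar C" "src C ?q = Y" "trg C ?q = c" using cc(2-4)[of True] by (auto simp: J Do_def)
  have qm: "?q \<cdot> m = \<iota> False" if "m \<in> M" for m using cc(5)[of "Inr m"] that by (simp add: J Da_def)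
  have "is_coequalizer M Y ?q"
    unfolding is_coequalizer_def
  proof (intro conjI ballI impI)
    fix h assume h: "h \<in> Ar C" and *: "src C h = Y \<and> (\<forall>m \<in> M. \<forall>m' \<in> M. h \<cdot> m = h \<cdot> m')"
    define h0 where "h0 = h \<cdot> m0"
    have h0: "h0 \<in> Ar C" "src C h0 = X" "trg C h0 = trg C h" "\<And>m. m \<in> M \<Longrightarrow> h \<cdot> m = h0"
    proof -
      show "h0 \<in> Ar C" "src C h0 = X" "trg C h0 = trg C h"
        using h * Mar(1)[OF m0] Mar(2)[OF m0] Mar(3)[OF m0] by (simp_all add: h0_def)
      show "\<And>m. m \<in> M \<Longrightarrow> h \<cdot> m = h0" using * m0 unfolding h0_def by blast
    qed
    have hY: "src C h = Y" using * by simp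
    have "\<exists>k. k \<in> Ar C \<and> src C k = c \<and> trg C k = trg C h \<and>
        (\<forall>i \<in> Ob J. k \<cdot> \<iota> i = (if i then h else h0))"
      by (rule is_colimit_factor[OF c]) (use h h0 hY in \<open>auto simp: J Do_def Da_def\<close>)
    then obtain k where "k \<in> Ar C" "src C k = c" "trg C k = trg C h" "k \<cdot> ?q = h"
      by (auto simp: J)
    then show "\<exists>k \<in> Ar C. src C k = trg C ?q \<and> trg C k = trg C h \<and> k \<cdot> ?q = h"
      using q by metis
  next
    fix g h assume gh: "g \<in> Ar C" "h \<in> Ar C"
      and *: "src C g = trg C ?q \<and> src C h = trg C ?q \<and> trg C g = trg C h \<and> g \<cdot> ?q = h \<cdot> ?q"
    have "g \<cdot> \<iota> False = h \<cdot> \<iota> False"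
    proof -
      have "g \<cdot> \<iota> False = (g \<cdot> ?q) \<cdot> m0" using gh(1) conjunct1[OF *] q Mar[OF m0] qm[OF m0] by simp
      also have "\<dots> = (h \<cdot> ?q) \<cdot> m0" using * by simp
      also have "\<dots> = h \<cdot> \<iota> False"
        using gh(2) conjunct1[OF conjunct2[OF *]] q Mar[OF m0] qm[OF m0] by simp
      finally show ?thesis .
    qed
    then have gh_eq: "g \<cdot> \<iota> i = h \<cdot> \<iota> i" for i using * by (cases i) simp_all
    show "g = h"
      by (rule is_colimit_unique[OF c cJ DF gh _ _ _ gh_eq]) (use * q in simp_all)
  qed (use q qm in auto)
  then show ?thesis by blast
qed

lemma joint_equalizer_exists:
  assumes P: "small \<kappa> P" "P \<subseteq> Ob C"
    and dense: "\<And>A. A \<in> Ob C \<Longrightarrow> \<exists>(J :: ('u, 'u) cat) Do Da \<iota>. category J \<and> is_functor J C Do Da \<and>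
        Do ` Ob J \<subseteq> P \<and> is_colimit J C Do Da A \<iota>"
    and Y: "Y \<in> Ob C"
    and u: "\<And>i. i \<in> I \<Longrightarrow> u i \<in> Hom C Y (T i)" and v: "\<And>i. i \<in> I \<Longrightarrow> v i \<in> Hom C Y (T i)"
  shows "\<exists>e. is_joint_equalizer C I Y u v e"
proof -
  define Q where "Q z \<longleftrightarrow> z \<in> Ar C \<and> trg C z = Y \<and> (\<forall>i \<in> I. u i \<cdot> z = v i \<cdot> z)" for z
  have Qar: "z \<in> Ar C" "trg C z = Y" if "Q z" for z using that by (auto simp: Q_def)
  have ua: "u i \<in> Ar C" "src C (u i) = Y" "trg C (u i) = T i"
    "v i \<in> Ar C" "src C (v i) = Y" "trg C (v i) = T i" if "i \<in> I" for i
    using u[OF that] v[OF that] by (auto simp: Hom_def)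
  have Q_cmp: "Q (z \<cdot> f)" if z: "Q z" and f: "f \<in> Ar C" "trg C f = src C z" for z f
  proof -
    have "u i \<cdot> z \<cdot> f = v i \<cdot> z \<cdot> f" if i: "i \<in> I" for i
    proof -
      have "(u i \<cdot> z) \<cdot> f = (v i \<cdot> z) \<cdot> f" using \<open>Q z\<close> i by (simp add: Q_def)
      then show ?thesis using ua[OF i] Qar[OF \<open>Q z\<close>] f by simp
    qed
    then show ?thesis using f Qar[OF z] by (simp add: Q_def)
  qed
  \<comment> \<open>Equalizing arrows with source in \<open>P\<close>, and commuting triangles over
    \<open>Y\<close> between them. An arrow carries both ends, since \<open>a\<close> alone does not
    determine \<open>z'\<close>.\<close>
  define J :: "('a, 'a \<times> 'a \<times> 'a) cat" where "J = \<lparr>Ob = {z. Q z \<and> src C z \<in> P},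
    Ar = {(z, a, z'). Q z \<and> src C z \<in> P \<and> Q z' \<and> src C z' \<in> P \<and>
      a \<in> Hom C (src C z) (src C z') \<and> z' \<cdot> a = z},
    src = fst, trg = \<lambda>t. snd (snd t), idn = \<lambda>z. (z, idn C (src C z), z),
    cmp = \<lambda>t s. (fst s, fst (snd t) \<cdot> fst (snd s), snd (snd t))\<rparr>"
  have J: "Ob J = {z. Q z \<and> src C z \<in> P}"
    "Ar J = {(z, a, z'). Q z \<and> src C z \<in> P \<and> Q z' \<and> src C z' \<in> P \<and>
      a \<in> Hom C (src C z) (src C z') \<and> z' \<cdot> a = z}"
    "src J t = fst t" "trg J t = snd (snd t)" "idn J z = (z, idn C (src C z), z)"
    "t \<cdot>\<^bsub>J\<^esub> s = (fst s, fst (snd t) \<cdot> fst (snd s), snd (snd t))" for t s z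
    by (simp_all add: J_def)
  have HomJ: "\<exists>a. t = (z, a, z') \<and> a \<in> Ar C \<and> src C a = src C z \<and> trg C a = src C z'"
    if "t \<in> Hom J z z'" for t z z'
    using that by (auto simp: Hom_def J)
  have cJ: "category J"
  proof (unfold_locales, goal_cases)
    case (5 t z z') from HomJ[OF this] show ?case by (auto simp: J)
  next
    case (6 t z z') from HomJ[OF this] show ?case by (auto simp: J)
  next
    case (7 t z' z'' s z r y)
    from HomJ[OF 7(1)] HomJ[OF 7(2)] HomJ[OF 7(3)] show ?case by (auto simp: J)
  next
    case (4 t z' z'' s z)
    obtain b where t: "t = (z', b, z'')" "Q z''" "src C z'' \<in> P" "b \<in> Ar C" "src C b = src C z'"
      "trg C b = src C z''" and zb: "z'' \<cdot> b = z'"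
      using 4(1) by (auto simp: Hom_def J)
    obtain a where s: "s = (z, a, z')" "Q z" "src C z \<in> P" "a \<in> Ar C" "src C a = src C z"
      "trg C a = src C z'" and za: "z' \<cdot> a = z"
      using 4(2) by (auto simp: Hom_def J)
    have "z'' \<cdot> (b \<cdot> a) = (z'' \<cdot> b) \<cdot> a" using t(2-) s(2-) Qar by simp
    then have "z'' \<cdot> (b \<cdot> a) = z" unfolding zb za .
    then show ?case using t s by (simp add: Hom_def J)
  qed (simp_all add: Hom_def J Qar split: prod.splits)
  have smO: "small \<kappa> (Ob J)"
  proof (rule small_mono)
    show "small \<kappa> (\<Union>p\<in>P. Hom C p Y)" using P Y by (intro small_UNION) auto
    show "Ob J \<subseteq> (\<Union>p\<in>P. Hom C p Y)" by (auto simp: J Hom_def Q_def)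
  qed
  have smA: "small \<kappa> (Ar J)"
  proof (rule small_mono)
    show "small \<kappa> (Ob J \<times> (\<Union>p\<in>P. \<Union>p'\<in>P. Hom C p p') \<times> Ob J)"
      using P smO by (intro small_Sigma small_UNION small_Hom) auto
    show "Ar J \<subseteq> Ob J \<times> (\<Union>p\<in>P. \<Union>p'\<in>P. Hom C p p') \<times> Ob J" by (auto simp: J)
  qed
  have DF: "is_functor J C (src C) (\<lambda>t. fst (snd t))"
    by (auto simp: is_functor_def J Hom_def Qar)
  obtain K \<iota> where K: "is_colimit J C (src C) (\<lambda>t. fst (snd t)) K \<iota>"
    using cocomplete_colimit[OF cocomplete cJ smO smA DF] by blast
  note Kc = is_colimit_cocone[OF K]
  \<comment> \<open>The objects of \<open>J\<close> are themselves the legs of a cocone with vertex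
    \<open>Y\<close>.\<close>
  have "\<exists>e. e \<in> Ar C \<and> src C e = K \<and> trg C e = Y \<and> (\<forall>z \<in> Ob J. e \<cdot> \<iota> z = z)"
    by (rule is_colimit_factor[OF K]) (auto simp: J Y Qar)
  then obtain e where e: "e \<in> Ar C" "src C e = K" "trg C e = Y" "\<And>z. z \<in> Ob J \<Longrightarrow> e \<cdot> \<iota> z = z"
    by blast
  have Qe: "Q e"
    unfolding Q_def
  proof (intro conjI ballI)
    fix i assume i: "i \<in> I"
    show "u i \<cdot> e = v i \<cdot> e"
    proof (rule is_colimit_unique[OF K cJ DF])
      fix z assume z: "z \<in> Ob J"
      then show "(u i \<cdot> e) \<cdot> \<iota> z = (v i \<cdot> e) \<cdot> \<iota> z"
        using e ua[OF i] Kc(2-4)[OF z] i by (simp add: J Q_def)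
    qed (use e ua[OF i] in auto)
  qed (use e in auto)
  \<comment> \<open>The source of \<open>z\<close> is a colimit of objects in \<open>P\<close>. The
    restrictions of \<open>z\<close> to these are objects of \<open>J\<close>, and their
    coprojections into \<open>K\<close> glue to \<open>g\<close>.\<close>
  have weak: "\<exists>g. g \<in> Ar C \<and> src C g = src C z \<and> trg C g = K \<and> e \<cdot> g = z" if z: "Q z" for z
  proof -
    note za = Qar[OF z]
    obtain J' :: "('u, 'u) cat" and Do Da \<iota>' where
      J': "category J'" "is_functor J' C Do Da" "Do ` Ob J' \<subseteq> P" "is_colimit J' C Do Da (src C z) \<iota>'"
      using dense[of "src C z"] za by auto
    interpret J': category J' by fact
    note c = is_colimit_cocone[OF J'(4)]
    have zi: "z \<cdot> \<iota>' i \<in> Ob J" "src C (z \<cdot> \<iota>' i) = Do i" if "i \<in> Ob J'" for i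
      using c(2-4)[OF that] z za J'(3) that by (auto simp: J intro!: Q_cmp)
    have "\<exists>g. g \<in> Ar C \<and> src C g = src C z \<and> trg C g = K \<and> (\<forall>i \<in> Ob J'. g \<cdot> \<iota>' i = \<iota> (z \<cdot> \<iota>' i))"
    proof (rule is_colimit_factor[OF J'(4) Kc(1)])
      fix i assume "i \<in> Ob J'"
      then show "\<iota> (z \<cdot> \<iota>' i) \<in> Ar C \<and> src C (\<iota> (z \<cdot> \<iota>' i)) = Do i \<and> trg C (\<iota> (z \<cdot> \<iota>' i)) = K"
        using Kc zi by simp
    next
      fix w assume w: "w \<in> Ar J'"
      have Daw: "Da w \<in> Ar C" "src C (Da w) = Do (src J' w)" "trg C (Da w) = Do (trg J' w)"
        using J'(2) w by (auto simp: is_functor_def Hom_def)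
      have "(z \<cdot> \<iota>' (trg J' w)) \<cdot> Da w = z \<cdot> \<iota>' (src J' w)"
        using za Daw c(2-5) w by simp
      then have "(z \<cdot> \<iota>' (src J' w), Da w, z \<cdot> \<iota>' (trg J' w)) \<in> Ar J"
        using zi[of "src J' w"] zi[of "trg J' w"] w Daw by (simp add: J Hom_def)
      from Kc(5)[OF this] show "\<iota> (z \<cdot> \<iota>' (trg J' w)) \<cdot> Da w = \<iota> (z \<cdot> \<iota>' (src J' w))"
        by (simp add: J)
    qed
    then obtain g where g: "g \<in> Ar C" "src C g = src C z" "trg C g = K"
      "\<And>i. i \<in> Ob J' \<Longrightarrow> g \<cdot> \<iota>' i = \<iota> (z \<cdot> \<iota>' i)" by blast
    have "e \<cdot> g = z"
    proof (rule is_colimit_unique[OF J'(4,1,2)])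
      fix i assume i: "i \<in> Ob J'"
      show "(e \<cdot> g) \<cdot> \<iota>' i = z \<cdot> \<iota>' i"
        using e g c(2-4)[OF i] zi[OF i] i by simp
    qed (use e g za in auto)
    then show ?thesis using g by blast
  qed
  \<comment> \<open>The endomorphisms of the weakly terminal arrow \<open>e\<close>; since the
    identity is one of them, the coequalizer satisfies \<open>q \<cdot> m = q\<close> for
    each.\<close>
  let ?M = "{m \<in> Hom C K K. e \<cdot> m = e}"
  have idM: "idn C K \<in> ?M" using Kc(1) e by (simp add: Hom_def)
  have M: "?M \<subseteq> Hom C K K" "?M \<noteq> {}" using idM by blast+
  obtain q where q: "is_coequalizer ?M K q" using coequalizer_exists[OF Kc(1) Kc(1) M] by blast
  note qa = is_coequalizerD(1,2)[OF q]
  obtain e' where e': "e' \<in> Ar C" "src C e' = trg C q" "trg C e' = Y" "e' \<cdot> q = e"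
    using is_coequalizer_factor[OF q e(1,2)] e(3) by auto
  \<comment> \<open>Coequalizers are epi, so being an equalizing arrow descends along them.\<close>
  have Q_epi: "Q f'" if f: "is_coequalizer N S f" and f': "f' \<in> Ar C" "src C f' = trg C f" "trg C f' = Y"
    and Qf: "Q (f' \<cdot> f)" for N S f f'
  proof -
    note fa = is_coequalizerD(1,2)[OF f]
    have "u i \<cdot> f' = v i \<cdot> f'" if i: "i \<in> I" for i
    proof (rule is_coequalizer_epi[OF f])
      show "(u i \<cdot> f') \<cdot> f = (v i \<cdot> f') \<cdot> f"
        using ua[OF i] f' fa Qf i by (simp add: Q_def)
    qed (use ua[OF i] f' fa in auto)
    then show ?thesis using f' by (simp add: Q_def)
  qed
  have Qe': "Q e'"
    using Q_epi[OF q e'(1-3)] Qe e'(4) by simp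
  \<comment> \<open>Let \<open>c\<close> coequalize \<open>a\<close> and \<open>b\<close>. Then
    \<open>e'\<close> factors through \<open>c\<close> by an equalizing arrow, which factors through
    \<open>e\<close> by some \<open>s\<close>. Now \<open>s \<cdot> c \<cdot> q\<close> is an
    endomorphism of \<open>e\<close>, so composing it with \<open>q\<close> gives \<open>q\<close>;
    as \<open>q\<close> is epi, \<open>q \<cdot> s\<close> is a left inverse of \<open>c\<close>,
    and \<open>c \<cdot> a = c \<cdot> b\<close> can be cancelled.\<close>
  have uniq: "a = b" if ab: "a \<in> Ar C" "b \<in> Ar C" "trg C a = src C e'" "trg C b = src C e'"
    "src C a = src C b" "e' \<cdot> a = e' \<cdot> b" for a b
  proof -
    let ?T = "src C e'"
    have M: "{a, b} \<subseteq> Hom C (src C a) ?T" "{a, b} \<noteq> {}" using ab by (auto simp: Hom_def)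
    have o: "src C a \<in> Ob C" "?T \<in> Ob C" using ab e' qa by auto
    obtain c where c: "is_coequalizer {a, b} ?T c" using coequalizer_exists[OF o M] by blast
    note ca = is_coequalizerD(1,2)[OF c]
    have cab: "c \<cdot> a = c \<cdot> b" using is_coequalizerD(3)[OF c] by blast
    obtain e'' where e'': "e'' \<in> Ar C" "src C e'' = trg C c" "trg C e'' = Y" "e'' \<cdot> c = e'"
    proof (rule is_coequalizer_factor[OF c e'(1)])
      show "e' \<cdot> m = e' \<cdot> m'" if "m \<in> {a, b}" "m' \<in> {a, b}" for m m' using that ab(6) by auto
    qed (use e' in auto)
    have Qe'': "Q e''" using Q_epi[OF c e''(1-3)] Qe' e''(4) by simp
    obtain s where s: "s \<in> Ar C" "src C s = src C e''" "trg C s = K" "e \<cdot> s = e''"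
      using weak[OF Qe''] by blast
    let ?m = "s \<cdot> c \<cdot> q"
    have m: "?m \<in> Hom C K K" using s ca qa e' e'' by (simp add: Hom_def)
    have "e \<cdot> ?m = ((e \<cdot> s) \<cdot> c) \<cdot> q"
      using e(1-3) s(1-3) ca qa e'(1-3) e''(1-3) by simp
    also have "\<dots> = e" using s(4) e''(4) e'(4) by simp
    finally have "?m \<in> ?M" using m by simp
    then have qm: "q \<cdot> ?m = q \<cdot> idn C K" by (rule is_coequalizerD(3)[OF q _ idM])
    have "q \<cdot> (s \<cdot> c) = idn C ?T"
    proof (rule is_coequalizer_epi[OF q])
      show "(q \<cdot> (s \<cdot> c)) \<cdot> q = idn C ?T \<cdot> q" using qm qa s(1-3) ca e'(1-3) e''(1-3) by simp
    qed (use qa s(1-3) ca e'(1-3) e''(1-3) in auto)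
    then have *: "(q \<cdot> (s \<cdot> c)) \<cdot> f = f" if "f \<in> Ar C" "trg C f = ?T" for f using that by simp
    have "(q \<cdot> (s \<cdot> c)) \<cdot> a = (q \<cdot> s) \<cdot> (c \<cdot> a)" using ab(1-5) qa s(1-3) ca e'(1-3) e''(1-3) by simp
    also have "\<dots> = (q \<cdot> (s \<cdot> c)) \<cdot> b" unfolding cab using ab(1-5) qa s(1-3) ca e'(1-3) e''(1-3) by simp
    finally show ?thesis using * ab by simp
  qed
  have "is_joint_equalizer C I Y u v e'"
    unfolding is_joint_equalizer_def
  proof (intro conjI ballI impI)
    fix z assume "z \<in> Ar C" "trg C z = Y \<and> (\<forall>i\<in>I. u i \<cdot> z = v i \<cdot> z)"
    then have z: "Q z" by (simp add: Q_def)
    obtain g where g: "g \<in> Ar C" "src C g = src C z" "trg C g = K" "e \<cdot> g = z" using weak[OF z] by blast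
    have "e' \<cdot> (q \<cdot> g) = (e' \<cdot> q) \<cdot> g" using e'(1-3) qa g(1-3) by simp
    then have "e' \<cdot> (q \<cdot> g) = z" using e'(4) g(4) by simp
    moreover have "q \<cdot> g \<in> Hom C (src C z) (src C e')" using g qa e' by (simp add: Hom_def)
    moreover have "a = b" if "a \<in> Hom C (src C z) (src C e')" "e' \<cdot> a = z"
      "b \<in> Hom C (src C z) (src C e')" "e' \<cdot> b = z" for a b
      by (rule uniq) (use that in \<open>simp_all add: Hom_def\<close>)
    ultimately show "\<exists>!g. g \<in> Hom C (src C z) (src C e') \<and> e' \<cdot> g = z" by blast
  qed (use Qe' in \<open>auto simp: Q_def\<close>)
  then show ?thesis by blast
qed

end

section \<open>Presentable objects and density\<close>

context universe
begin

text \<open>The uniqueness half of preservation, tested on a two-element set, says that arrows out of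
  a presentable object into the colimit factor through the cocone.\<close>

lemma presentable_factor:
  fixes C :: "('o, 'a, 'm) cat_scheme" (structure)
  assumes X: "X \<in> presentable \<kappa> \<rho> C" and J: "small_category \<kappa> J" "filtered \<rho> J"
    "is_functor J C Do Da" "is_colimit J C Do Da c \<iota>" and f: "f \<in> Hom C X c" and C: "category C"
  shows "\<exists>i \<in> Ob J. \<exists>g \<in> Hom C X (Do i). \<iota> i \<cdot> g = f"
proof (rule ccontr)
  assume neg: "\<not> ?thesis"
  interpret category C by fact
  obtain a b :: 'u where ab: "a \<noteq> b"
  proof (rule ccontr)
    assume *: "\<not> thesis"
    have "x = undefined" for x :: 'u using * that by blast
    then have "Field \<kappa> \<subseteq> {undefined}" by blast
    then show False using infinite_universe finite_subset by blast
  qed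
  have *: "\<exists>!\<psi>. \<psi> \<in> Hom C X c \<rightarrow>\<^sub>E {a, b} \<and>
           (\<forall>i \<in> Ob J. \<forall>g \<in> Hom C X (Do i). \<psi> (\<iota> i \<cdot> g) = a)"
    using X J unfolding presentable_def hom_preserves_colimit_def by (auto elim!: allE[of _ "\<lambda>i g. a"])
  \<comment> \<open>The constant function with value \<open>a\<close> and its modification at
    \<open>f\<close> alone have the same restriction along the cocone if \<open>f\<close> does not
    factor; \<open>undefined\<close> off the hom-set is forced by extensionality.\<close>
  have "(\<lambda>g. if g \<in> Hom C X c then a else undefined) \<in> Hom C X c \<rightarrow>\<^sub>E {a, b} \<and>
      (\<forall>i \<in> Ob J. \<forall>g \<in> Hom C X (Do i). (\<lambda>g. if g \<in> Hom C X c then a else undefined) (\<iota> i \<cdot> g) = a)"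
    using is_colimit_cocone[OF J(4)] by (auto simp: Hom_def split: if_splits)
  moreover have "(\<lambda>g. if g \<in> Hom C X c then if g = f then b else a else undefined) \<in> Hom C X c \<rightarrow>\<^sub>E {a, b} \<and>
      (\<forall>i \<in> Ob J. \<forall>g \<in> Hom C X (Do i).
        (\<lambda>g. if g \<in> Hom C X c then if g = f then b else a else undefined) (\<iota> i \<cdot> g) = a)"
    using is_colimit_cocone[OF J(4)] neg by (auto simp: Hom_def split: if_splits)
  ultimately have "(\<lambda>g. if g \<in> Hom C X c then a else undefined)
      = (\<lambda>g. if g \<in> Hom C X c then if g = f then b else a else undefined)"
    using * by blast
  then show False using f ab by (metis (mono_tags))
qed

text \<open>The colimit over objects of \<open>P\<close> defines \<open>h\<close> from the values of
  \<phi> on the cocone. Every other \<open>t\<close> has a presentable source, so it factors through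
  the cocone by \<open>presentable_factor\<close>, and naturality carries the equation over to
  it.\<close>

lemma density:
  fixes C :: "('o, 'a, 'm) cat_scheme" (structure)
  assumes C: "category C" and D: "P \<subseteq> D" "D \<subseteq> presentable \<kappa> \<rho> C"
    and J: "small_category \<kappa> J" "filtered \<rho> J" "is_functor J C Do Da" "Do ` Ob J \<subseteq> P"
      "is_colimit J C Do Da c \<iota>"
    and B: "B \<in> Ob C"
    and \<phi>: "\<And>t. t \<in> Ar C \<Longrightarrow> trg C t = c \<Longrightarrow> src C t \<in> D \<Longrightarrow> \<phi> t \<in> Hom C (src C t) B"
    and nat: "\<And>t w. t \<in> Ar C \<Longrightarrow> trg C t = c \<Longrightarrow> src C t \<in> D \<Longrightarrow> w \<in> Ar C \<Longrightarrow> trg C w = src C t \<Longrightarrow>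
      src C w \<in> D \<Longrightarrow> \<phi> (t \<cdot> w) = \<phi> t \<cdot> w"
  shows "\<exists>h \<in> Hom C c B. \<forall>t \<in> Ar C. trg C t = c \<and> src C t \<in> D \<longrightarrow> h \<cdot> t = \<phi> t"
proof -
  interpret category C by fact
  interpret J: category J using J(1) by (simp add: small_category_def)
  note cc = is_colimit_cocone[OF J(5)]
  have \<iota>D: "src C (\<iota> i) \<in> D" if "i \<in> Ob J" for i using cc(3)[OF that] J(4) D(1) that by auto
  have "\<exists>h. h \<in> Ar C \<and> src C h = c \<and> trg C h = B \<and> (\<forall>i \<in> Ob J. h \<cdot> \<iota> i = \<phi> (\<iota> i))"
  proof (rule is_colimit_factor[OF J(5) B])
    fix i assume i: "i \<in> Ob J"
    show "\<phi> (\<iota> i) \<in> Ar C \<and> src C (\<phi> (\<iota> i)) = Do i \<and> trg C (\<phi> (\<iota> i)) = B"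
      using \<phi>[of "\<iota> i"] cc(2-4)[OF i] \<iota>D[OF i] by (auto simp: Hom_def)
  next
    fix u assume u: "u \<in> Ar J"
    have Dau: "Da u \<in> Ar C" "src C (Da u) = Do (src J u)" "trg C (Da u) = Do (trg J u)"
      using J(3) u by (auto simp: is_functor_def Hom_def)
    have "\<phi> (\<iota> (trg J u) \<cdot> Da u) = \<phi> (\<iota> (trg J u)) \<cdot> Da u"
      using cc(2-4) Dau u \<iota>D cc(3)[of "src J u"] \<iota>D[of "src J u"] by (intro nat) auto
    then show "\<phi> (\<iota> (trg J u)) \<cdot> Da u = \<phi> (\<iota> (src J u))" using cc(5)[OF u] by simp
  qed
  then obtain h where h: "h \<in> Ar C" "src C h = c" "trg C h = B" "\<And>i. i \<in> Ob J \<Longrightarrow> h \<cdot> \<iota> i = \<phi> (\<iota> i)"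
    by blast
  show ?thesis
  proof (intro bexI ballI impI)
    show "h \<in> Hom C c B" using h by (simp add: Hom_def)
    fix t assume t: "t \<in> Ar C" "trg C t = c \<and> src C t \<in> D"
    have tP: "src C t \<in> presentable \<kappa> \<rho> C" using t D(2) by blast
    have "t \<in> Hom C (src C t) c" using t by (simp add: Hom_def)
    from presentable_factor[OF tP J(1,2,3,5) this C] obtain i g where
      i: "i \<in> Ob J" and "g \<in> Hom C (src C t) (Do i)" and t_eq: "\<iota> i \<cdot> g = t" by blast
    then have g: "g \<in> Ar C" "src C g = src C t" "trg C g = Do i" by (auto simp: Hom_def)
    have "h \<cdot> t = (h \<cdot> \<iota> i) \<cdot> g" unfolding t_eq[symmetric] using h g cc(2-4)[OF i] by simp
    also have "\<dots> = \<phi> (\<iota> i) \<cdot> g" using h(4)[OF i] by simp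
    also have "\<dots> = \<phi> (\<iota> i \<cdot> g)"
      using cc(2-4)[OF i] g \<iota>D[OF i] t by (intro nat[symmetric]) auto
    finally show "h \<cdot> t = \<phi> t" using t_eq by simp
  qed
qed

end

section \<open>Testing equality of arrows on a generator\<close>

locale monoidal_generator = symmetric_monoidal_closed V
  for V :: "('o, 'a, 'm) smc_scheme" (structure) +
  fixes \<G> :: "'o set"
  assumes generator_Ob: "\<G> \<subseteq> Ob V"
    and generator: "\<And>X Y f g. \<lbrakk>f \<in> Hom V X Y; g \<in> Hom V X Y;
      \<And>G h. G \<in> \<G> \<Longrightarrow> h \<in> Hom V G X \<Longrightarrow> f \<cdot> h = g \<cdot> h\<rbrakk> \<Longrightarrow> f = g"
begin

text \<open>After the braiding both arrows are transposed to \<open>Y -> [W, A]\<close>, where joint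
  faithfulness applies: tensoring with \<open>W\<close> preserves jointly epimorphic families
  because it has a right adjoint.\<close>

lemma generator_tensor:
  assumes k: "k \<in> Ar V" "src V k = W \<otimes> Y" "trg V k = A"
    and k': "k' \<in> Ar V" "src V k' = W \<otimes> Y" "trg V k' = A"
    and W: "W \<in> Ob V" and Y: "Y \<in> Ob V"
    and eq: "\<And>g. g \<in> Ar V \<Longrightarrow> src V g \<in> \<G> \<Longrightarrow> trg V g = Y \<Longrightarrow> k \<cdot> (idn V W \<odot> g) = k' \<cdot> (idn V W \<odot> g)"
  shows "k = k'"
proof -
  let ?t = "\<lambda>k. transp V Y W A (k \<cdot> braid V Y W)"
  have t: "?t k \<cdot> g = transp V (src V g) W A (k \<cdot> (idn V W \<odot> g) \<cdot> braid V (src V g) W)"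
    if "k \<in> Ar V" "src V k = W \<otimes> Y" "trg V k = A" "g \<in> Ar V" "trg V g = Y" for k g
  proof -
    have "braid V Y W \<cdot> (g \<odot> idn V W) = (idn V W \<odot> g) \<cdot> braid V (src V g) W"
      using that W by (intro braid_natural) (auto simp: Hom_def)
    then show ?thesis using that W Y by (subst transp_cmp) auto
  qed
  have "?t k = ?t k'"
  proof (rule generator)
    fix G g assume "G \<in> \<G>" "g \<in> Hom V G Y"
    then have g: "g \<in> Ar V" "src V g \<in> \<G>" "trg V g = Y" by (auto simp: Hom_def)
    have "(k \<cdot> (idn V W \<odot> g)) \<cdot> braid V (src V g) W = (k' \<cdot> (idn V W \<odot> g)) \<cdot> braid V (src V g) W"
      using eq[OF g] by simp
    then have "k \<cdot> (idn V W \<odot> g) \<cdot> braid V (src V g) W = k' \<cdot> (idn V W \<odot> g) \<cdot> braid V (src V g) W"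
      using k k' g W by simp
    then show "?t k \<cdot> g = ?t k' \<cdot> g" using t[OF k g(1,3)] t[OF k' g(1,3)] by simp
  qed (use k k' W Y in \<open>auto simp: Hom_def\<close>)
  then have "k \<cdot> braid V Y W = k' \<cdot> braid V Y W"
    by (rule transp_inject) (use k k' W Y in auto)
  then have "(k \<cdot> braid V Y W) \<cdot> braid V W Y = (k' \<cdot> braid V Y W) \<cdot> braid V W Y" by simp
  then show ?thesis using k k' W Y by (simp add: braid_symmetric)
qed

text \<open>\<open>Y\<close> is transposed away first, which leaves the situation of
  \<open>generator_tensor\<close>. With \<open>Z\<close> the stage of a generalized element, this
  reduces powers by arbitrary objects to powers by members of the generator.\<close>

lemma generator_tensor_mid:
  assumes k: "k \<in> Ar V" "src V k = (W \<otimes> Z) \<otimes> Y" "trg V k = A"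
    and k': "k' \<in> Ar V" "src V k' = (W \<otimes> Z) \<otimes> Y" "trg V k' = A"
    and W: "W \<in> Ob V" and Y: "Y \<in> Ob V" and Z: "Z \<in> Ob V"
    and eq: "\<And>g. g \<in> Ar V \<Longrightarrow> src V g \<in> \<G> \<Longrightarrow> trg V g = Z \<Longrightarrow>
      k \<cdot> ((idn V W \<odot> g) \<odot> idn V Y) = k' \<cdot> ((idn V W \<odot> g) \<odot> idn V Y)"
  shows "k = k'"
proof (rule transp_inject)
  show "transp V (W \<otimes> Z) Y A k = transp V (W \<otimes> Z) Y A k'"
  proof (rule generator_tensor)
    fix g assume g: "g \<in> Ar V" "src V g \<in> \<G>" "trg V g = Z"
    have "transp V (W \<otimes> Z) Y A k \<cdot> (idn V W \<odot> g)
      = transp V (W \<otimes> src V g) Y A (k \<cdot> ((idn V W \<odot> g) \<odot> idn V Y))"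
      using k g W Y Z by (subst transp_cmp) auto
    also have "\<dots> = transp V (W \<otimes> Z) Y A k' \<cdot> (idn V W \<odot> g)"
      unfolding eq[OF g] using k' g W Y Z by (subst transp_cmp) auto
    finally show "transp V (W \<otimes> Z) Y A k \<cdot> (idn V W \<odot> g) = transp V (W \<otimes> Z) Y A k' \<cdot> (idn V W \<odot> g)" .
  qed (use k k' W Y Z in auto)
qed (use k k' W Y Z in auto)

text \<open>Transposed, composition with \<open>A^g\<close> is restriction along
  \<open>W \<otimes> g\<close>, so \<open>generator_tensor\<close> applies. This is what brings
  output arities into the generator.\<close>

lemma generator_pre:
  assumes \<phi>: "\<phi> \<in> Ar V" "trg V \<phi> = ihom V Y A" and \<psi>: "\<psi> \<in> Ar V" "trg V \<psi> = ihom V Y A"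
    and src: "src V \<phi> = src V \<psi>" and o: "Y \<in> Ob V" "A \<in> Ob V"
    and eq: "\<And>g. g \<in> Ar V \<Longrightarrow> src V g \<in> \<G> \<Longrightarrow> trg V g = Y \<Longrightarrow> pre V g A \<cdot> \<phi> = pre V g A \<cdot> \<psi>"
  shows "\<phi> = \<psi>"
proof (rule unc_inject)
  show "unc Y A \<phi> = unc Y A \<psi>"
  proof (rule generator_tensor)
    fix g assume g: "g \<in> Ar V" "src V g \<in> \<G>" "trg V g = Y"
    have "unc (src V g) A (pre V g A \<cdot> \<phi>) = unc Y A \<phi> \<cdot> (idn V (src V \<phi>) \<odot> g)"
      using \<phi> g o by (subst unc_pre_cmp) auto
    moreover have "unc (src V g) A (pre V g A \<cdot> \<psi>) = unc Y A \<psi> \<cdot> (idn V (src V \<phi>) \<odot> g)"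
      unfolding src using \<psi> g o by (subst unc_pre_cmp) auto
    ultimately show "unc Y A \<phi> \<cdot> (idn V (src V \<phi>) \<odot> g) = unc Y A \<psi> \<cdot> (idn V (src V \<phi>) \<odot> g)"
      unfolding eq[OF g] by simp
  qed (use \<phi> \<psi> src o in auto)
qed (use \<phi> \<psi> src o in auto)

end

text \<open>Density with a parameter \<open>W\<close>: by closedness it is \<open>density\<close>
  with target \<open>[W, A]\<close>, the braiding bringing the varying factor to the left.\<close>

lemma (in universe) tensor_density:
  fixes V :: "('o, 'a, 'm) smc_scheme" (structure)
  assumes V: "symmetric_monoidal_closed V" and D: "P \<subseteq> D" "D \<subseteq> presentable \<kappa> \<rho> V"
    and J: "small_category \<kappa> J" "filtered \<rho> J" "is_functor J V Do Da" "Do ` Ob J \<subseteq> P"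
      "is_colimit J V Do Da c \<iota>"
    and o: "W \<in> Ob V" "A \<in> Ob V"
    and \<phi>: "\<And>t. t \<in> Ar V \<Longrightarrow> trg V t = c \<Longrightarrow> src V t \<in> D \<Longrightarrow> \<phi> t \<in> Hom V (W \<otimes> src V t) A"
    and nat: "\<And>t w. t \<in> Ar V \<Longrightarrow> trg V t = c \<Longrightarrow> src V t \<in> D \<Longrightarrow> w \<in> Ar V \<Longrightarrow> trg V w = src V t \<Longrightarrow>
      src V w \<in> D \<Longrightarrow> \<phi> (t \<cdot> w) = \<phi> t \<cdot> (idn V W \<odot> w)"
  shows "\<exists>h \<in> Hom V (W \<otimes> c) A. \<forall>t \<in> Ar V. trg V t = c \<and> src V t \<in> D \<longrightarrow>
    h \<cdot> (idn V W \<odot> t) = \<phi> t"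
proof -
  interpret symmetric_monoidal_closed V by fact
  define \<psi> where "\<psi> t = transp V (src V t) W A (\<phi> t \<cdot> braid V (src V t) W)" for t
  have \<phi>a: "\<phi> t \<in> Ar V" "src V (\<phi> t) = W \<otimes> src V t" "trg V (\<phi> t) = A"
    if "t \<in> Ar V" "trg V t = c" "src V t \<in> D" for t using \<phi>[OF that] by (auto simp: Hom_def)
  have nb: "braid V Y W \<cdot> (w \<odot> idn V W) = (idn V W \<odot> w) \<cdot> braid V (src V w) W"
    "braid V W Y \<cdot> (idn V W \<odot> w) = (w \<odot> idn V W) \<cdot> braid V W (src V w)"
    if "w \<in> Ar V" "trg V w = Y" for w Y
    using that o by (auto intro!: braid_natural simp: Hom_def)
  have "\<exists>h \<in> Hom V c (ihom V W A). \<forall>t \<in> Ar V. trg V t = c \<and> src V t \<in> D \<longrightarrow> h \<cdot> t = \<psi> t"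
  proof (rule density[OF category_axioms D J])
    show "ihom V W A \<in> Ob V" using o by simp
    show "\<psi> t \<in> Hom V (src V t) (ihom V W A)" if "t \<in> Ar V" "trg V t = c" "src V t \<in> D" for t
      using that \<phi>a[OF that] o by (simp add: \<psi>_def Hom_def)
    fix t w assume t: "t \<in> Ar V" "trg V t = c" "src V t \<in> D"
      and w: "w \<in> Ar V" "trg V w = src V t" "src V w \<in> D"
    note ta = \<phi>a[OF t]
    have "\<psi> t \<cdot> w = transp V (src V w) W A (\<phi> t \<cdot> (braid V (src V t) W \<cdot> (w \<odot> idn V W)))"
      unfolding \<psi>_def using t w ta o by (subst transp_cmp) auto
    also have "\<phi> t \<cdot> (braid V (src V t) W \<cdot> (w \<odot> idn V W)) = \<phi> (t \<cdot> w) \<cdot> braid V (src V w) W"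
      unfolding nat[OF t w] nb[OF w(1,2)] using t w ta o by simp
    finally show "\<psi> (t \<cdot> w) = \<psi> t \<cdot> w" using t w by (simp add: \<psi>_def)
  qed
  then obtain h where h: "h \<in> Ar V" "src V h = c" "trg V h = ihom V W A"
    and ht: "\<And>t. t \<in> Ar V \<Longrightarrow> trg V t = c \<Longrightarrow> src V t \<in> D \<Longrightarrow> h \<cdot> t = \<psi> t"
    by (auto simp: Hom_def)
  have c: "c \<in> Ob V" using h by auto
  show ?thesis
  proof (intro bexI[of _ "unc W A h \<cdot> braid V W c"] ballI impI)
    show "unc W A h \<cdot> braid V W c \<in> Hom V (W \<otimes> c) A" using h o c by (simp add: Hom_def)
    fix t assume t: "t \<in> Ar V" "trg V t = c \<and> src V t \<in> D"
    have "(unc W A h \<cdot> braid V W c) \<cdot> (idn V W \<odot> t)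
      = (unc W A h \<cdot> (t \<odot> idn V W)) \<cdot> braid V W (src V t)"
      using h o c t nb(2)[of t c] by simp
    also have "unc W A h \<cdot> (t \<odot> idn V W) = unc W A (h \<cdot> t)"
      using h o t by (subst unc_cmp) auto
    also have "\<dots> = \<phi> t \<cdot> braid V (src V t) W"
      using t \<phi>a[of t] o by (simp add: ht \<psi>_def)
    also have "(\<phi> t \<cdot> braid V (src V t) W) \<cdot> braid V W (src V t) = \<phi> t"
      using t \<phi>a[of t] o by (simp add: braid_symmetric)
    finally show "(unc W A h \<cdot> braid V W c) \<cdot> (idn V W \<odot> t) = \<phi> t" .
  qed
qed

section \<open>The enriched category of structures\<close>

locale structure_homs = structures_over V L
  for V :: "('o, 'a, 'm) smc_scheme" (structure) and L :: "('f, 'o) language" +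
  assumes str_incl_exists: "\<And>A B. \<lbrakk>A \<in> structures V L; B \<in> structures V L\<rbrakk> \<Longrightarrow>
    \<exists>e. is_joint_equalizer V (Sym L) (ihom V (fst A) (fst B)) (str_eq_l A B) (str_eq_r A B) e"
begin

abbreviation "incl \<equiv> str_incl V L"

lemma incl_equalizer:
  assumes "A \<in> structures V L" "B \<in> structures V L"
  shows "is_joint_equalizer V (Sym L) (ihom V (fst A) (fst B)) (str_eq_l A B) (str_eq_r A B) (incl A B)"
  using someI_ex[OF str_incl_exists[OF assms]]
  unfolding str_incl_def str_eq_l_def[abs_def] str_eq_r_def[abs_def] by simp

lemma incl_ar [simp]:
  assumes "A \<in> structures V L" "B \<in> structures V L"
  shows "incl A B \<in> Ar V" "trg V (incl A B) = ihom V (fst A) (fst B)"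
  using incl_equalizer[OF assms] by (auto simp: is_joint_equalizer_def)

lemma incl_imor:
  assumes "A \<in> structures V L" "B \<in> structures V L"
  shows "imor (src V (incl A B)) A B (unc (fst A) (fst B) (incl A B))"
  using incl_equalizer[OF assms] imor_iff[OF assms, of "incl A B"] assms
  by (auto simp: is_joint_equalizer_def)

lemma incl_mono:
  assumes "A \<in> structures V L" "B \<in> structures V L" "g \<in> Ar V" "h \<in> Ar V"
    "trg V g = src V (incl A B)" "trg V h = src V (incl A B)" "src V g = src V h"
    "incl A B \<cdot> g = incl A B \<cdot> h"
  shows "g = h"
  by (rule is_joint_equalizer_mono[OF category_axioms incl_equalizer[OF assms(1,2)] _ _ assms(3-)])
    (use str_eq_ar[OF assms(1,2)] in \<open>auto simp: Hom_def\<close>)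

text \<open>The definite description \<open>factor\<close> is meaningful only if \<open>z\<close>
  equalizes the pairs; \<open>imor_iff\<close> turns that condition into a statement about families
  of morphisms.\<close>

lemma incl_factor:
  assumes A: "A \<in> structures V L" and B: "B \<in> structures V L"
    and z: "z \<in> Ar V" "trg V z = ihom V (fst A) (fst B)" "imor (src V z) A B (unc (fst A) (fst B) z)"
  shows "factor V (incl A B) z \<in> Ar V" "src V (factor V (incl A B) z) = src V z"
    "trg V (factor V (incl A B) z) = src V (incl A B)" "incl A B \<cdot> factor V (incl A B) z = z"
proof -
  have "\<forall>f \<in> Sym L. str_eq_l A B f \<cdot> z = str_eq_r A B f \<cdot> z"
    using imor_iff[OF A B z(1,2) refl] z(3) by simp
  then have "\<exists>!g. g \<in> Hom V (src V z) (src V (incl A B)) \<and> incl A B \<cdot> g = z"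
    using incl_equalizer[OF A B] z unfolding is_joint_equalizer_def by blast
  from theI'[OF this] show "factor V (incl A B) z \<in> Ar V" "src V (factor V (incl A B) z) = src V z"
    "trg V (factor V (incl A B) z) = src V (incl A B)" "incl A B \<cdot> factor V (incl A B) z = z"
    unfolding factor_def by (auto simp: Hom_def)
qed

lemma Str_idn:
  assumes A: "A \<in> structures V L"
  shows "VIdn (Str V L) A \<in> Ar V" "src V (VIdn (Str V L) A) = unit_ob V"
    "trg V (VIdn (Str V L) A) = src V (incl A A)" "incl A A \<cdot> VIdn (Str V L) A = iidn V (fst A)"
  using incl_factor[OF A A, of "iidn V (fst A)"] imor_lunit[OF A] A
  by (auto simp: Str_def unc_iidn)

lemma Str_cmp:
  assumes A: "A \<in> structures V L" and B: "B \<in> structures V L" and D: "D \<in> structures V L"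
  shows "VCmp (Str V L) A B D \<in> Ar V"
    "src V (VCmp (Str V L) A B D) = src V (incl B D) \<otimes> src V (incl A B)"
    "trg V (VCmp (Str V L) A B D) = src V (incl A D)"
    "incl A D \<cdot> VCmp (Str V L) A B D = icmp V (fst A) (fst B) (fst D) \<cdot> (incl B D \<odot> incl A B)"
  using incl_factor[OF A D, of "icmp V (fst A) (fst B) (fst D) \<cdot> (incl B D \<odot> incl A B)"]
    imor_cmp[OF A B D incl_imor[OF B D] incl_imor[OF A B]] A B D
  by (auto simp: Str_def unc_icmp_cmp)

text \<open>The inclusions into the internal homs are mono and respect identities and composition,
  so every law is inherited from \<open>self_vcat V\<close>. The arbitrary \<open>S\<close> covers
  categories of models at the same time.\<close>

lemma Str_vcategory: "vcategory V (full_vsubcat (Str V L) S)"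
proof
  let ?C = "full_vsubcat (Str V L) S"
  have St: "A \<in> structures V L" if "A \<in> VOb ?C" for A
    using that by (auto simp: full_vsubcat_def Str_def)
  have C: "VHom ?C A B = src V (incl A B)" "VIdn ?C = VIdn (Str V L)" "VCmp ?C = VCmp (Str V L)" for A B
    by (auto simp: full_vsubcat_def Str_def)
  interpret self: vcategory V "self_vcat V" by (rule self_vcategory)
  have self: "VHom (self_vcat V) X Y = ihom V X Y" "VIdn (self_vcat V) X = iidn V X"
    "VCmp (self_vcat V) X Y Z = icmp V X Y Z" "X \<in> VOb (self_vcat V) \<longleftrightarrow> X \<in> Ob V" for X Y Z
    by (auto simp: self_vcat_def)
  fix A B assume ob: "A \<in> VOb ?C" "B \<in> VOb ?C"
  note A = St[OF ob(1)] and B = St[OF ob(2)]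
  show "VHom ?C A B \<in> Ob V" using A B by (simp add: C)
  show "VIdn ?C A \<in> Hom V (unit_ob V) (VHom ?C A A)" using Str_idn[OF A] by (simp add: C Hom_def)
  let ?a = "fst A" and ?b = "fst B" and ?m = "VCmp (Str V L)" and ?i = "VIdn (Str V L)"
  show "VCmp ?C A B B \<cdot> (VIdn ?C B \<odot> idn V (VHom ?C A B)) = lunit V (VHom ?C A B)"
    unfolding C
  proof (rule incl_mono[OF A B])
    have "incl A B \<cdot> ?m A B B \<cdot> (?i B \<odot> idn V (src V (incl A B)))
      = (incl A B \<cdot> ?m A B B) \<cdot> (?i B \<odot> idn V (src V (incl A B)))"
      using A B Str_cmp(1-3)[OF A B B] Str_idn(1-3)[OF B] by simp
    also have "\<dots> = icmp V ?a ?b ?b \<cdot> ((incl B B \<cdot> ?i B) \<odot> incl A B)"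
      unfolding Str_cmp(4)[OF A B B] using A B Str_idn(1-3)[OF B] by simp
    also have "\<dots> = (icmp V ?a ?b ?b \<cdot> (iidn V ?b \<odot> idn V (ihom V ?a ?b))) \<cdot> (idn V (unit_ob V) \<odot> incl A B)"
      unfolding Str_idn(4)[OF B] using A B by simp
    also have "\<dots> = lunit V (ihom V ?a ?b) \<cdot> (idn V (unit_ob V) \<odot> incl A B)"
      using self.VIdn_left[of ?a ?b] A B by (simp add: self)
    also have "\<dots> = incl A B \<cdot> lunit V (src V (incl A B))"
      using A B by (intro lunit_natural) (auto simp: Hom_def)
    finally show "incl A B \<cdot> ?m A B B \<cdot> (?i B \<odot> idn V (src V (incl A B)))
      = incl A B \<cdot> lunit V (src V (incl A B))" .
  qed (use A B Str_cmp(1-3)[OF A B B] Str_idn(1-3)[OF B] in auto)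
  show "VCmp ?C A A B \<cdot> (idn V (VHom ?C A B) \<odot> VIdn ?C A) = runit V (VHom ?C A B)"
    unfolding C
  proof (rule incl_mono[OF A B])
    have "incl A B \<cdot> ?m A A B \<cdot> (idn V (src V (incl A B)) \<odot> ?i A)
      = (incl A B \<cdot> ?m A A B) \<cdot> (idn V (src V (incl A B)) \<odot> ?i A)"
      using A B Str_cmp(1-3)[OF A A B] Str_idn(1-3)[OF A] by simp
    also have "\<dots> = icmp V ?a ?a ?b \<cdot> (incl A B \<odot> (incl A A \<cdot> ?i A))"
      unfolding Str_cmp(4)[OF A A B] using A B Str_idn(1-3)[OF A] by simp
    also have "\<dots> = (icmp V ?a ?a ?b \<cdot> (idn V (ihom V ?a ?b) \<odot> iidn V ?a)) \<cdot> (incl A B \<odot> idn V (unit_ob V))"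
      unfolding Str_idn(4)[OF A] using A B by simp
    also have "\<dots> = runit V (ihom V ?a ?b) \<cdot> (incl A B \<odot> idn V (unit_ob V))"
      using self.VIdn_right[of ?a ?b] A B by (simp add: self)
    also have "\<dots> = incl A B \<cdot> runit V (src V (incl A B))"
      using A B by (intro runit_natural) (auto simp: Hom_def)
    finally show "incl A B \<cdot> ?m A A B \<cdot> (idn V (src V (incl A B)) \<odot> ?i A)
      = incl A B \<cdot> runit V (src V (incl A B))" .
  qed (use A B Str_cmp(1-3)[OF A A B] Str_idn(1-3)[OF A] in auto)
  fix D assume obD: "D \<in> VOb ?C"
  note D = St[OF this]
  show "VCmp ?C A B D \<in> Hom V (VHom ?C B D \<otimes> VHom ?C A B) (VHom ?C A D)"
    using Str_cmp[OF A B D] by (simp add: C Hom_def)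
  fix E assume obE: "E \<in> VOb ?C"
  note E = St[OF this]
  let ?d = "fst D" and ?e = "fst E"
  let ?hab = "src V (incl A B)" and ?hbd = "src V (incl B D)" and ?hde = "src V (incl D E)"
  show "VCmp ?C A B E \<cdot> (VCmp ?C B D E \<odot> idn V (VHom ?C A B))
    = VCmp ?C A D E \<cdot> (idn V (VHom ?C D E) \<odot> VCmp ?C A B D) \<cdot> assoc V (VHom ?C D E) (VHom ?C B D) (VHom ?C A B)"
    unfolding C
  proof (rule incl_mono[OF A E])
    have "incl A E \<cdot> ?m A B E \<cdot> (?m B D E \<odot> idn V ?hab)
      = (incl A E \<cdot> ?m A B E) \<cdot> (?m B D E \<odot> idn V ?hab)"
      using A B D E Str_cmp(1-3)[OF A B E] Str_cmp(1-3)[OF B D E] by simp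
    also have "\<dots> = icmp V ?a ?b ?e \<cdot> ((incl B E \<cdot> ?m B D E) \<odot> incl A B)"
      unfolding Str_cmp(4)[OF A B E] using A B D E Str_cmp(1-3)[OF B D E] by simp
    also have "\<dots> = (icmp V ?a ?b ?e \<cdot> (icmp V ?b ?d ?e \<odot> idn V (ihom V ?a ?b))) \<cdot> ((incl D E \<odot> incl B D) \<odot> incl A B)"
      unfolding Str_cmp(4)[OF B D E] using A B D E by simp
    also have "icmp V ?a ?b ?e \<cdot> (icmp V ?b ?d ?e \<odot> idn V (ihom V ?a ?b))
      = icmp V ?a ?d ?e \<cdot> (idn V (ihom V ?d ?e) \<odot> icmp V ?a ?b ?d) \<cdot> assoc V (ihom V ?d ?e) (ihom V ?b ?d) (ihom V ?a ?b)"
      using self.VCmp_assoc[of ?a ?b ?d ?e] A B D E by (simp add: self)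
    also have "\<dots> \<cdot> ((incl D E \<odot> incl B D) \<odot> incl A B)
      = icmp V ?a ?d ?e \<cdot> (incl D E \<odot> (icmp V ?a ?b ?d \<cdot> (incl B D \<odot> incl A B))) \<cdot> assoc V ?hde ?hbd ?hab"
      using A B D E by simp
    also have "\<dots> = (icmp V ?a ?d ?e \<cdot> (incl D E \<odot> incl A D)) \<cdot> (idn V ?hde \<odot> ?m A B D) \<cdot> assoc V ?hde ?hbd ?hab"
      unfolding Str_cmp(4)[OF A B D, symmetric] using A B D E Str_cmp(1-3)[OF A B D] by simp
    also have "\<dots> = incl A E \<cdot> ?m A D E \<cdot> (idn V ?hde \<odot> ?m A B D) \<cdot> assoc V ?hde ?hbd ?hab"
      unfolding Str_cmp(4)[OF A D E, symmetric] using A B D E Str_cmp(1-3)[OF A B D] Str_cmp(1-3)[OF A D E] by simp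
    finally show "incl A E \<cdot> ?m A B E \<cdot> (?m B D E \<odot> idn V ?hab)
      = incl A E \<cdot> ?m A D E \<cdot> (idn V ?hde \<odot> ?m A B D) \<cdot> assoc V ?hde ?hbd ?hab" .
  qed (use A B D E Str_cmp(1-3)[OF A B E] Str_cmp(1-3)[OF B D E] Str_cmp(1-3)[OF A B D] Str_cmp(1-3)[OF A D E] in auto)
qed

lemma forget_vfunctor: "vfunctor V (full_vsubcat (Str V L) S) (self_vcat V) (forget V L)"
proof -
  interpret source: vcategory V "full_vsubcat (Str V L) S" by (rule Str_vcategory)
  interpret target: vcategory V "self_vcat V" by (rule self_vcategory)
  show ?thesis
  proof
    show "VFh (forget V L) A A \<cdot> VIdn (full_vsubcat (Str V L) S) A = VIdn (self_vcat V) (VFo (forget V L) A)"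
      if "A \<in> VOb (full_vsubcat (Str V L) S)" for A
      using that Str_idn(4)[of A] by (auto simp: full_vsubcat_def Str_def forget_def self_vcat_def)
    show "VFh (forget V L) A D \<cdot> VCmp (full_vsubcat (Str V L) S) A B D
      = VCmp (self_vcat V) (VFo (forget V L) A) (VFo (forget V L) B) (VFo (forget V L) D)
        \<cdot> (VFh (forget V L) B D \<odot> VFh (forget V L) A B)"
      if "A \<in> VOb (full_vsubcat (Str V L) S)" "B \<in> VOb (full_vsubcat (Str V L) S)"
        "D \<in> VOb (full_vsubcat (Str V L) S)" for A B D
      using that Str_cmp(4)[of A B D] by (auto simp: full_vsubcat_def Str_def forget_def self_vcat_def)
  qed (auto simp: full_vsubcat_def Str_def forget_def self_vcat_def Hom_def)
qed

end

section \<open>Free structures and extended operations\<close>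

locale free_structures = structure_homs V L
  for V :: "('o, 'a, 'm) smc_scheme" (structure) and L :: "('f, 'o) language" +
  fixes F :: "'o \<Rightarrow> ('o, 'a, 'f) struct" and \<eta> :: "'o \<Rightarrow> 'a"
  assumes left_adjoint: "left_adjoint_forget V L F \<eta>"
begin

abbreviation "U X \<equiv> fst (F X)"

lemma F_structure [simp]: "X \<in> Ob V \<Longrightarrow> F X \<in> structures V L"
  and unit_ar [simp]: "X \<in> Ob V \<Longrightarrow> \<eta> X \<in> Ar V" "X \<in> Ob V \<Longrightarrow> src V (\<eta> X) = X"
    "X \<in> Ob V \<Longrightarrow> trg V (\<eta> X) = U X"
  and adj_iso: "X \<in> Ob V \<Longrightarrow> A \<in> structures V L \<Longrightarrow> iso V (adj_iso V L F \<eta> X A)"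
  using left_adjoint by (auto simp: left_adjoint_forget_def Hom_def)

lemma adj_iso_ar:
  assumes "X \<in> Ob V" "A \<in> structures V L"
  shows "adj_iso V L F \<eta> X A \<in> Ar V" "src V (adj_iso V L F \<eta> X A) = src V (incl (F X) A)"
    "trg V (adj_iso V L F \<eta> X A) = ihom V X (fst A)"
  using assms by (auto simp: adj_iso_def)

text \<open>The extension of \<open>x : Z \<otimes> X \<rightarrow> A\<close> to a \<open>Z\<close>-indexed family of morphisms \<open>F X \<rightarrow> A\<close>.\<close>

definition lift :: "'o \<Rightarrow> 'o \<Rightarrow> ('o, 'a, 'f) struct \<Rightarrow> 'a \<Rightarrow> 'a" where
  "lift Z X A x = unc (U X) (fst A)
     (incl (F X) A \<cdot> inverse_ar V (adj_iso V L F \<eta> X A) \<cdot> transp V Z X (fst A) x)"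

lemma lift:
  assumes X: "X \<in> Ob V" and A: "A \<in> structures V L" and Z: "Z \<in> Ob V"
    and x: "x \<in> Ar V" "src V x = Z \<otimes> X" "trg V x = fst A"
  shows lift_imor: "imor Z (F X) A (lift Z X A x)"
    and lift_unit: "lift Z X A x \<cdot> (idn V Z \<odot> \<eta> X) = x"
proof -
  let ?i = "inverse_ar V (adj_iso V L F \<eta> X A)" and ?t = "transp V Z X (fst A) x"
  note i = inverse_ar[OF adj_iso[OF X A]]
  have F: "F X \<in> structures V L" using X by simp
  have t: "?t \<in> Ar V" "src V ?t = Z" "trg V ?t = ihom V X (fst A)" using A Z X x by auto
  have it: "?i \<cdot> ?t \<in> Ar V" "src V (?i \<cdot> ?t) = Z" "trg V (?i \<cdot> ?t) = src V (incl (F X) A)"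
    using i t adj_iso_ar[OF X A] by auto
  have "lift Z X A x = unc (U X) (fst A) (incl (F X) A) \<cdot> ((?i \<cdot> ?t) \<odot> idn V (U X))"
    unfolding lift_def using it F A by (intro unc_cmp) auto
  then show "imor Z (F X) A (lift Z X A x)"
    using imor_natural[OF F A incl_imor[OF F A] it] by simp
  have "lift Z X A x \<cdot> (idn V Z \<odot> \<eta> X) = unc X (fst A) (pre V (\<eta> X) (fst A) \<cdot> incl (F X) A \<cdot> ?i \<cdot> ?t)"
    unfolding lift_def using it F A X by (subst unc_pre_cmp) auto
  also have "pre V (\<eta> X) (fst A) \<cdot> incl (F X) A \<cdot> ?i \<cdot> ?t = (adj_iso V L F \<eta> X A \<cdot> ?i) \<cdot> ?t"
    unfolding adj_iso_def[of V L F \<eta> X A] using it F A X i(1-3) t adj_iso_ar[OF X A]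
    by (simp add: adj_iso_def)
  also have "\<dots> = ?t" unfolding i(5) using t adj_iso_ar[OF X A] by simp
  finally show "lift Z X A x \<cdot> (idn V Z \<odot> \<eta> X) = x" using X Z x A by simp
qed

text \<open>The transpose of \<open>k\<close> factors through the hom-object of structures, and this
  factor is determined by its image under the adjunction isomorphism, which is the transpose of
  \<open>x\<close>.\<close>

lemma lift_unique:
  assumes X: "X \<in> Ob V" and A: "A \<in> structures V L"
    and k: "imor Z (F X) A k" and x: "k \<cdot> (idn V Z \<odot> \<eta> X) = x"
  shows "k = lift Z X A x"
proof -
  let ?i = "inverse_ar V (adj_iso V L F \<eta> X A)" and ?t = "transp V Z X (fst A) x"
  note i = inverse_ar[OF adj_iso[OF X A]] and ka = imor_ar[OF k]
  have F: "F X \<in> structures V L" using X by simp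
  let ?z = "transp V Z (U X) (fst A) k"
  have z: "?z \<in> Ar V" "src V ?z = Z" "trg V ?z = ihom V (U X) (fst A)"
    and uz: "unc (U X) (fst A) ?z = k" using ka F by auto
  have "imor (src V ?z) (F X) A (unc (U X) (fst A) ?z)" using k z uz by simp
  note g = incl_factor[OF F A z(1,3) this]
  let ?g = "factor V (incl (F X) A) ?z"
  have xa: "x \<in> Ar V" "src V x = Z \<otimes> X" "trg V x = fst A" using x ka X F by auto
  have "adj_iso V L F \<eta> X A \<cdot> ?g = pre V (\<eta> X) (fst A) \<cdot> (incl (F X) A \<cdot> ?g)"
    unfolding adj_iso_def using g(1-3) F A X by simp
  also have "\<dots> = pre V (\<eta> X) (fst A) \<cdot> ?z" using g(4) by simp
  also have "\<dots> = ?t"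
  proof (rule unc_inject[of X "fst A"])
    show "unc X (fst A) (pre V (\<eta> X) (fst A) \<cdot> ?z) = unc X (fst A) ?t"
      using X A z uz x xa ka(1) by (subst unc_pre_cmp) auto
  qed (use X A z xa ka F in auto)
  finally have "?i \<cdot> ?t = ?i \<cdot> adj_iso V L F \<eta> X A \<cdot> ?g" by simp
  also have "\<dots> = (?i \<cdot> adj_iso V L F \<eta> X A) \<cdot> ?g"
    using i(1-3) g(1-3) z adj_iso_ar[OF X A] by simp
  also have "\<dots> = ?g" unfolding i(4) using g(1-3) z adj_iso_ar[OF X A] by simp
  finally have "lift Z X A x = unc (U X) (fst A) (incl (F X) A \<cdot> ?g)" by (simp add: lift_def)
  then show ?thesis using g(4) uz by simp
qed

lemma lift_ar [simp]:
  assumes "X \<in> Ob V" "A \<in> structures V L" "Z \<in> Ob V" "x \<in> Ar V" "src V x = Z \<otimes> X" "trg V x = fst A"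
  shows "lift Z X A x \<in> Ar V" "src V (lift Z X A x) = Z \<otimes> U X" "trg V (lift Z X A x) = fst A"
  using imor_ar[OF lift_imor[OF assms]] by auto

text \<open>Both sides are families of morphisms out of \<open>F X\<close> with the same restriction
  along the unit.\<close>

lemma lift_natural:
  assumes X: "X \<in> Ob V" and A: "A \<in> structures V L"
    and x: "x \<in> Ar V" "src V x = Z \<otimes> X" "trg V x = fst A" and z: "z \<in> Ar V" "trg V z = Z" "src V z = Z'"
  shows "lift Z' X A (x \<cdot> (z \<odot> idn V X)) = lift Z X A x \<cdot> (z \<odot> idn V (U X))"
proof (rule lift_unique[OF X A, symmetric])
  have Z: "Z \<in> Ob V" "Z' \<in> Ob V" using z by auto
  have F: "F X \<in> structures V L" using X by simp
  show "imor Z' (F X) A (lift Z X A x \<cdot> (z \<odot> idn V (U X)))"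
    using z by (intro imor_natural[OF F A lift_imor[OF X A Z(1) x]]) auto
  have "(lift Z X A x \<cdot> (z \<odot> idn V (U X))) \<cdot> (idn V Z' \<odot> \<eta> X)
    = (lift Z X A x \<cdot> (idn V Z \<odot> \<eta> X)) \<cdot> (z \<odot> idn V X)"
    using X A Z x z F by simp
  then show "(lift Z X A x \<cdot> (z \<odot> idn V (U X))) \<cdot> (idn V Z' \<odot> \<eta> X) = x \<cdot> (z \<odot> idn V X)"
    using lift_unit[OF X A Z(1) x] by simp
qed

text \<open>A family of morphisms carries extensions to extensions; this is the reason why extended
  operations commute with such families.\<close>

lemma lift_imor_cmp:
  assumes X: "X \<in> Ob V" and A: "A \<in> structures V L" and B: "B \<in> structures V L"
    and W: "W \<in> Ob V" and x: "x \<in> Ar V" "src V x = W \<otimes> X" "trg V x = fst A" and k: "imor Z A B k"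
  shows "lift (Z \<otimes> W) X B (k \<cdot> (idn V Z \<odot> x) \<cdot> assoc V Z W X)
    = k \<cdot> (idn V Z \<odot> lift W X A x) \<cdot> assoc V Z W (U X)"
proof (rule lift_unique[OF X B, symmetric])
  note ka = imor_ar[OF k]
  have F: "F X \<in> structures V L" using X by simp
  show "imor (Z \<otimes> W) (F X) B (k \<cdot> (idn V Z \<odot> lift W X A x) \<cdot> assoc V Z W (U X))"
    by (rule imor_cmp[OF F A B k lift_imor[OF X A W x]])
  have "(k \<cdot> (idn V Z \<odot> lift W X A x) \<cdot> assoc V Z W (U X)) \<cdot> (idn V (Z \<otimes> W) \<odot> \<eta> X)
    = k \<cdot> (idn V Z \<odot> (lift W X A x \<cdot> (idn V W \<odot> \<eta> X))) \<cdot> assoc V Z W X"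
    using X A W x ka F by (simp flip: tensor_idn)
  then show "(k \<cdot> (idn V Z \<odot> lift W X A x) \<cdot> assoc V Z W (U X)) \<cdot> (idn V (Z \<otimes> W) \<odot> \<eta> X)
    = k \<cdot> (idn V Z \<odot> x) \<cdot> assoc V Z W X"
    using lift_unit[OF X A W x] by simp
qed

text \<open>The interpretation of the extended term of arity \<open>(X, Y)\<close> that corresponds to \<open>s : Y \<rightarrow> U X\<close>.\<close>

definition eop :: "('o, 'a, 'f) struct \<Rightarrow> 'o \<Rightarrow> 'a \<Rightarrow> 'a" where
  "eop A X s = transp V (ihom V X (fst A)) (src V s) (fst A)
     (lift (ihom V X (fst A)) X A (ev V X (fst A)) \<cdot> (idn V (ihom V X (fst A)) \<odot> s))"

lemma
  assumes "X \<in> Ob V" "A \<in> structures V L" "s \<in> Ar V" "trg V s = U X"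
  shows eop_ar [simp]: "eop A X s \<in> Ar V" "src V (eop A X s) = ihom V X (fst A)"
    "trg V (eop A X s) = ihom V (src V s) (fst A)"
    and unc_eop: "unc (src V s) (fst A) (eop A X s)
      = lift (ihom V X (fst A)) X A (ev V X (fst A)) \<cdot> (idn V (ihom V X (fst A)) \<odot> s)"
  using assms by (auto simp: eop_def)

text \<open>The definition of \<open>eop\<close> treats the generic element \<open>ev\<close>;
  naturality of the extension transports it to every \<open>x\<close>.\<close>

lemma act_eop:
  assumes X: "X \<in> Ob V" and A: "A \<in> structures V L" and s: "s \<in> Ar V" "trg V s = U X" "src V s = Y"
    and W: "W \<in> Ob V" and x: "x \<in> Ar V" "src V x = W \<otimes> X" "trg V x = fst A"
  shows "act X Y (fst A) (eop A X s) W x = lift W X A x \<cdot> (idn V W \<odot> s)"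
proof -
  let ?a = "fst A" and ?E = "ihom V X (fst A)" and ?t = "transp V W X (fst A) x"
  have Y: "Y \<in> Ob V" using s by auto
  have F: "F X \<in> structures V L" using X by simp
  have t: "?t \<in> Ar V" "src V ?t = W" "trg V ?t = ?E" using A X W x by auto
  have "act X Y ?a (eop A X s) W x = unc Y ?a (eop A X s) \<cdot> (?t \<odot> idn V Y)"
    using X A s W x Y by (intro act_eq_unc) auto
  also have "\<dots> = (lift ?E X A (ev V X ?a) \<cdot> (?t \<odot> idn V (U X))) \<cdot> (idn V W \<odot> s)"
    using unc_eop[OF X A s(1,2)] s X A t Y F W by simp
  also have "lift ?E X A (ev V X ?a) \<cdot> (?t \<odot> idn V (U X)) = lift W X A (ev V X ?a \<cdot> (?t \<odot> idn V X))"
    using X A t by (intro lift_natural[symmetric]) auto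
  also have "ev V X ?a \<cdot> (?t \<odot> idn V X) = x" using X A W x by (intro ev_transp) auto
  finally show ?thesis .
qed

text \<open>Transposed, both arrows are the extension of \<open>ev\<close> restricted along
  \<open>t \<cdot> \<eta> Y\<close>. From here on an extended term enters only through this arrow
  into \<open>U X\<close>.\<close>

lemma ext_interp_eop:
  assumes X: "X \<in> Ob V" and Y: "Y \<in> Ob V" and A: "A \<in> structures V L"
    and t: "struct_morphism V L (F Y) (F X) t"
  shows "ext_interp V L F \<eta> A X Y t = eop A X (t \<cdot> \<eta> Y)"
proof -
  let ?a = "fst A" and ?E = "ihom V X (fst A)"
  let ?i = "inverse_ar V (adj_iso V L F \<eta> X A)"
  note i = inverse_ar[OF adj_iso[OF X A]]
  have F: "F X \<in> structures V L" "F Y \<in> structures V L" using X Y by auto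
  have ta: "t \<in> Ar V" "src V t = U Y" "trg V t = U X" using t by (auto simp: struct_morphism_def Hom_def)
  let ?z = "pre V t ?a \<cdot> incl (F X) A"
  have z: "?z \<in> Ar V" "src V ?z = src V (incl (F X) A)" "trg V ?z = ihom V (U Y) ?a" using ta F A by auto
  have "unc (U Y) ?a ?z = unc (U X) ?a (incl (F X) A) \<cdot> (idn V (src V (incl (F X) A)) \<odot> t)"
    using ta F A by (subst unc_pre_cmp) auto
  then have "imor (src V ?z) (F Y) A (unc (U Y) ?a ?z)"
    using imor_struct_morphism[OF F(2,1) A incl_imor[OF F(1) A] t] z by simp
  note f = incl_factor[OF F(2) A z(1,3) this]
  have "ext_interp V L F \<eta> A X Y t = pre V (\<eta> Y) ?a \<cdot> (incl (F Y) A \<cdot> factor V (incl (F Y) A) ?z) \<cdot> ?i"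
    unfolding ext_interp_def adj_iso_def[of V L F \<eta> Y A]
    using f(1-3) i(1-3) F A X Y z adj_iso_ar[OF X A] by simp
  also have "\<dots> = pre V (\<eta> Y) ?a \<cdot> pre V t ?a \<cdot> (incl (F X) A \<cdot> ?i)"
    unfolding f(4) using i(1-3) F A X Y ta z adj_iso_ar[OF X A] by simp
  finally have e: "ext_interp V L F \<eta> A X Y t = pre V (\<eta> Y) ?a \<cdot> pre V t ?a \<cdot> (incl (F X) A \<cdot> ?i)" .
  have ii: "incl (F X) A \<cdot> ?i \<in> Ar V" "src V (incl (F X) A \<cdot> ?i) = ?E"
    "trg V (incl (F X) A \<cdot> ?i) = ihom V (U X) ?a"
    using i(1-3) F A adj_iso_ar[OF X A] by auto
  have l: "unc (U X) ?a (incl (F X) A \<cdot> ?i) = lift ?E X A (ev V X ?a)"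
    using i(1-3) F A X adj_iso_ar[OF X A] by (simp add: lift_def)
  have E: "?E \<in> Ob V" using X A by simp
  have "unc Y ?a (ext_interp V L F \<eta> A X Y t)
    = unc (U Y) ?a (pre V t ?a \<cdot> (incl (F X) A \<cdot> ?i)) \<cdot> (idn V ?E \<odot> \<eta> Y)"
    unfolding e using ii ta F A X Y by (subst unc_pre_cmp) auto
  also have "unc (U Y) ?a (pre V t ?a \<cdot> (incl (F X) A \<cdot> ?i)) = lift ?E X A (ev V X ?a) \<cdot> (idn V ?E \<odot> t)"
    using l ii ta F A X by (subst unc_pre_cmp) auto
  finally have "unc Y ?a (ext_interp V L F \<eta> A X Y t) = lift ?E X A (ev V X ?a) \<cdot> (idn V ?E \<odot> (t \<cdot> \<eta> Y))"
    using ta F A X Y E by simp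
  moreover have "unc Y ?a (eop A X (t \<cdot> \<eta> Y)) = lift ?E X A (ev V X ?a) \<cdot> (idn V ?E \<odot> (t \<cdot> \<eta> Y))"
    using unc_eop[OF X A, of "t \<cdot> \<eta> Y"] ta F Y by simp
  ultimately have u: "unc Y ?a (ext_interp V L F \<eta> A X Y t) = unc Y ?a (eop A X (t \<cdot> \<eta> Y))" by simp
  show ?thesis
    by (rule unc_inject[OF _ _ _ _ _ _ _ u]) (use ii ta F A X Y in \<open>auto simp: e\<close>)
qed

end

section \<open>Isomorphisms of enriched categories over V\<close>

definition comparison ::
  "('o, 'a, 'm) smc_scheme \<Rightarrow> ('f, 'o) language \<Rightarrow> ('g, 'o) language
    \<Rightarrow> (('o, 'a, 'f) struct \<Rightarrow> ('o, 'a, 'g) struct)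
    \<Rightarrow> (('o, 'a, 'f) struct, ('o, 'a, 'g) struct, 'a) vfun" where
  "comparison V L L' S =
     \<lparr>VFo = S, VFh = \<lambda>A B. factor V (str_incl V L' (S A) (S B)) (str_incl V L A B)\<rparr>"

text \<open>The map of hom-objects is the unique one over \<open>[A, B]\<close>. It exists because
  the hypothesis on \<open>imor\<close> applies to the universal family, namely the inclusion
  itself; functoriality is checked after composing with a monomorphism.\<close>

lemma comparison_vfunctor:
  fixes V :: "('o, 'a, 'm) smc_scheme" (structure)
  assumes L: "structure_homs V L" and L': "structure_homs V L'"
    and S: "\<And>A. A \<in> structures V L \<Longrightarrow> A \<in> M \<Longrightarrow> S A \<in> structures V L' \<and> S A \<in> M' \<and> fst (S A) = fst A"
    and imor: "\<And>A B Z k. A \<in> structures V L \<Longrightarrow> A \<in> M \<Longrightarrow> B \<in> structures V L \<Longrightarrow> B \<in> M \<Longrightarrow>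
      structures_over.imor V L Z A B k \<Longrightarrow> structures_over.imor V L' Z (S A) (S B) k"
  defines "T \<equiv> comparison V L L' S"
  shows "vfunctor V (full_vsubcat (Str V L) M) (full_vsubcat (Str V L') M') T"
    and "\<And>A B. A \<in> structures V L \<Longrightarrow> A \<in> M \<Longrightarrow> B \<in> structures V L \<Longrightarrow> B \<in> M \<Longrightarrow>
      VFh T A B \<in> Hom V (src V (str_incl V L A B)) (src V (str_incl V L' (S A) (S B)))
      \<and> str_incl V L' (S A) (S B) \<cdot> VFh T A B = str_incl V L A B"
proof -
  interpret L: structure_homs V L by fact
  interpret L': structure_homs V L' by fact
  let ?C = "full_vsubcat (Str V L) M" and ?D = "full_vsubcat (Str V L') M'"
  have ob: "A \<in> VOb ?C \<longleftrightarrow> A \<in> structures V L \<and> A \<in> M"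
    "B \<in> VOb ?D \<longleftrightarrow> B \<in> structures V L' \<and> B \<in> M'" for A B
    by (auto simp: full_vsubcat_def Str_def)
  have C: "VHom ?C A B = src V (L.incl A B)" "VIdn ?C = VIdn (Str V L)" "VCmp ?C = VCmp (Str V L)" for A B
    by (auto simp: full_vsubcat_def Str_def)
  have D: "VHom ?D A B = src V (L'.incl A B)" "VIdn ?D = VIdn (Str V L')" "VCmp ?D = VCmp (Str V L')" for A B
    by (auto simp: full_vsubcat_def Str_def)
  have T: "VFo T = S" by (simp add: T_def comparison_def)
  have Th: "VFh T A B \<in> Ar V" "src V (VFh T A B) = src V (L.incl A B)"
      "trg V (VFh T A B) = src V (L'.incl (S A) (S B))" "L'.incl (S A) (S B) \<cdot> VFh T A B = L.incl A B"
    if "A \<in> structures V L \<and> A \<in> M" "B \<in> structures V L \<and> B \<in> M" for A B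
  proof -
    have "L'.imor (src V (L.incl A B)) (S A) (S B) (L.unc (fst (S A)) (fst (S B)) (L.incl A B))"
      using that S[of A] S[of B] by (auto intro!: imor L.incl_imor)
    moreover have "trg V (L.incl A B) = ihom V (fst (S A)) (fst (S B))" "L.incl A B \<in> Ar V"
      using that S[of A] S[of B] by auto
    ultimately show "VFh T A B \<in> Ar V" "src V (VFh T A B) = src V (L.incl A B)"
      "trg V (VFh T A B) = src V (L'.incl (S A) (S B))" "L'.incl (S A) (S B) \<cdot> VFh T A B = L.incl A B"
      using L'.incl_factor[of "S A" "S B" "L.incl A B"] that S[of A] S[of B] by (auto simp: T_def comparison_def)
  qed
  then show "\<And>A B. A \<in> structures V L \<Longrightarrow> A \<in> M \<Longrightarrow> B \<in> structures V L \<Longrightarrow> B \<in> M \<Longrightarrow>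
      VFh T A B \<in> Hom V (src V (str_incl V L A B)) (src V (str_incl V L' (S A) (S B)))
      \<and> str_incl V L' (S A) (S B) \<cdot> VFh T A B = str_incl V L A B"
    by (auto simp: Hom_def)
  interpret source: vcategory V ?C by (rule L.Str_vcategory)
  interpret target: vcategory V ?D by (rule L'.Str_vcategory)
  show "vfunctor V ?C ?D T"
  proof
    let ?i = "VIdn (Str V L)" and ?i' = "VIdn (Str V L')" and ?c = "VCmp (Str V L)" and ?m' = "VCmp (Str V L')"
    fix A assume A: "A \<in> VOb ?C"
    let ?aa = "L'.incl (S A) (S A)"
    note A' = A[unfolded ob]
    have SA: "S A \<in> structures V L'" "fst (S A) = fst A" "S A \<in> M'" using S A' by auto
    show "VFo T A \<in> VOb ?D" using SA by (simp add: T ob)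
    show "VFh T A A \<cdot> VIdn ?C A = VIdn ?D (VFo T A)"
      unfolding C D T
    proof (rule L'.incl_mono[OF SA(1) SA(1)])
      have "?aa \<cdot> VFh T A A \<cdot> ?i A
        = (?aa \<cdot> VFh T A A) \<cdot> ?i A"
        using A' SA Th(1-3)[OF A' A'] L.Str_idn(1-3)[of A] by simp
      also have "\<dots> = ?aa \<cdot> ?i' (S A)"
        unfolding Th(4)[OF A' A'] using L.Str_idn(4)[of A] L'.Str_idn(4)[OF SA(1)] A' SA by simp
      finally show "?aa \<cdot> VFh T A A \<cdot> ?i A
        = ?aa \<cdot> ?i' (S A)" .
    qed (use A' SA Th(1-3)[OF A' A'] L.Str_idn(1-3)[of A] L'.Str_idn(1-3)[OF SA(1)] in auto)
    fix B assume B: "B \<in> VOb ?C"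
    note B' = B[unfolded ob]
    have SB: "S B \<in> structures V L'" "fst (S B) = fst B" "S B \<in> M'" using S B' by auto
    show "VFh T A B \<in> Hom V (VHom ?C A B) (VHom ?D (VFo T A) (VFo T B))"
      using Th[OF A' B'] by (simp add: C D T Hom_def)
    fix E assume E: "E \<in> VOb ?C"
    let ?ab = "L'.incl (S A) (S B)" and ?be = "L'.incl (S B) (S E)" and ?ae = "L'.incl (S A) (S E)"
    note E' = E[unfolded ob]
    have SE: "S E \<in> structures V L'" "fst (S E) = fst E" "S E \<in> M'" using S E' by auto
    note Cm = L.Str_cmp[OF conjunct1[OF A'] conjunct1[OF B'] conjunct1[OF E']]
    note Cm' = L'.Str_cmp[OF SA(1) SB(1) SE(1)]
    show "VFh T A E \<cdot> VCmp ?C A B E = VCmp ?D (VFo T A) (VFo T B) (VFo T E) \<cdot> (VFh T B E \<odot> VFh T A B)"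
      unfolding C D T
    proof (rule L'.incl_mono[OF SA(1) SE(1)])
      let ?m = "icmp V (fst A) (fst B) (fst E)"
      have "?ae \<cdot> VFh T A E \<cdot> ?c A B E
        = (?ae \<cdot> VFh T A E) \<cdot> ?c A B E"
        using A' E' SA SE Th(1-3)[OF A' E'] Cm(1-3) by simp
      also have "\<dots> = ?m \<cdot> (L.incl B E \<odot> L.incl A B)"
        unfolding Th(4)[OF A' E'] Cm(4) ..
      also have "\<dots> = ?m \<cdot> ((?be \<cdot> VFh T B E) \<odot> (?ab \<cdot> VFh T A B))"
        unfolding Th(4)[OF A' B'] Th(4)[OF B' E'] ..
      also have "\<dots> = (?m \<cdot> (?be \<odot> ?ab)) \<cdot> (VFh T B E \<odot> VFh T A B)"
        using A' B' E' SA SB SE Th(1-3)[OF A' B'] Th(1-3)[OF B' E'] by simp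
      also have "?m \<cdot> (?be \<odot> ?ab)
        = ?ae \<cdot> ?m' (S A) (S B) (S E)"
        using Cm'(4) SA SB SE by simp
      also have "(?ae \<cdot> ?m' (S A) (S B) (S E)) \<cdot> (VFh T B E \<odot> VFh T A B)
        = ?ae \<cdot> ?m' (S A) (S B) (S E) \<cdot> (VFh T B E \<odot> VFh T A B)"
        using A' B' E' SA SB SE Th(1-3)[OF A' B'] Th(1-3)[OF B' E'] Cm'(1-3) by simp
      finally show "?ae \<cdot> VFh T A E \<cdot> ?c A B E
        = ?ae \<cdot> ?m' (S A) (S B) (S E) \<cdot> (VFh T B E \<odot> VFh T A B)" .
    qed (use A' B' E' SA SB SE Th(1-3)[OF A' B'] Th(1-3)[OF B' E'] Th(1-3)[OF A' E'] Cm(1-3) Cm'(1-3) in auto)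
  qed
qed

text \<open>On hom-objects the composite lies over the identity of \<open>[A, B]\<close>, and the
  inclusion is mono. The other composite is treated by exchanging the roles of \<open>S\<close> and
  \<open>R\<close>.\<close>

lemma comparison_inverse:
  fixes V :: "('o, 'a, 'm) smc_scheme" (structure)
  assumes L: "structure_homs V L" and L': "structure_homs V L'"
    and S: "\<And>A. A \<in> structures V L \<Longrightarrow> A \<in> M \<Longrightarrow> S A \<in> structures V L' \<and> S A \<in> M' \<and> fst (S A) = fst A"
    and R: "\<And>A. A \<in> structures V L' \<Longrightarrow> A \<in> M' \<Longrightarrow> R A \<in> structures V L \<and> R A \<in> M \<and> fst (R A) = fst A"
    and RS: "\<And>A. A \<in> structures V L \<Longrightarrow> A \<in> M \<Longrightarrow> R (S A) = A"
    and imor: "\<And>A B Z k. A \<in> structures V L \<Longrightarrow> A \<in> M \<Longrightarrow> B \<in> structures V L \<Longrightarrow> B \<in> M \<Longrightarrow>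
      structures_over.imor V L Z A B k \<Longrightarrow> structures_over.imor V L' Z (S A) (S B) k"
    and imor': "\<And>A B Z k. A \<in> structures V L' \<Longrightarrow> A \<in> M' \<Longrightarrow> B \<in> structures V L' \<Longrightarrow> B \<in> M' \<Longrightarrow>
      structures_over.imor V L' Z A B k \<Longrightarrow> structures_over.imor V L Z (R A) (R B) k"
  shows "vfun_eq (full_vsubcat (Str V L) M) (vfun_cmp V (comparison V L' L R) (comparison V L L' S))
    (vfun_idn V (full_vsubcat (Str V L) M))"
  unfolding vfun_eq_def
proof (intro conjI ballI)
  interpret L: structure_homs V L by fact
  interpret L': structure_homs V L' by fact
  let ?S = "comparison V L L' S" and ?R = "comparison V L' L R" and ?C = "full_vsubcat (Str V L) M"
  have ob: "A \<in> VOb ?C \<longleftrightarrow> A \<in> structures V L \<and> A \<in> M" for A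
    by (auto simp: full_vsubcat_def Str_def)
  fix A assume "A \<in> VOb ?C"
  then have A: "A \<in> structures V L" "A \<in> M" by (simp_all add: ob)
  show "VFo (vfun_cmp V ?R ?S) A = VFo (vfun_idn V ?C) A"
    using RS[OF A] by (simp add: vfun_cmp_def vfun_idn_def comparison_def)
  fix B assume "B \<in> VOb ?C"
  then have B: "B \<in> structures V L" "B \<in> M" by (simp_all add: ob)
  note SA = S[OF A] and SB = S[OF B]
  let ?s = "VFh ?S A B" and ?r = "VFh ?R (S A) (S B)"
  have "?s \<in> Hom V (src V (L.incl A B)) (src V (L'.incl (S A) (S B)))
      \<and> L'.incl (S A) (S B) \<cdot> ?s = L.incl A B"
    by (rule comparison_vfunctor(2)[where M=M and M'=M', OF L L' S imor]) (use A B in auto)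
  then have s: "?s \<in> Ar V" "src V ?s = src V (L.incl A B)" "trg V ?s = src V (L'.incl (S A) (S B))"
    "L'.incl (S A) (S B) \<cdot> ?s = L.incl A B" by (auto simp: Hom_def)
  have "?r \<in> Hom V (src V (L'.incl (S A) (S B))) (src V (L.incl (R (S A)) (R (S B))))
      \<and> L.incl (R (S A)) (R (S B)) \<cdot> ?r = L'.incl (S A) (S B)"
    by (rule comparison_vfunctor(2)[where M=M' and M'=M, OF L' L R imor']) (use SA SB in auto)
  then have r: "?r \<in> Ar V" "src V ?r = src V (L'.incl (S A) (S B))" "trg V ?r = src V (L.incl A B)"
    "L.incl A B \<cdot> ?r = L'.incl (S A) (S B)"
    using RS[OF A] RS[OF B] by (auto simp: Hom_def)
  have "?r \<cdot> ?s = idn V (src V (L.incl A B))"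
  proof (rule L.incl_mono[OF A(1) B(1)])
    have "L.incl A B \<cdot> (?r \<cdot> ?s) = (L.incl A B \<cdot> ?r) \<cdot> ?s"
      using A B r(1-3) s(1-3) by simp
    then show "L.incl A B \<cdot> (?r \<cdot> ?s) = L.incl A B \<cdot> idn V (src V (L.incl A B))"
      unfolding r(4) s(4) using A B by simp
  qed (use A B r(1-3) s(1-3) in auto)
  moreover have "VFh (vfun_cmp V ?R ?S) A B = ?r \<cdot> ?s"
    by (simp add: vfun_cmp_def comparison_def)
  ultimately show "VFh (vfun_cmp V ?R ?S) A B = VFh (vfun_idn V ?C) A B"
    by (simp add: vfun_idn_def full_vsubcat_def Str_def)
qed

text \<open>A hom-object over \<open>[A, B]\<close> is determined up to isomorphism by its
  generalized elements. Comparing \<open>imor\<close> on both sides therefore suffices, although the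
  two equalizers are chosen independently.\<close>

lemma isomorphic_overI:
  assumes L: "structure_homs V L" and L': "structure_homs V L'"
    and S: "\<And>A. A \<in> structures V L \<Longrightarrow> A \<in> M \<Longrightarrow> S A \<in> structures V L' \<and> S A \<in> M' \<and> fst (S A) = fst A"
    and R: "\<And>A. A \<in> structures V L' \<Longrightarrow> A \<in> M' \<Longrightarrow> R A \<in> structures V L \<and> R A \<in> M \<and> fst (R A) = fst A"
    and RS: "\<And>A. A \<in> structures V L \<Longrightarrow> A \<in> M \<Longrightarrow> R (S A) = A"
    and SR: "\<And>A. A \<in> structures V L' \<Longrightarrow> A \<in> M' \<Longrightarrow> S (R A) = A"
    and imor: "\<And>A B Z k. A \<in> structures V L \<Longrightarrow> A \<in> M \<Longrightarrow> B \<in> structures V L \<Longrightarrow> B \<in> M \<Longrightarrow>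
      structures_over.imor V L' Z (S A) (S B) k \<longleftrightarrow> structures_over.imor V L Z A B k"
  shows "isomorphic_over V (full_vsubcat (Str V L) M) (forget V L) (full_vsubcat (Str V L') M') (forget V L')"
proof -
  interpret L: structure_homs V L by fact
  interpret L': structure_homs V L' by fact
  have im: "L'.imor Z (S A) (S B) k"
    if "A \<in> structures V L" "A \<in> M" "B \<in> structures V L" "B \<in> M" "L.imor Z A B k" for A B Z k
    using imor that by simp
  have im': "L.imor Z (R A) (R B) k"
    if "A \<in> structures V L'" "A \<in> M'" "B \<in> structures V L'" "B \<in> M'" "L'.imor Z A B k" for A B Z k
    using imor[of "R A" "R B" Z k] R[OF that(1,2)] R[OF that(3,4)] SR[OF that(1,2)] SR[OF that(3,4)] that(5)
    by simp
  let ?C = "full_vsubcat (Str V L) M" and ?D = "full_vsubcat (Str V L') M'"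
  let ?S = "comparison V L L' S" and ?R = "comparison V L' L R"
  have "str_incl V L' (S A) (S B) \<cdot>\<^bsub>V\<^esub> VFh ?S A B = str_incl V L A B"
    if "A \<in> structures V L" "A \<in> M" "B \<in> structures V L" "B \<in> M" for A B
    by (rule conjunct2[OF comparison_vfunctor(2)[where M=M and M'=M', OF L L' S im]]) (use that in auto)
  then have "vfun_eq ?C (vfun_cmp V (forget V L') ?S) (forget V L)"
    using S by (auto simp: vfun_eq_def vfun_cmp_def forget_def full_vsubcat_def Str_def comparison_def)
  moreover have "vfunctor V ?C ?D ?S" by (rule comparison_vfunctor(1)[OF L L' S im])
  moreover have "vfunctor V ?D ?C ?R" by (rule comparison_vfunctor(1)[OF L' L R im'])
  moreover have "vfun_eq ?C (vfun_cmp V ?R ?S) (vfun_idn V ?C)"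
    by (rule comparison_inverse[OF L L' S R RS im im'])
  moreover have "vfun_eq ?D (vfun_cmp V ?S ?R) (vfun_idn V ?D)"
    by (rule comparison_inverse[OF L' L R S SR im' im])
  ultimately show ?thesis
    unfolding isomorphic_over_def
    using L.forget_vfunctor L'.forget_vfunctor by blast
qed

section \<open>Powers of symbols and the laws of extended operations\<close>

context free_structures
begin

text \<open>This is the value that \<open>interp\<close> gives to \<open>TPow Z\<close> of the
  symbol \<open>f\<close>.\<close>

definition pow :: "('o, 'a, 'f) struct \<Rightarrow> 'o \<Rightarrow> 'f \<Rightarrow> 'a" where
  "pow A Z f = inverse_ar V (curry_iso V Z (outar L f) (fst A)) \<cdot> post V Z (snd A f)
     \<cdot> curry_iso V Z (inar L f) (fst A)"

lemma
  assumes "A \<in> structures V L" "Z \<in> Ob V" "f \<in> Sym L"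
  shows pow_ar [simp]: "pow A Z f \<in> Ar V" "src V (pow A Z f) = ihom V (Z \<otimes> inar L f) (fst A)"
      "trg V (pow A Z f) = ihom V (Z \<otimes> outar L f) (fst A)"
    and act_pow: "\<lbrakk>W \<in> Ob V; x \<in> Ar V; src V x = W \<otimes> (Z \<otimes> inar L f); trg V x = fst A\<rbrakk> \<Longrightarrow>
      act (Z \<otimes> inar L f) (Z \<otimes> outar L f) (fst A) (pow A Z f) W x \<cdot> assoc V W Z (outar L f)
      = opn A f (W \<otimes> Z) (x \<cdot> assoc V W Z (inar L f))"
proof -
  note i = inverse_ar[OF curry_iso[of Z "outar L f" "fst A"]]
  show "pow A Z f \<in> Ar V" "src V (pow A Z f) = ihom V (Z \<otimes> inar L f) (fst A)"
    "trg V (pow A Z f) = ihom V (Z \<otimes> outar L f) (fst A)"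
    using assms i(1-3) by (auto simp: pow_def)
  show "act (Z \<otimes> inar L f) (Z \<otimes> outar L f) (fst A) (pow A Z f) W x \<cdot> assoc V W Z (outar L f)
      = opn A f (W \<otimes> Z) (x \<cdot> assoc V W Z (inar L f))"
    if "W \<in> Ob V" "x \<in> Ar V" "src V x = W \<otimes> (Z \<otimes> inar L f)" "trg V x = fst A"
    unfolding pow_def using assms that by (intro act_power) auto
qed

lemma unc_pow:
  assumes A: "A \<in> structures V L" and Z: "Z \<in> Ob V" and f: "f \<in> Sym L"
    and \<psi>: "\<psi> \<in> Ar V" "trg V \<psi> = ihom V (Z \<otimes> inar L f) (fst A)" "src V \<psi> = W"
  shows "unc (Z \<otimes> outar L f) (fst A) (pow A Z f \<cdot> \<psi>) \<cdot> assoc V W Z (outar L f)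
    = opn A f (W \<otimes> Z) (unc (Z \<otimes> inar L f) (fst A) \<psi> \<cdot> assoc V W Z (inar L f))"
proof -
  let ?X = "Z \<otimes> inar L f" and ?Y = "Z \<otimes> outar L f"
  have "act ?X ?Y (fst A) (pow A Z f) W (unc ?X (fst A) \<psi>) = unc ?Y (fst A) (pow A Z f \<cdot> \<psi>)"
    using A Z f \<psi> by (simp add: act_def)
  moreover have W: "W \<in> Ob V" using \<psi> by auto
  ultimately show ?thesis using act_pow[OF A Z f W, of "unc ?X (fst A) \<psi>"] A Z f \<psi> by simp
qed

text \<open>This law and the next two are soundness of the first three groups of equations in
  \<open>base\<close>; \<open>eop_unique\<close> is the converse.\<close>

lemma eop_unit:
  assumes X: "X \<in> Ob V" and A: "A \<in> structures V L"
  shows "eop A X (\<eta> X) = idn V (ihom V X (fst A))"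
proof (rule unc_inject[of X "fst A"])
  show "unc X (fst A) (eop A X (\<eta> X)) = unc X (fst A) (idn V (ihom V X (fst A)))"
    using unc_eop[OF X A, of "\<eta> X"] lift_unit[OF X A, of "ihom V X (fst A)" "ev V X (fst A)"] X A by simp
qed (use X A in auto)

lemma eop_cmp:
  assumes X: "X \<in> Ob V" and A: "A \<in> structures V L" and s: "s \<in> Ar V" "trg V s = U X"
    and w: "w \<in> Ar V" "trg V w = src V s"
  shows "eop A X (s \<cdot> w) = pre V w (fst A) \<cdot> eop A X s"
proof (rule unc_inject[of "src V w" "fst A"])
  have "unc (src V w) (fst A) (pre V w (fst A) \<cdot> eop A X s)
    = unc (src V s) (fst A) (eop A X s) \<cdot> (idn V (ihom V X (fst A)) \<odot> w)"
    using X A s w by (subst unc_pre_cmp) auto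
  then show "unc (src V w) (fst A) (eop A X (s \<cdot> w)) = unc (src V w) (fst A) (pre V w (fst A) \<cdot> eop A X s)"
    using unc_eop[OF X A, of "s \<cdot> w"] unc_eop[OF X A s] X A s w by simp
qed (use X A s w in auto)

text \<open>The extension of \<open>ev\<close> to \<open>U X\<close> is a family of morphisms, so it
  commutes with \<open>f\<close> at stage \<open>Z\<close>; in \<open>A\<close> this stage reappears
  as a power, by \<open>unc_pow\<close>.\<close>

lemma eop_opn:
  assumes X: "X \<in> Ob V" and A: "A \<in> structures V L" and f: "f \<in> Sym L" and Z: "Z \<in> Ob V"
    and r: "r \<in> Ar V" "src V r = Z \<otimes> inar L f" "trg V r = U X"
  shows "eop A X (opn (F X) f Z r) = pow A Z f \<cdot> eop A X r"
proof -
  let ?W = "ihom V X (fst A)" and ?Y = "Z \<otimes> outar L f" and ?l = "lift (ihom V X (fst A)) X A (ev V X (fst A))"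
  have F: "F X \<in> structures V L" using X by simp
  have o: "opn (F X) f Z r \<in> Ar V" "src V (opn (F X) f Z r) = ?Y" "trg V (opn (F X) f Z r) = U X"
    using F f Z r by auto
  have W: "?W \<in> Ob V" using X A by simp
  have i: "imor ?W (F X) A ?l" using X A W by (intro lift_imor) auto
  have e: "eop A X r \<in> Ar V" "trg V (eop A X r) = ihom V (Z \<otimes> inar L f) (fst A)" "src V (eop A X r) = ?W"
    using X A r by auto
  have u: "unc ?Y (fst A) (eop A X (opn (F X) f Z r)) = unc ?Y (fst A) (pow A Z f \<cdot> eop A X r)"
  proof (rule assoc_cancel[of ?W Z "outar L f"])
    have "unc ?Y (fst A) (eop A X (opn (F X) f Z r)) \<cdot> assoc V ?W Z (outar L f)
      = ?l \<cdot> (idn V ?W \<odot> opn (F X) f Z r) \<cdot> assoc V ?W Z (outar L f)"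
      using unc_eop[OF X A o(1,3)] o X A Z f W F by simp
    also have "\<dots> = opn A f (?W \<otimes> Z) (?l \<cdot> (idn V ?W \<odot> r) \<cdot> assoc V ?W Z (inar L f))"
      using imor_opn[OF i f Z r] by simp
    also have "?l \<cdot> (idn V ?W \<odot> r) \<cdot> assoc V ?W Z (inar L f)
      = unc (Z \<otimes> inar L f) (fst A) (eop A X r) \<cdot> assoc V ?W Z (inar L f)"
      using unc_eop[OF X A r(1,3)] r X A Z f W F by simp
    also have "opn A f (?W \<otimes> Z) (unc (Z \<otimes> inar L f) (fst A) (eop A X r) \<cdot> assoc V ?W Z (inar L f))
      = unc ?Y (fst A) (pow A Z f \<cdot> eop A X r) \<cdot> assoc V ?W Z (outar L f)"
      by (rule unc_pow[OF A Z f e, symmetric])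
    finally show "unc ?Y (fst A) (eop A X (opn (F X) f Z r)) \<cdot> assoc V ?W Z (outar L f)
      = unc ?Y (fst A) (pow A Z f \<cdot> eop A X r) \<cdot> assoc V ?W Z (outar L f)" .
  qed (use A Z f W X o e in auto)
  show ?thesis
    by (rule unc_inject[OF _ _ _ _ _ _ _ u]) (use A Z f W X o e in auto)
qed

text \<open>By \<open>lift_imor_cmp\<close>. Hence adjoining the extended operations as symbols puts
  no further condition on families of morphisms.\<close>

lemma eop_struct_morphism:
  assumes X: "X \<in> Ob V" and A: "A \<in> structures V L" and B: "B \<in> structures V L" and k: "imor Z A B k"
    and s: "s \<in> Ar V" "trg V s = U X" "src V s = Y"
    and W: "W \<in> Ob V" and x: "x \<in> Ar V" "src V x = W \<otimes> X" "trg V x = fst A"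
  shows "act X Y (fst B) (eop B X s) (Z \<otimes> W) (k \<cdot> (idn V Z \<odot> x) \<cdot> assoc V Z W X)
    = k \<cdot> (idn V Z \<odot> act X Y (fst A) (eop A X s) W x) \<cdot> assoc V Z W Y"
proof -
  note ka = imor_ar[OF k]
  have F: "F X \<in> structures V L" using X by simp
  have Y: "Y \<in> Ob V" using s by auto
  have "act X Y (fst B) (eop B X s) (Z \<otimes> W) (k \<cdot> (idn V Z \<odot> x) \<cdot> assoc V Z W X)
    = lift (Z \<otimes> W) X B (k \<cdot> (idn V Z \<odot> x) \<cdot> assoc V Z W X) \<cdot> (idn V (Z \<otimes> W) \<odot> s)"
    using ka x W X A by (intro act_eop[OF X B s]) auto
  also have "\<dots> = (k \<cdot> (idn V Z \<odot> lift W X A x) \<cdot> assoc V Z W (U X)) \<cdot> (idn V (Z \<otimes> W) \<odot> s)"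
    unfolding lift_imor_cmp[OF X A B W x k] ..
  also have "\<dots> = k \<cdot> (idn V Z \<odot> (lift W X A x \<cdot> (idn V W \<odot> s))) \<cdot> assoc V Z W Y"
    using ka x W X A s F Y by (simp flip: tensor_idn)
  finally show ?thesis unfolding act_eop[OF X A s W x] .
qed

end

text \<open>\<open>P\<close> is a small dense set of presentable objects, \<open>D0\<close> the input arities and \<open>D1\<close> the output
  arities of the new function symbols.\<close>

locale presentation = free_structures V L F \<eta> + monoidal_generator V \<G> + universe \<kappa>
  for V :: "('o, 'a, 'm) smc_scheme" (structure) and L :: "('f, 'o) language"
    and F :: "'o \<Rightarrow> ('o, 'a, 'f) struct" and \<eta> :: "'o \<Rightarrow> 'a" and \<G> :: "'o set" and \<kappa> :: "'u rel" +
  fixes \<rho> :: "'l rel" and P D0 D1 :: "'o set"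
  assumes dense: "\<And>A. A \<in> Ob V \<Longrightarrow> \<exists>(J :: ('u, 'u) cat) Do Da \<iota>. small_category \<kappa> J \<and> filtered \<rho> J \<and>
      is_functor J V Do Da \<and> Do ` Ob J \<subseteq> P \<and> is_colimit J V Do Da A \<iota>"
    and P_D1: "P \<subseteq> D1" and D0_D1: "D0 \<subseteq> D1" and D1: "D1 \<subseteq> presentable \<kappa> \<rho> V"
    and tensor_inar_D1: "\<lbrakk>Z \<in> \<G>; f \<in> Sym L\<rbrakk> \<Longrightarrow> Z \<otimes> inar L f \<in> D1"
    and tensor_outar_D1: "\<lbrakk>Z \<in> \<G>; f \<in> Sym L\<rbrakk> \<Longrightarrow> Z \<otimes> outar L f \<in> D1"
begin

lemma D1_Ob [simp]: "X \<in> D1 \<Longrightarrow> X \<in> Ob V"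
  and D0_Ob [simp]: "X \<in> D0 \<Longrightarrow> X \<in> Ob V"
  using D0_D1 D1 by (auto simp: presentable_def)

text \<open>By density the operations \<open>\<psi> s\<close> are the restrictions of one arrow \<open>h : [X, A] \<otimes> U X \<rightarrow> A\<close>; it
  is a family of morphisms of structures, hence the extension of the evaluation.\<close>

lemma eop_unique:
  assumes X: "X \<in> D0" and A: "A \<in> structures V L"
    and \<psi>: "\<And>s. s \<in> Ar V \<Longrightarrow> trg V s = U X \<Longrightarrow> src V s \<in> D1 \<Longrightarrow>
      \<psi> s \<in> Hom V (ihom V X (fst A)) (ihom V (src V s) (fst A))"
    and unit: "\<psi> (\<eta> X) = idn V (ihom V X (fst A))"
    and cmp: "\<And>s w. s \<in> Ar V \<Longrightarrow> trg V s = U X \<Longrightarrow> src V s \<in> D1 \<Longrightarrow> w \<in> Ar V \<Longrightarrow> trg V w = src V s \<Longrightarrow>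
      src V w \<in> D1 \<Longrightarrow> \<psi> (s \<cdot> w) = pre V w (fst A) \<cdot> \<psi> s"
    and opn: "\<And>f Z r. f \<in> Sym L \<Longrightarrow> Z \<in> \<G> \<Longrightarrow> r \<in> Ar V \<Longrightarrow> src V r = Z \<otimes> inar L f \<Longrightarrow> trg V r = U X \<Longrightarrow>
      \<psi> (opn (F X) f Z r) = pow A Z f \<cdot> \<psi> r"
    and s: "s \<in> Ar V" "trg V s = U X" "src V s \<in> D1"
  shows "\<psi> s = eop A X s"
proof -
  let ?a = "fst A" and ?W = "ihom V X (fst A)"
  have Xo: "X \<in> Ob V" using X by simp
  have F: "F X \<in> structures V L" using Xo by simp
  have W: "?W \<in> Ob V" using Xo A by simp
  have \<psi>a: "\<psi> s \<in> Ar V" "src V (\<psi> s) = ?W" "trg V (\<psi> s) = ihom V (src V s) ?a"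
    if "s \<in> Ar V" "trg V s = U X" "src V s \<in> D1" for s using \<psi>[OF that] by (auto simp: Hom_def)
  obtain J :: "('u, 'u) cat" and Do Da \<iota> where J: "small_category \<kappa> J" "filtered \<rho> J"
    "is_functor J V Do Da" "Do ` Ob J \<subseteq> P" "is_colimit J V Do Da (U X) \<iota>"
    using dense[of "U X"] F by auto
  have "\<exists>h \<in> Hom V (?W \<otimes> U X) ?a. \<forall>t \<in> Ar V. trg V t = U X \<and> src V t \<in> D1 \<longrightarrow>
    h \<cdot> (idn V ?W \<odot> t) = unc (src V t) ?a (\<psi> t)"
  proof (rule tensor_density[OF symmetric_monoidal_closed_axioms P_D1 D1 J W])
    show "?a \<in> Ob V" using A by simp
    show "unc (src V t) ?a (\<psi> t) \<in> Hom V (?W \<otimes> src V t) ?a"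
      if "t \<in> Ar V" "trg V t = U X" "src V t \<in> D1" for t
      using \<psi>a[OF that] A that by (simp add: Hom_def)
    fix t w assume t: "t \<in> Ar V" "trg V t = U X" "src V t \<in> D1"
      and w: "w \<in> Ar V" "trg V w = src V t" "src V w \<in> D1"
    have "unc (src V w) ?a (pre V w ?a \<cdot> \<psi> t) = unc (src V t) ?a (\<psi> t) \<cdot> (idn V ?W \<odot> w)"
      using \<psi>a[OF t] A w by (subst unc_pre_cmp) auto
    then show "unc (src V (t \<cdot> w)) ?a (\<psi> (t \<cdot> w)) = unc (src V t) ?a (\<psi> t) \<cdot> (idn V ?W \<odot> w)"
      using cmp[OF t w] t w by simp
  qed
  then obtain h where h: "h \<in> Ar V" "src V h = ?W \<otimes> U X" "trg V h = ?a"
    and ht: "\<And>t. t \<in> Ar V \<Longrightarrow> trg V t = U X \<Longrightarrow> src V t \<in> D1 \<Longrightarrow>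
      h \<cdot> (idn V ?W \<odot> t) = unc (src V t) ?a (\<psi> t)"
    by (auto simp: Hom_def)
  have "imor ?W (F X) A h"
    unfolding imor_def
  proof (intro conjI ballI)
    show "?W \<in> Ob V" "h \<in> Hom V (?W \<otimes> U X) ?a" using W h by (auto simp: Hom_def)
    fix f Z x
    let ?X = "inar L f" and ?Y = "outar L f"
    assume f: "f \<in> Sym L" and Z: "Z \<in> Ob V" and "x \<in> Hom V (Z \<otimes> ?X) (U X)"
    then have x: "x \<in> Ar V" "src V x = Z \<otimes> ?X" "trg V x = U X" by (auto simp: Hom_def)
    have y: "opn (F X) f Z x \<in> Ar V" "src V (opn (F X) f Z x) = Z \<otimes> ?Y" "trg V (opn (F X) f Z x) = U X"
      using F f Z x by auto
    show "opn A f (?W \<otimes> Z) (h \<cdot> (idn V ?W \<odot> x) \<cdot> assoc V ?W Z (?X))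
      = h \<cdot> (idn V ?W \<odot> opn (F X) f Z x) \<cdot> assoc V ?W Z (?Y)"
    \<comment> \<open>The law for \<open>h\<close> is wanted at every stage \<open>Z\<close>, while
      the hypothesis on \<psi> covers powers by members of the generator only. Restricting along
      \<open>g\<close> replaces \<open>Z\<close> by such a member.\<close>
    proof (rule generator_tensor_mid)
      fix g assume g: "g \<in> Ar V" "src V g \<in> \<G>" "trg V g = Z"
      let ?G = "src V g" and ?r = "x \<cdot> (g \<odot> idn V (?X))"
      have G: "?G \<in> Ob V" using g by simp
      have r: "?r \<in> Ar V" "src V ?r = ?G \<otimes> ?X" "trg V ?r = U X" using x g f by auto
      have rD: "src V ?r \<in> D1" using r(2) tensor_inar_D1[OF g(2) f] by simp
      have o: "opn (F X) f ?G ?r \<in> Ar V" "src V (opn (F X) f ?G ?r) = ?G \<otimes> ?Y"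
        "trg V (opn (F X) f ?G ?r) = U X" using F f G r by auto
      have oD: "src V (opn (F X) f ?G ?r) \<in> D1" using o(2) tensor_outar_D1[OF g(2) f] by simp
      have nat: "opn (F X) f ?G ?r = opn (F X) f Z x \<cdot> (g \<odot> idn V (?Y))"
        using F f Z x g by (intro act_natural) auto
      have "opn A f (?W \<otimes> Z) (h \<cdot> (idn V ?W \<odot> x) \<cdot> assoc V ?W Z (?X)) \<cdot> ((idn V ?W \<odot> g) \<odot> idn V (?Y))
        = opn A f (?W \<otimes> ?G) ((h \<cdot> (idn V ?W \<odot> x) \<cdot> assoc V ?W Z (?X)) \<cdot> ((idn V ?W \<odot> g) \<odot> idn V (?X)))"
        using A F f Z W x g h by (intro act_natural[symmetric]) auto
      also have "(h \<cdot> (idn V ?W \<odot> x) \<cdot> assoc V ?W Z (?X)) \<cdot> ((idn V ?W \<odot> g) \<odot> idn V (?X))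
        = (h \<cdot> (idn V ?W \<odot> ?r)) \<cdot> assoc V ?W ?G (?X)"
        using A F f Z W x g h by simp
      also have "h \<cdot> (idn V ?W \<odot> ?r) = unc (?G \<otimes> ?X) ?a (\<psi> ?r)"
        using ht[OF r(1,3) rD] r(2) by simp
      also have "opn A f (?W \<otimes> ?G) (unc (?G \<otimes> ?X) ?a (\<psi> ?r) \<cdot> assoc V ?W ?G (?X))
        = unc (?G \<otimes> ?Y) ?a (pow A ?G f \<cdot> \<psi> ?r) \<cdot> assoc V ?W ?G (?Y)"
        using \<psi>a[OF r(1,3) rD] r(2) by (intro unc_pow[OF A G f, symmetric]) auto
      also have "pow A ?G f \<cdot> \<psi> ?r = \<psi> (opn (F X) f ?G ?r)" using opn[OF f g(2) r] by simp
      also have "unc (?G \<otimes> ?Y) ?a (\<psi> (opn (F X) f ?G ?r)) = h \<cdot> (idn V ?W \<odot> opn (F X) f ?G ?r)"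
        using ht[OF o(1,3) oD] o(2) by simp
      also have "(h \<cdot> (idn V ?W \<odot> opn (F X) f ?G ?r)) \<cdot> assoc V ?W ?G (?Y)
        = (h \<cdot> (idn V ?W \<odot> opn (F X) f Z x) \<cdot> assoc V ?W Z (?Y)) \<cdot> ((idn V ?W \<odot> g) \<odot> idn V (?Y))"
        unfolding nat using A F f Z W y g h by simp
      finally show "opn A f (?W \<otimes> Z) (h \<cdot> (idn V ?W \<odot> x) \<cdot> assoc V ?W Z (?X)) \<cdot> ((idn V ?W \<odot> g) \<odot> idn V (?Y))
        = (h \<cdot> (idn V ?W \<odot> opn (F X) f Z x) \<cdot> assoc V ?W Z (?Y)) \<cdot> ((idn V ?W \<odot> g) \<odot> idn V (?Y))" .
    qed (use A F f Z W x y h in auto)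
  qed
  \<comment> \<open>The hypothesis on \<psi> at the unit determines which element \<open>h\<close>
    extends.\<close>
  moreover have "h \<cdot> (idn V ?W \<odot> \<eta> X) = ev V X ?a"
    using ht[of "\<eta> X"] X D0_D1 Xo A unit by auto
  ultimately have "h = lift ?W X A (ev V X ?a)" by (rule lift_unique[OF Xo A])
  then have u: "unc (src V s) ?a (\<psi> s) = unc (src V s) ?a (eop A X s)"
    using ht[OF s] unc_eop[OF Xo A s(1,2)] by simp
  show ?thesis
    by (rule unc_inject[OF _ _ _ _ _ _ _ u]) (use s \<psi>a[OF s] Xo A in auto)
qed

end

section \<open>The equational theory\<close>

lemma is_term_mono:
  assumes "is_term \<kappa> \<rho> V L \<Z> t X Y" "\<Z> \<subseteq> \<Z>'"
  shows "is_term \<kappa> \<rho> V L \<Z>' t X Y"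
  using assms(1)
proof induction
  case (TPow t X Y Z)
  then show ?case using assms(2) by (intro is_term.TPow) auto
next
  case (TSubst J t X Y P p Q q s W)
  then show ?case by (intro is_term.TSubst)
qed (auto intro: is_term.intros)

lemma structures_arb: "A \<in> structures V L \<Longrightarrow> f \<notin> Sym L \<Longrightarrow> snd A f = undefined"
  by (auto simp: structures_def intro: PiE_arb)

context symmetric_monoidal_closed
begin

lemma pre_idn [simp]:
  assumes "X \<in> Ob V" "A \<in> Ob V"
  shows "pre V (idn V X) A = idn V (ihom V X A)"
proof (rule unc_inject[of X A])
  show "unc X A (pre V (idn V X) A) = unc X A (idn V (ihom V X A))"
    using unc_pre_cmp[of "idn V X" A "idn V (ihom V X A)" X] assms by simp
qed (use assms in auto)

lemma singleton_coproduct: "X \<in> Ob V \<Longrightarrow> is_coproduct V {j} (\<lambda>_. X) X (\<lambda>_. idn V X)"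
  by (auto simp: is_coproduct_def Hom_def)

text \<open>Composition of terms is substitution over a one-element index set: the identities
  exhibit \<open>X\<close> and \<open>Y\<close> as coproducts of themselves.\<close>

definition tcomp :: "('o, 'a, 'f, 'u) trm \<Rightarrow> ('o, 'a, 'f, 'u) trm \<Rightarrow> 'o \<Rightarrow> 'o \<Rightarrow> ('o, 'a, 'f, 'u) trm" where
  "tcomp t s X Y = TSubst t {undefined} (\<lambda>_. s) X (\<lambda>_. idn V X) Y (\<lambda>_. idn V Y)"

lemma is_term_tcomp:
  assumes \<rho>: "regular_cardinal \<rho>" and "X \<in> Ob V" "Y \<in> Ob V"
    and "is_term \<kappa> \<rho> V L \<Z> s X Y" "is_term \<kappa> \<rho> V L \<Z> t Y W"
  shows "is_term \<kappa> \<rho> V L \<Z> (tcomp t s X Y) X W"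
  unfolding tcomp_def
proof (rule is_term.TSubst)
  have "Well_order \<rho>" "\<not> finite (Field \<rho>)"
    using \<rho> by (auto simp: regular_cardinal_def cinfinite_def card_order_on_def)
  then show "|{undefined}| <o \<rho>"
    by (intro finite_ordLess_infinite card_of_Well_order) (auto simp: Field_card_of)
qed (use assms singleton_coproduct in auto)

lemma interp_tcomp:
  assumes "X \<in> Ob V" "Y \<in> Ob V" "fst A \<in> Ob V"
    and s: "interp V L A s \<in> Hom V (ihom V X (fst A)) (ihom V Y (fst A))"
  shows "interp V L A (tcomp t s X Y) = interp V L A t \<cdot> interp V L A s"
proof -
  have "(THE m. m \<in> Hom V (ihom V X (fst A)) (ihom V Y (fst A)) \<and>
    (\<forall>j \<in> {undefined}. pre V (idn V Y) (fst A) \<cdot> m = interp V L A s \<cdot> pre V (idn V X) (fst A)))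
    = interp V L A s"
    using assms by (intro the_equality) (auto simp: Hom_def)
  then show ?thesis by (simp add: tcomp_def)
qed

end

section \<open>The new language and its theory\<close>

locale ext_presentation = presentation V L F \<eta> \<G> \<kappa> \<rho> P D0 D1
  for V :: "('o, 'a, 'm) smc_scheme" (structure) and L :: "('f, 'o) language"
    and F :: "'o \<Rightarrow> ('o, 'a, 'f) struct" and \<eta> :: "'o \<Rightarrow> 'a" and \<G> :: "'o set" and \<kappa> :: "'u rel"
    and \<rho> :: "'l rel" and P D0 D1 :: "'o set" +
  fixes E :: "('o, 'a) ext_theory" and enc :: "'f + 'o \<times> 'a \<Rightarrow> 'u"
  assumes ext_theory: "ext_equational_theory \<kappa> \<rho> V L F E"
    and E_D0: "(X, Y, s, t) \<in> E \<Longrightarrow> X \<in> D0 \<and> Y \<in> D0"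
    and language: "is_language \<kappa> \<rho> V L"
    and regular: "regular_cardinal \<rho>"
    and \<G>_presentable: "\<G> \<subseteq> presentable \<kappa> \<rho> V"
    and small_sets: "small \<kappa> \<G>" "small \<kappa> D0" "small \<kappa> D1"
    and small_homs: "\<lbrakk>X \<in> Ob V; Y \<in> Ob V\<rbrakk> \<Longrightarrow> small \<kappa> (Hom V X Y)"
    and enc_inj: "inj_on enc
      (Inl ` Sym L \<union> Inr ` {(X, s). X \<in> D0 \<and> s \<in> Ar V \<and> trg V s = U X \<and> src V s \<in> D1})"
begin

text \<open>\<open>X\<close> is recorded because \<open>U X\<close> need not determine it; the
  output arity is \<open>src V s\<close>.\<close>

definition ext_ops :: "('o \<times> 'a) set" where
  "ext_ops = {(X, s). X \<in> D0 \<and> s \<in> Ar V \<and> trg V s = U X \<and> src V s \<in> D1}"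

lemma ext_opsD:
  assumes "(X, s) \<in> ext_ops"
  shows "X \<in> D0" "X \<in> Ob V" "s \<in> Ar V" "trg V s = U X" "src V s \<in> D1"
    "X \<in> presentable \<kappa> \<rho> V" "src V s \<in> presentable \<kappa> \<rho> V"
  using assms D0_D1 D1 by (auto simp: ext_ops_def)

text \<open>The symbols of \<open>L'\<close> are elements of \<open>'u\<close>; decoding them
  recovers their arities and their intended interpretation.\<close>

definition dec :: "'u \<Rightarrow> 'f + 'o \<times> 'a" where
  "dec = inv_into (Inl ` Sym L \<union> Inr ` ext_ops) enc"

lemma dec [simp]: "f \<in> Sym L \<Longrightarrow> dec (enc (Inl f)) = Inl f" "p \<in> ext_ops \<Longrightarrow> dec (enc (Inr p)) = Inr p"
  using enc_inj by (auto simp: dec_def ext_ops_def intro!: inv_into_f_f)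

definition L' :: "('u, 'o) language" where
  "L' = \<lparr>Sym = enc ` (Inl ` Sym L \<union> Inr ` ext_ops),
     inar = \<lambda>u. case dec u of Inl f \<Rightarrow> inar L f | Inr (X, s) \<Rightarrow> X,
     outar = \<lambda>u. case dec u of Inl f \<Rightarrow> outar L f | Inr (X, s) \<Rightarrow> src V s\<rparr>"

lemma Sym_L': "Sym L' = enc ` Inl ` Sym L \<union> enc ` Inr ` ext_ops"
  by (auto simp: L'_def)

lemma ar_L' [simp]:
  "f \<in> Sym L \<Longrightarrow> inar L' (enc (Inl f)) = inar L f" "f \<in> Sym L \<Longrightarrow> outar L' (enc (Inl f)) = outar L f"
  "(X, s) \<in> ext_ops \<Longrightarrow> inar L' (enc (Inr (X, s))) = X"
  "(X, s) \<in> ext_ops \<Longrightarrow> outar L' (enc (Inr (X, s))) = src V s"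
  by (simp_all add: L'_def)

lemma small_ext_ops: "small \<kappa> ext_ops"
proof (rule small_mono)
  show "small \<kappa> (Sigma D0 (\<lambda>X. \<Union>Y\<in>D1. Hom V Y (U X)))"
    using small_sets by (auto intro!: small_Sigma small_UNION small_homs)
  show "ext_ops \<subseteq> Sigma D0 (\<lambda>X. \<Union>Y\<in>D1. Hom V Y (U X))"
    by (auto simp: ext_ops_def Hom_def)
qed

lemma language_L': "is_language \<kappa> \<rho> V L'"
  unfolding is_language_def
proof (intro conjI ballI)
  show "small \<kappa> (Sym L')"
    using language small_ext_ops by (simp add: Sym_L' is_language_def)
  fix u assume "u \<in> Sym L'"
  then show "inar L' u \<in> presentable \<kappa> \<rho> V" "outar L' u \<in> presentable \<kappa> \<rho> V"
    using language ext_opsD(6,7) by (auto simp: Sym_L' is_language_def)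
qed

sublocale new: structures_over V L'
proof
  fix u assume "u \<in> Sym L'"
  then show "inar L' u \<in> Ob V" "outar L' u \<in> Ob V"
    using language_L' by (auto simp: is_language_def presentable_def)
qed

definition fsym :: "'f \<Rightarrow> ('o, 'a, 'u, 'u) trm" where "fsym f = TFun (enc (Inl f))"

definition esym :: "'o \<Rightarrow> 'a \<Rightarrow> ('o, 'a, 'u, 'u) trm" where "esym X s = TFun (enc (Inr (X, s)))"

text \<open>Equations \<open>(l, r, X, Y)\<close> between terms of arity \<open>(X, Y)\<close>, still without the restriction on output
  arities.  The first three sets say that the new symbols form a family of operations as in
  \<open>eop_unique\<close>; the last one is the given theory.\<close>

definition base :: "(('o, 'a, 'u, 'u) trm \<times> ('o, 'a, 'u, 'u) trm \<times> 'o \<times> 'o) set" where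
  "base = (\<lambda>X. (esym X (\<eta> X), TMor (idn V X), X, X)) ` D0
    \<union> (\<lambda>((X, s), w). (esym X (s \<cdot> w), tcomp (TMor w) (esym X s) X (src V s), X, src V w)) `
        {((X, s), w). (X, s) \<in> ext_ops \<and> w \<in> Ar V \<and> trg V w = src V s \<and> src V w \<in> D1}
    \<union> (\<lambda>((X, r), f, Z). (esym X (opn (F X) f Z r),
          tcomp (TPow Z (fsym f)) (esym X r) X (Z \<otimes> inar L f), X, Z \<otimes> outar L f)) `
        {((X, r), f, Z). (X, r) \<in> ext_ops \<and> f \<in> Sym L \<and> Z \<in> \<G> \<and> src V r = Z \<otimes> inar L f}
    \<union> (\<lambda>(X, Y, s, t). (esym X (s \<cdot> \<eta> Y), esym X (t \<cdot> \<eta> Y), X, Y)) ` E"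

lemma base_intros:
  shows "X \<in> D0 \<Longrightarrow> (esym X (\<eta> X), TMor (idn V X), X, X) \<in> base"
    and "\<lbrakk>(X, s) \<in> ext_ops; w \<in> Ar V; trg V w = src V s; src V w \<in> D1\<rbrakk> \<Longrightarrow>
      (esym X (s \<cdot> w), tcomp (TMor w) (esym X s) X (src V s), X, src V w) \<in> base"
    and "\<lbrakk>(X, r) \<in> ext_ops; f \<in> Sym L; Z \<in> \<G>; src V r = Z \<otimes> inar L f\<rbrakk> \<Longrightarrow>
      (esym X (opn (F X) f Z r), tcomp (TPow Z (fsym f)) (esym X r) X (Z \<otimes> inar L f), X, Z \<otimes> outar L f) \<in> base"
    and "(X, Y, e, e') \<in> E \<Longrightarrow> (esym X (e \<cdot> \<eta> Y), esym X (e' \<cdot> \<eta> Y), X, Y) \<in> base"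
  unfolding base_def
  subgoal by (intro UnI1[OF UnI1[OF UnI1]]) simp
  subgoal by (rule UnI1[OF UnI1[OF UnI2]], rule image_eqI[of _ _ "((X, s), w)"]) auto
  subgoal by (rule UnI1[OF UnI2], rule image_eqI[of _ _ "((X, r), f, Z)"]) auto
  subgoal by (rule UnI2, rule image_eqI[of _ _ "(X, Y, e, e')"]) auto
  done

text \<open>Applying \<open>TMor g\<close>, interpreted as \<open>A^g\<close>, lowers the output
  arity from \<open>Y\<close> to \<open>G\<close>. By \<open>generator_pre\<close> all these
  restrictions together are as strong as the equation they come from.\<close>

definition E' :: "('o, 'a, 'u, 'u) eq_theory" where
  "E' = (\<Union>(l, r, X, Y)\<in>base. \<Union>G\<in>\<G>. (\<lambda>g. (tcomp (TMor g) l X Y, tcomp (TMor g) r X Y)) ` Hom V G Y)"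

lemma \<G>_Ob [simp]: "Z \<in> \<G> \<Longrightarrow> Z \<in> Ob V"
  using generator_Ob by blast

lemma ext_opsI:
  "X \<in> D0 \<Longrightarrow> (X, \<eta> X) \<in> ext_ops"
  "(X, s) \<in> ext_ops \<Longrightarrow> w \<in> Ar V \<Longrightarrow> trg V w = src V s \<Longrightarrow> src V w \<in> D1 \<Longrightarrow> (X, s \<cdot> w) \<in> ext_ops"
  "(X, r) \<in> ext_ops \<Longrightarrow> f \<in> Sym L \<Longrightarrow> Z \<in> \<G> \<Longrightarrow> src V r = Z \<otimes> inar L f \<Longrightarrow>
    (X, opn (F X) f Z r) \<in> ext_ops"
  using D0_D1 tensor_outar_D1 by (auto simp: ext_ops_def)

lemma E_D:
  assumes "(X, Y, s, t) \<in> E"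
  shows "X \<in> D0" "Y \<in> D0" "struct_morphism V L (F Y) (F X) s" "struct_morphism V L (F Y) (F X) t"
    "(X, s \<cdot> \<eta> Y) \<in> ext_ops" "(X, t \<cdot> \<eta> Y) \<in> ext_ops"
    "src V (s \<cdot> \<eta> Y) = Y" "src V (t \<cdot> \<eta> Y) = Y"
proof -
  show XY: "X \<in> D0" "Y \<in> D0" using E_D0[OF assms] by auto
  show st: "struct_morphism V L (F Y) (F X) s" "struct_morphism V L (F Y) (F X) t"
    using ext_theory assms by (auto simp: ext_equational_theory_def is_ext_term_def)
  then show "(X, s \<cdot> \<eta> Y) \<in> ext_ops" "(X, t \<cdot> \<eta> Y) \<in> ext_ops"
    "src V (s \<cdot> \<eta> Y) = Y" "src V (t \<cdot> \<eta> Y) = Y"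
    using XY D0_D1 by (auto simp: ext_ops_def struct_morphism_def Hom_def)
qed

lemma base_cases:
  assumes "(l, r, X, Y) \<in> base"
  obtains
    (unit) "X \<in> D0" "Y = X" "l = esym X (\<eta> X)" "r = TMor (idn V X)"
  | (cmp) s w where "(X, s) \<in> ext_ops" "w \<in> Ar V" "trg V w = src V s" "src V w \<in> D1" "Y = src V w"
      "l = esym X (s \<cdot> w)" "r = tcomp (TMor w) (esym X s) X (src V s)"
  | (opn) s f Z where "(X, s) \<in> ext_ops" "f \<in> Sym L" "Z \<in> \<G>" "src V s = Z \<otimes> inar L f"
      "Y = Z \<otimes> outar L f" "l = esym X (opn (F X) f Z s)"
      "r = tcomp (TPow Z (fsym f)) (esym X s) X (Z \<otimes> inar L f)"
  | (E) s t where "(X, Y, s, t) \<in> E" "l = esym X (s \<cdot> \<eta> Y)" "r = esym X (t \<cdot> \<eta> Y)"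
  using assms unfolding base_def by (elim UnE imageE; clarsimp; blast)

lemma base_Ob:
  assumes "(l, r, X, Y) \<in> base"
  shows "X \<in> D0" "X \<in> Ob V" "Y \<in> Ob V"
  using assms by (cases rule: base_cases; auto dest: ext_opsD E_D)+

lemma is_term_esym: "(X, s) \<in> ext_ops \<Longrightarrow> src V s = Y \<Longrightarrow> is_term \<kappa> \<rho> V L' \<Z> (esym X s) X Y"
  using is_term.TFun[of "enc (Inr (X, s))" L' \<kappa> \<rho> V \<Z>] by (auto simp: esym_def Sym_L')

lemma is_term_fsym: "f \<in> Sym L \<Longrightarrow> is_term \<kappa> \<rho> V L' \<Z> (fsym f) (inar L f) (outar L f)"
  using is_term.TFun[of "enc (Inl f)" L' \<kappa> \<rho> V \<Z>] by (auto simp: fsym_def Sym_L')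

lemma base_is_term:
  assumes "(l, r, X, Y) \<in> base"
  shows "is_term \<kappa> \<rho> V L' \<G> l X Y" "is_term \<kappa> \<rho> V L' \<G> r X Y"
proof -
  have "is_term \<kappa> \<rho> V L' \<G> l X Y \<and> is_term \<kappa> \<rho> V L' \<G> r X Y"
    using assms
  proof (cases rule: base_cases)
    case unit
    then show ?thesis
      using D0_D1 D1 by (auto intro!: is_term_esym is_term.TMor ext_opsI simp: Hom_def)
  next
    case (cmp s w)
    note s = ext_opsD[OF cmp(1)]
    have "is_term \<kappa> \<rho> V L' \<G> (TMor w) (src V s) (src V w)"
      using cmp s D1 by (intro is_term.TMor) (auto simp: Hom_def)
    then show ?thesis
      using cmp s by (auto intro!: is_term_esym is_term_tcomp[OF regular] ext_opsI)
  next
    case (opn s f Z)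
    note s = ext_opsD[OF opn(1)]
    have "is_term \<kappa> \<rho> V L' \<G> (TPow Z (fsym f)) (Z \<otimes> inar L f) (Z \<otimes> outar L f)"
      using opn \<G>_presentable by (intro is_term.TPow is_term_fsym) auto
    moreover have "src V (opn (F X) f Z s) = Z \<otimes> outar L f" using opn s by simp
    ultimately show ?thesis
      using opn s by (auto intro!: is_term_esym is_term_tcomp[OF regular] ext_opsI)
  next
    case (E s t)
    then show ?thesis using E_D[OF E(1)] by (auto intro!: is_term_esym)
  qed
  then show "is_term \<kappa> \<rho> V L' \<G> l X Y" "is_term \<kappa> \<rho> V L' \<G> r X Y" by auto
qed

lemma E'_is_term:
  assumes "(l, r) \<in> E'"
  obtains X Y where "Y \<in> \<G>" "is_term \<kappa> \<rho> V L' \<G> l X Y" "is_term \<kappa> \<rho> V L' \<G> r X Y"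
proof -
  obtain l0 r0 X Y g where b: "(l0, r0, X, Y) \<in> base" and g: "g \<in> Ar V" "src V g \<in> \<G>" "trg V g = Y"
    and lr: "l = tcomp (TMor g) l0 X Y" "r = tcomp (TMor g) r0 X Y"
    using assms by (auto simp: E'_def Hom_def)
  have "Y \<in> presentable \<kappa> \<rho> V"
    using b
  proof (cases rule: base_cases)
    case (opn s f Z)
    then show ?thesis using tensor_outar_D1 D1 by auto
  qed (use D0_D1 D1 in \<open>auto dest: E_D\<close>)
  then have "is_term \<kappa> \<rho> V L' \<G> (TMor g) Y (src V g)"
    using g \<G>_presentable by (intro is_term.TMor) (auto simp: Hom_def)
  then show thesis
    by (intro that[OF g(2), of X])
      (auto simp: lr intro!: is_term_tcomp[OF regular] base_is_term[OF b] base_Ob[OF b])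
qed

lemma small_base: "small \<kappa> base"
proof -
  have s: "small \<kappa> (Sym L)" "small \<kappa> E"
    using language ext_theory by (auto simp: is_language_def ext_equational_theory_def)
  have "small \<kappa> (ext_ops \<times> (\<Union>Y\<in>D1. \<Union>Y'\<in>D1. Hom V Y Y'))"
    using small_ext_ops small_sets by (intro small_Sigma small_UNION small_homs) auto
  then have 1: "small \<kappa> {((X, s), w). (X, s) \<in> ext_ops \<and> w \<in> Ar V \<and> trg V w = src V s \<and> src V w \<in> D1}"
    by (rule small_mono) (auto simp: Hom_def dest: ext_opsD)
  have "small \<kappa> (ext_ops \<times> Sym L \<times> \<G>)"
    using small_ext_ops small_sets s by (intro small_Sigma)
  then have 2: "small \<kappa> {((X, r), f, Z). (X, r) \<in> ext_ops \<and> f \<in> Sym L \<and> Z \<in> \<G> \<and> src V r = Z \<otimes> inar L f}"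
    by (rule small_mono) auto
  show ?thesis
    unfolding base_def by (intro small_Un small_image small_sets 1 2 s)
qed

lemma equational_theory_E': "equational_theory \<kappa> \<rho> V L' E'"
  unfolding equational_theory_def
proof (intro conjI)
  show "small \<kappa> E'"
    unfolding E'_def split_def
    using small_sets base_Ob
    by (intro small_UNION small_base small_image small_homs) (auto dest: base_Ob)
  have "\<exists>X Y. is_term \<kappa> \<rho> V L' (presentable \<kappa> \<rho> V) s X Y \<and> is_term \<kappa> \<rho> V L' (presentable \<kappa> \<rho> V) t X Y"
    if "(s, t) \<in> E'" for s t
    using that
  proof (rule E'_is_term)
    fix X Y assume "is_term \<kappa> \<rho> V L' \<G> s X Y" "is_term \<kappa> \<rho> V L' \<G> t X Y"
    then show ?thesis using is_term_mono[OF _ \<G>_presentable] by blast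
  qed
  then show "\<forall>(s, t) \<in> E'. \<exists>X Y. is_term \<kappa> \<rho> V L' (presentable \<kappa> \<rho> V) s X Y \<and>
      is_term \<kappa> \<rho> V L' (presentable \<kappa> \<rho> V) t X Y" by blast
qed

section \<open>Reducts, expansions and models\<close>

definition reduct :: "('o, 'a, 'u) struct \<Rightarrow> ('o, 'a, 'f) struct" where
  "reduct A = (fst A, \<lambda>f\<in>Sym L. snd A (enc (Inl f)))"

text \<open>The only interpretation of the new symbols that the equations will allow.\<close>

definition expand :: "('o, 'a, 'f) struct \<Rightarrow> ('o, 'a, 'u) struct" where
  "expand A = (fst A, \<lambda>u\<in>Sym L'. case dec u of Inl f \<Rightarrow> snd A f | Inr (X, s) \<Rightarrow> eop A X s)"

abbreviation eint :: "('o, 'a, 'u) struct \<Rightarrow> 'o \<Rightarrow> 'a \<Rightarrow> 'a" where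
  "eint A X s \<equiv> snd A (enc (Inr (X, s)))"

lemma reduct_fst [simp]: "fst (reduct A) = fst A"
  and expand_fst [simp]: "fst (expand B) = fst B"
  and reduct_snd [simp]: "f \<in> Sym L \<Longrightarrow> snd (reduct A) f = snd A (enc (Inl f))"
  and expand_snd [simp]: "f \<in> Sym L \<Longrightarrow> snd (expand B) (enc (Inl f)) = snd B f"
    "(X, s) \<in> ext_ops \<Longrightarrow> eint (expand B) X s = eop B X s"
  by (auto simp: reduct_def expand_def Sym_L')

lemma reduct_structure [simp]: "A \<in> structures V L' \<Longrightarrow> reduct A \<in> structures V L"
  using new.structuresD(2-4)[of A "enc (Inl _)"] new.structuresD(1)[of A]
  by (auto simp: structures_def[of _ L] reduct_def Hom_def Sym_L')

lemma eint_ar: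
  assumes "A \<in> structures V L'" "(X, s) \<in> ext_ops"
  shows "eint A X s \<in> Ar V" "src V (eint A X s) = ihom V X (fst A)"
    "trg V (eint A X s) = ihom V (src V s) (fst A)"
  using assms new.structuresD(2-4)[OF assms(1), of "enc (Inr (X, s))"] by (auto simp: Sym_L')

lemma expand_structure [simp]: "A \<in> structures V L \<Longrightarrow> expand A \<in> structures V L'"
  using ext_opsD(2-4) by (auto simp: structures_def[of _ L'] expand_def Sym_L' Hom_def)

lemma reduct_expand [simp]:
  assumes "A \<in> structures V L"
  shows "reduct (expand A) = A"
proof (rule prod_eqI)
  have "snd (reduct (expand A)) f = snd A f" for f
    using structures_arb[OF assms] by (cases "f \<in> Sym L") (auto simp: reduct_def[of "expand A"])
  then show "snd (reduct (expand A)) = snd A" by (rule ext)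
qed simp

lemma interp_esym [simp]: "interp V L' A (esym X s) = eint A X s"
  by (simp add: esym_def)

lemma interp_pow:
  assumes "f \<in> Sym L"
  shows "interp V L' A (TPow Z (fsym f)) = pow (reduct A) Z f"
  using assms by (simp add: pow_def fsym_def)

text \<open>The typing matters because \<open>interp\<close> of a substitution contains a definite
  description; it is also required for \<open>generator_pre\<close>.\<close>

lemma interp_base:
  assumes A: "A \<in> structures V L'" and b: "(l, r, X, Y) \<in> base"
  shows "interp V L' A l \<in> Hom V (ihom V X (fst A)) (ihom V Y (fst A))"
    and "interp V L' A r \<in> Hom V (ihom V X (fst A)) (ihom V Y (fst A))"
proof -
  have a: "fst A \<in> Ob V" "reduct A \<in> structures V L" using A new.structuresD(1)[OF A] by auto
  have "interp V L' A l \<in> Hom V (ihom V X (fst A)) (ihom V Y (fst A)) \<and>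
    interp V L' A r \<in> Hom V (ihom V X (fst A)) (ihom V Y (fst A))"
    using b
  proof (cases rule: base_cases)
    case unit
    then show ?thesis using eint_ar[OF A ext_opsI(1)] a by (auto simp: Hom_def)
  next
    case (cmp s w)
    note s = ext_opsD[OF cmp(1)] and sa = eint_ar[OF A cmp(1)]
    have "interp V L' A r = pre V w (fst A) \<cdot> eint A X s"
      unfolding cmp(7) using s sa a by (subst interp_tcomp) (auto simp: Hom_def)
    then show ?thesis using cmp s sa eint_ar[OF A ext_opsI(2)[OF cmp(1-4)]] a by (auto simp: Hom_def)
  next
    case (opn s f Z)
    note s = ext_opsD[OF opn(1)] and sa = eint_ar[OF A opn(1)]
    have "interp V L' A r = pow (reduct A) Z f \<cdot> eint A X s"
      unfolding opn(7) using s sa a opn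
      by (subst interp_tcomp) (auto simp: Hom_def interp_pow simp del: interp.simps)
    moreover have "src V (opn (F X) f Z s) = Z \<otimes> outar L f" using opn s by simp
    ultimately show ?thesis
      using opn s sa eint_ar[OF A ext_opsI(3)[OF opn(1-4)]] a by (auto simp: Hom_def)
  next
    case (E s t)
    note e = E_D[OF E(1)]
    then show ?thesis using E eint_ar[OF A e(5)] eint_ar[OF A e(6)] by (auto simp: Hom_def)
  qed
  then show "interp V L' A l \<in> Hom V (ihom V X (fst A)) (ihom V Y (fst A))"
    "interp V L' A r \<in> Hom V (ihom V X (fst A)) (ihom V Y (fst A))" by auto
qed

text \<open>The equations of \<open>E'\<close> test those of \<open>base\<close> on the arrows
  \<open>A^g\<close>, which jointly detect equality by \<open>generator_pre\<close>.\<close>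

lemma satisfies_iff:
  assumes A: "A \<in> structures V L'"
  shows "(\<forall>(s, t) \<in> E'. interp V L' A s = interp V L' A t)
    \<longleftrightarrow> (\<forall>(l, r, X, Y) \<in> base. interp V L' A l = interp V L' A r)"
proof -
  have a: "fst A \<in> Ob V" using new.structuresD(1)[OF A] .
  have tc: "interp V L' A (tcomp (TMor g) l X Y) = pre V g (fst A) \<cdot> interp V L' A l"
    "interp V L' A (tcomp (TMor g) r X Y) = pre V g (fst A) \<cdot> interp V L' A r"
    if "(l, r, X, Y) \<in> base" for l r X Y g
    using that interp_base[OF A that] base_Ob[OF that] a by (simp_all add: interp_tcomp)
  show ?thesis
  proof
    assume e: "\<forall>(s, t) \<in> E'. interp V L' A s = interp V L' A t"
    show "\<forall>(l, r, X, Y) \<in> base. interp V L' A l = interp V L' A r"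
    proof (clarify)
      fix l r X Y assume b: "(l, r, X, Y) \<in> base"
      note i = interp_base[OF A b, unfolded Hom_def] and o = base_Ob[OF b]
      show "interp V L' A l = interp V L' A r"
      proof (rule generator_pre[of _ Y "fst A"])
        fix g assume g: "g \<in> Ar V" "src V g \<in> \<G>" "trg V g = Y"
        then have "g \<in> Hom V (src V g) Y" by (simp add: Hom_def)
        then have "(tcomp (TMor g) l X Y, tcomp (TMor g) r X Y) \<in> E'"
          unfolding E'_def using b g(2) by blast
        then have "interp V L' A (tcomp (TMor g) l X Y) = interp V L' A (tcomp (TMor g) r X Y)"
          using e by blast
        then show "pre V g (fst A) \<cdot> interp V L' A l = pre V g (fst A) \<cdot> interp V L' A r"
          unfolding tc[OF b] .
      qed (use i o a in auto)
    qed
  next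
    assume b: "\<forall>(l, r, X, Y) \<in> base. interp V L' A l = interp V L' A r"
    show "\<forall>(s, t) \<in> E'. interp V L' A s = interp V L' A t"
      unfolding E'_def using b tc by fastforce
  qed
qed

text \<open>From left to right \<open>eop_unique\<close> forces the interpretation of the new
  symbols; from right to left the laws of \<open>eop\<close> give soundness. In both directions
  \<open>ext_interp_eop\<close> translates the equations of \<open>E\<close>.\<close>

lemma base_iff:
  assumes A: "A \<in> structures V L'"
  shows "(\<forall>(l, r, X, Y) \<in> base. interp V L' A l = interp V L' A r) \<longleftrightarrow>
    (\<forall>(X, s) \<in> ext_ops. eint A X s = eop (reduct A) X s) \<and>
    (\<forall>(X, Y, s, t) \<in> E. ext_interp V L F \<eta> (reduct A) X Y s = ext_interp V L F \<eta> (reduct A) X Y t)"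
proof -
  let ?A = "reduct A"
  have R: "?A \<in> structures V L" using A by simp
  have a: "fst A \<in> Ob V" using new.structuresD(1)[OF A] .
  have ipre: "interp V L' A (tcomp (TMor w) (esym X s) X (src V s)) = pre V w (fst A) \<cdot> eint A X s"
    if "(X, s) \<in> ext_ops" for X s w
    using ext_opsD[OF that] eint_ar[OF A that] a by (subst interp_tcomp) (auto simp: Hom_def)
  have ipow: "interp V L' A (tcomp (TPow Z (fsym f)) (esym X s) X (Z \<otimes> inar L f)) = pow ?A Z f \<cdot> eint A X s"
    if "(X, s) \<in> ext_ops" "f \<in> Sym L" "Z \<in> \<G>" "src V s = Z \<otimes> inar L f" for X s f Z
    using ext_opsD[OF that(1)] eint_ar[OF A that(1)] a that(2-)
    by (subst interp_tcomp) (auto simp: Hom_def interp_pow simp del: interp.simps)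
  have ext: "ext_interp V L F \<eta> ?A X Y s = eop ?A X (s \<cdot> \<eta> Y)"
    "ext_interp V L F \<eta> ?A X Y t = eop ?A X (t \<cdot> \<eta> Y)" if "(X, Y, s, t) \<in> E" for X Y s t
    using E_D(1-4)[OF that] R by (auto intro!: ext_interp_eop)
  show ?thesis
  proof
    assume b: "\<forall>(l, r, X, Y) \<in> base. interp V L' A l = interp V L' A r"
    have bE: "interp V L' A l = interp V L' A r" if "(l, r, X, Y) \<in> base" for l r X Y using b that by blast
    have e: "eint A X s = eop ?A X s" if Xs: "(X, s) \<in> ext_ops" for X s
    \<comment> \<open>For fixed \<open>X\<close>, the first three groups of \<open>base\<close>
      supply the unit, restriction and power laws that \<open>eop_unique\<close> asks of
      \<psi>.\<close>
    proof (rule eop_unique[where \<psi> = "eint A X"])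
      note s = ext_opsD[OF Xs]
      show "X \<in> D0" "s \<in> Ar V" "trg V s = U X" "src V s \<in> D1" using s by auto
      have "(esym X (\<eta> X), TMor (idn V X), X, X) \<in> base" by (rule base_intros(1)[OF s(1)])
      from bE[OF this] show "eint A X (\<eta> X) = idn V (ihom V X (fst ?A))" using s(2) a by simp
      show "eint A X s \<in> Hom V (ihom V X (fst ?A)) (ihom V (src V s) (fst ?A))"
        if "s \<in> Ar V" "trg V s = U X" "src V s \<in> D1" for s
        using eint_ar[OF A, of X s] that s(1) by (auto simp: ext_ops_def Hom_def)
      show "eint A X (s \<cdot> w) = pre V w (fst ?A) \<cdot> eint A X s"
        if "s \<in> Ar V" "trg V s = U X" "src V s \<in> D1" "w \<in> Ar V" "trg V w = src V s" "src V w \<in> D1" for s w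
      proof -
        have x: "(X, s) \<in> ext_ops" using that s(1) by (simp add: ext_ops_def)
        have "(esym X (s \<cdot> w), tcomp (TMor w) (esym X s) X (src V s), X, src V w) \<in> base"
          by (rule base_intros(2)[OF x that(4-6)])
        from bE[OF this] show ?thesis unfolding ipre[OF x] by simp
      qed
      show "eint A X (opn (F X) f Z r) = pow ?A Z f \<cdot> eint A X r"
        if "f \<in> Sym L" "Z \<in> \<G>" "r \<in> Ar V" "src V r = Z \<otimes> inar L f" "trg V r = U X" for f Z r
      proof -
        have x: "(X, r) \<in> ext_ops" using that s(1) tensor_inar_D1[OF that(2,1)] by (simp add: ext_ops_def)
        have "(esym X (opn (F X) f Z r), tcomp (TPow Z (fsym f)) (esym X r) X (Z \<otimes> inar L f),
          X, Z \<otimes> outar L f) \<in> base"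
          by (rule base_intros(3)[OF x that(1,2,4)])
        from bE[OF this] show ?thesis unfolding ipow[OF x that(1,2,4)] by simp
      qed
    qed (rule R)
    moreover have "ext_interp V L F \<eta> ?A X Y s = ext_interp V L F \<eta> ?A X Y t" if x: "(X, Y, s, t) \<in> E" for X Y s t
    proof -
      have "(esym X (s \<cdot> \<eta> Y), esym X (t \<cdot> \<eta> Y), X, Y) \<in> base" by (rule base_intros(4)[OF x])
      from bE[OF this] show ?thesis unfolding ext[OF x] using e[OF E_D(5)[OF x]] e[OF E_D(6)[OF x]] by simp
    qed
    ultimately show "(\<forall>(X, s) \<in> ext_ops. eint A X s = eop ?A X s) \<and>
      (\<forall>(X, Y, s, t) \<in> E. ext_interp V L F \<eta> ?A X Y s = ext_interp V L F \<eta> ?A X Y t)" by blast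
  next
    assume *: "(\<forall>(X, s) \<in> ext_ops. eint A X s = eop ?A X s) \<and>
      (\<forall>(X, Y, s, t) \<in> E. ext_interp V L F \<eta> ?A X Y s = ext_interp V L F \<eta> ?A X Y t)"
    then have e: "eint A X s = eop ?A X s" if "(X, s) \<in> ext_ops" for X s using that by blast
    show "\<forall>(l, r, X, Y) \<in> base. interp V L' A l = interp V L' A r"
    proof clarify
      fix l r X Y assume "(l, r, X, Y) \<in> base"
      then show "interp V L' A l = interp V L' A r"
      proof (cases rule: base_cases)
        case unit
        then show ?thesis using e[OF ext_opsI(1)] eop_unit[OF _ R] a by simp
      next
        case (cmp s w)
        note s = ext_opsD[OF cmp(1)]
        show ?thesis unfolding cmp(6,7) ipre[OF cmp(1)] interp_esym e[OF cmp(1)] e[OF ext_opsI(2)[OF cmp(1-4)]]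
          using eop_cmp[OF s(2) R s(3,4) cmp(2,3)] by simp
      next
        case (opn s f Z)
        note s = ext_opsD[OF opn(1)]
        show ?thesis unfolding opn(6,7) ipow[OF opn(1-4)] interp_esym e[OF opn(1)] e[OF ext_opsI(3)[OF opn(1-4)]]
          using eop_opn[OF s(2) R opn(2) \<G>_Ob[OF opn(3)] s(3) opn(4) s(4)] .
      next
        case (E s t)
        then show ?thesis using * ext[OF E(1)] e[OF E_D(5)[OF E(1)]] e[OF E_D(6)[OF E(1)]] by auto
      qed
    qed
  qed
qed

lemma expand_reduct:
  assumes A: "A \<in> structures V L'" and e: "\<forall>(X, s) \<in> ext_ops. eint A X s = eop (reduct A) X s"
  shows "expand (reduct A) = A"
proof (rule prod_eqI)
  have "snd (expand (reduct A)) u = snd A u" for u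
  proof (cases "u \<in> Sym L'")
    case True
    then show ?thesis using e by (auto simp: Sym_L')
  next
    case False
    then show ?thesis using structures_arb[OF A] by (simp add: expand_def)
  qed
  then show "snd (expand (reduct A)) = snd A" by (rule ext)
qed simp

text \<open>The symbols of \<open>L\<close> give one direction. For the other, the conditions at the
  additional symbols hold automatically by \<open>eop_struct_morphism\<close>.\<close>

lemma imor_expand:
  assumes A: "A \<in> structures V L" and B: "B \<in> structures V L"
  shows "new.imor Z (expand A) (expand B) k \<longleftrightarrow> imor Z A B k"
proof
  assume k: "new.imor Z (expand A) (expand B) k"
  show "imor Z A B k"
    unfolding imor_def
  proof (intro conjI ballI)
    show "Z \<in> Ob V" "k \<in> Hom V (Z \<otimes> fst A) (fst B)"
      using new.imor_ar[OF k] by (auto simp: Hom_def)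
    fix f W x assume f: "f \<in> Sym L" "W \<in> Ob V" "x \<in> Hom V (W \<otimes> inar L f) (fst A)"
    then have "enc (Inl f) \<in> Sym L'" by (simp add: Sym_L')
    from new.imor_opn[OF k this, of W x] f
    show "opn B f (Z \<otimes> W) (k \<cdot> (idn V Z \<odot> x) \<cdot> assoc V Z W (inar L f))
      = k \<cdot> (idn V Z \<odot> opn A f W x) \<cdot> assoc V Z W (outar L f)"
      by (simp add: Hom_def)
  qed
next
  assume k: "imor Z A B k"
  show "new.imor Z (expand A) (expand B) k"
    unfolding new.imor_def
  proof (intro conjI ballI)
    show "Z \<in> Ob V" "k \<in> Hom V (Z \<otimes> fst (expand A)) (fst (expand B))"
      using imor_ar[OF k] by (auto simp: Hom_def)
    fix u W x assume u: "u \<in> Sym L'" and W: "W \<in> Ob V" and x: "x \<in> Hom V (W \<otimes> inar L' u) (fst (expand A))"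
    from u consider f where "f \<in> Sym L" "u = enc (Inl f)" | X s where "(X, s) \<in> ext_ops" "u = enc (Inr (X, s))"
      by (auto simp: Sym_L')
    then show "new.opn (expand B) u (Z \<otimes> W) (k \<cdot> (idn V Z \<odot> x) \<cdot> assoc V Z W (inar L' u))
      = k \<cdot> (idn V Z \<odot> new.opn (expand A) u W x) \<cdot> assoc V Z W (outar L' u)"
    proof cases
      case 1
      then show ?thesis using imor_opn[OF k 1(1) W, of x] x by (simp add: Hom_def)
    next
      case 2
      note s = ext_opsD[OF 2(1)]
      show ?thesis
        using eop_struct_morphism[OF s(2) A B k s(3,4) refl W, of x] x 2 by (simp add: Hom_def)
    qed
  qed
qed

end

text \<open>\<open>str_incl\<close> is chosen with \<open>SOME\<close>; local presentability
  guarantees that there is a joint equalizer to choose, for the old language and for the new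
  one.\<close>

lemma locally_presentable_structure_homs:
  fixes \<kappa> :: "'u rel"
  assumes \<kappa>: "small_universe \<kappa>" and V: "locally_presentable_closed \<kappa> \<rho> V"
    and L: "\<And>f. f \<in> Sym L \<Longrightarrow> inar L f \<in> Ob V \<and> outar L f \<in> Ob V"
  shows "structure_homs V L"
proof -
  have lp: "symmetric_monoidal_closed V" "locally_presentable \<kappa> \<rho> V"
    using V by (auto simp: locally_presentable_closed_def)
  interpret symmetric_monoidal_closed V by (rule lp(1))
  interpret small_cocomplete V \<kappa>
    using lp(2) \<kappa> by unfold_locales (simp_all add: locally_presentable_def)
  interpret structures_over V L by unfold_locales (use L in auto)
  obtain P where P: "small \<kappa> P" "P \<subseteq> presentable \<kappa> \<rho> V"
    and dense: "\<forall>A \<in> Ob V. \<exists>(J :: ('u, 'u) cat) Do Da \<iota>. small_category \<kappa> J \<and> filtered \<rho> J \<and>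
      is_functor J V Do Da \<and> Do ` Ob J \<subseteq> P \<and> is_colimit J V Do Da A \<iota>"
    using lp(2) unfolding locally_presentable_def by (elim conjE exE) (rule that)
  have P_Ob: "P \<subseteq> Ob V" using P(2) by (auto simp: presentable_def)
  have dense': "\<exists>(J :: ('u, 'u) cat) Do Da \<iota>. category J \<and> is_functor J V Do Da \<and>
        Do ` Ob J \<subseteq> P \<and> is_colimit J V Do Da A \<iota>" if "A \<in> Ob V" for A
    using bspec[OF dense that] unfolding small_category_def by blast
  show ?thesis
  proof
    fix A B assume A: "A \<in> structures V L" and B: "B \<in> structures V L"
    show "\<exists>e. is_joint_equalizer V (Sym L) (ihom V (fst A) (fst B)) (str_eq_l A B) (str_eq_r A B) e"
      by (rule joint_equalizer_exists[OF P(1) P_Ob dense' _ str_eq_ar[OF A B]]) (use A B in auto)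
  qed
qed

theorem theorem5p23:
  fixes \<kappa> :: "'u rel" and \<rho> :: "'l rel"
    and V :: "('o, 'a) smc" and \<G> :: "'o set"
    and L :: "('f, 'o) language"
    and F :: "'o \<Rightarrow> ('o, 'a, 'f) struct" and \<eta> :: "'o \<Rightarrow> 'a"
    and E :: "('o, 'a) ext_theory"
  assumes "small_universe \<kappa>"
    and "regular_cardinal \<rho>" and "\<rho> <o \<kappa>"
    and "locally_presentable_closed \<kappa> \<rho> V"
    and "\<G> \<subseteq> presentable \<kappa> \<rho> V" and "generator \<kappa> V \<G>"
    and "is_language \<kappa> \<rho> V L"
    and "left_adjoint_forget V L F \<eta>"
    and "ext_equational_theory \<kappa> \<rho> V L F E"
  shows "\<exists>(L' :: ('u, 'o) language) (E' :: ('o, 'a, 'u, 'u) eq_theory).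
    is_language \<kappa> \<rho> V L' \<and> equational_theory \<kappa> \<rho> V L' E' \<and>
    (\<forall>(s, t) \<in> E'. \<forall>r \<in> {s, t}. \<exists>X. \<exists>Y \<in> \<G>. is_term \<kappa> \<rho> V L' \<G> r X Y) \<and>
    isomorphic_over V (ext_Mod V L F \<eta> E) (forget V L) (Mod V L' E') (forget V L')"
proof -
  let ?p = "presentable \<kappa> \<rho> V"
  have lp: "symmetric_monoidal_closed V" "locally_presentable \<kappa> \<rho> V"
    and tens: "\<And>X Y. X \<in> ?p \<Longrightarrow> Y \<in> ?p \<Longrightarrow> X \<otimes>\<^bsub>V\<^esub> Y \<in> ?p"
    using assms(4) by (auto simp: locally_presentable_closed_def)
  interpret symmetric_monoidal_closed V by (rule lp(1))
  interpret universe \<kappa> using assms(1) by unfold_locales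
  have p_Ob: "?p \<subseteq> Ob V" by (auto simp: presentable_def)
  have lang: "f \<in> Sym L \<Longrightarrow> inar L f \<in> ?p \<and> outar L f \<in> ?p" for f
    using assms(7) by (simp add: is_language_def)
  have homs: "small \<kappa> (Hom V X Y)" if "X \<in> Ob V" "Y \<in> Ob V" for X Y
    using lp(2) that by (simp add: locally_presentable_def)
  obtain P where P: "small \<kappa> P" "P \<subseteq> ?p"
    and dense: "\<forall>A \<in> Ob V. \<exists>(J :: ('u, 'u) cat) Do Da \<iota>. small_category \<kappa> J \<and> filtered \<rho> J \<and>
      is_functor J V Do Da \<and> Do ` Ob J \<subseteq> P \<and> is_colimit J V Do Da A \<iota>"
    using lp(2) unfolding locally_presentable_def by (elim conjE exE) (rule that)
  interpret L: structure_homs V L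
    by (rule locally_presentable_structure_homs[OF assms(1,4)]) (use lang p_Ob in auto)
  interpret L: free_structures V L F \<eta> using assms(8) by unfold_locales
  interpret monoidal_generator V \<G>
    using assms(6) by unfold_locales (auto simp: generator_def dest: Hom_Ob, blast dest: Hom_Ob)
  \<comment> \<open>\<open>P\<close> serves density, the arities in \<open>E\<close> let its
    equations be written with the new symbols, and the arities of \<open>L\<close> are needed for
    the tensor products in \<open>D1\<close>.\<close>
  define D0 where "D0 = P \<union> inar L ` Sym L \<union> outar L ` Sym L \<union> fst ` E \<union> (fst \<circ> snd) ` E"
  \<comment> \<open>Tensoring with the generator provides the arities of the arguments and values of
    powers of symbols.\<close>
  define D1 where "D1 = D0 \<union> (\<lambda>(Z, X). Z \<otimes>\<^bsub>V\<^esub> X) ` (\<G> \<times> D0)"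
  have Ep: "X \<in> ?p \<and> Y \<in> ?p" if "(X, Y, s, t) \<in> E" for X Y s t
    using assms(9) that by (auto simp: ext_equational_theory_def is_ext_term_def)
  have D0: "D0 \<subseteq> ?p" using P(2) lang Ep by (auto simp: D0_def)
  have D1: "D1 \<subseteq> ?p" using D0 tens assms(5) by (auto simp: D1_def)
  have sm: "small \<kappa> (Sym L)" "small \<kappa> E" "small \<kappa> \<G>"
    using assms(6,7,9) by (auto simp: is_language_def ext_equational_theory_def generator_def)
  have smD0: "small \<kappa> D0" unfolding D0_def using sm P(1) by (intro small_Un small_image)
  have smD1: "small \<kappa> D1" unfolding D1_def using sm smD0 by (intro small_Un small_image small_Sigma)
  interpret L: presentation V L F \<eta> \<G> \<kappa> \<rho> P D0 D1
    using bspec[OF dense] D1 by unfold_locales (auto simp: D0_def D1_def)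
  let ?S = "Inl ` Sym L \<union> Inr ` {(X, s). X \<in> D0 \<and> s \<in> Ar V \<and> trg V s = L.U X \<and> src V s \<in> D1}"
  have "small \<kappa> {(X, s). X \<in> D0 \<and> s \<in> Ar V \<and> trg V s = L.U X \<and> src V s \<in> D1}"
  proof (rule small_mono)
    show "small \<kappa> (Sigma D0 (\<lambda>X. \<Union>Y\<in>D1. Hom V Y (L.U X)))"
      using smD0 smD1 by (auto intro!: small_Sigma small_UNION homs)
  qed (auto simp: Hom_def)
  then have "small \<kappa> ?S" using sm by simp
  then obtain enc :: "'f + 'o \<times> 'a \<Rightarrow> 'u" where enc: "inj_on enc ?S" using small_embeds by blast
  interpret L: ext_presentation V L F \<eta> \<G> \<kappa> \<rho> P D0 D1 E enc
  proof
    show "X \<in> D0 \<and> Y \<in> D0" if "(X, Y, s, t) \<in> E" for X Y s t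
      using image_eqI[OF _ that, of _ fst] image_eqI[OF _ that, of _ "fst \<circ> snd"] by (auto simp: D0_def)
  qed (use assms homs sm smD0 smD1 enc in auto)
  let ?M = "{A. \<forall>(X, Y, s, t) \<in> E. ext_interp V L F \<eta> A X Y s = ext_interp V L F \<eta> A X Y t}"
  let ?M' = "{A. \<forall>(s, t) \<in> L.E'. interp V L.L' A s = interp V L.L' A t}"
  have L': "structure_homs V L.L'"
    by (rule locally_presentable_structure_homs[OF assms(1,4)]) auto
  \<comment> \<open>So the models of the new theory are exactly the expansions of the models of
    \<open>E\<close>, which makes \<open>L.expand\<close> and \<open>L.reduct\<close> mutually
    inverse on models.\<close>
  have iff: "A \<in> ?M' \<longleftrightarrow> (\<forall>(X, s) \<in> L.ext_ops. L.eint A X s = L.eop (L.reduct A) X s) \<and> L.reduct A \<in> ?M"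
    if "A \<in> structures V L.L'" for A
    using L.satisfies_iff[OF that] L.base_iff[OF that] by simp
  have ex: "L.expand A \<in> ?M'" if "A \<in> structures V L" "A \<in> ?M" for A
    using iff[OF L.expand_structure[OF that(1)]] that by auto
  have "isomorphic_over V (full_vsubcat (Str V L) ?M) (forget V L) (full_vsubcat (Str V L.L') ?M') (forget V L.L')"
  proof (rule isomorphic_overI[OF L.structure_homs_axioms L', where S = L.expand and R = L.reduct])
    show "L.expand (L.reduct A) = A" if "A \<in> structures V L.L'" "A \<in> ?M'" for A
      using L.expand_reduct[OF that(1)] iff[OF that(1)] that(2) by blast
    show "L.reduct A \<in> structures V L \<and> L.reduct A \<in> ?M \<and> fst (L.reduct A) = fst A"
      if "A \<in> structures V L.L'" "A \<in> ?M'" for A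
      using iff[OF that(1)] that by simp
    show "L.expand A \<in> structures V L.L' \<and> L.expand A \<in> ?M' \<and> fst (L.expand A) = fst A"
      if "A \<in> structures V L" "A \<in> ?M" for A
      using ex[OF that] that by simp
  qed (simp_all add: L.imor_expand)
  moreover have "\<forall>(s, t) \<in> L.E'. \<forall>r \<in> {s, t}. \<exists>X. \<exists>Y \<in> \<G>. is_term \<kappa> \<rho> V L.L' \<G> r X Y"
    by (auto elim!: L.E'_is_term)
  ultimately show ?thesis
    using L.language_L' L.equational_theory_E' unfolding ext_Mod_def Mod_def by blast
qed

end
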